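(* Let $m>1$ be an integer, let $\ell$ be an odd integer, and let $K$, $\mu$, $\Phi$, $f_n$, $S$ be as defined in the context. The canonical map $P:\mathrm{Aut}(K)\to \mathrm{Aut}(K/Z_2(K))$ is a group homomorphism with kernel $\mathrm{Aut}_2(K)$ and image $(S\langle\mu,\Phi\rangle)^P$, so that $\mathrm{Aut}(K)=\mathrm{Aut}_2(K)S\langle \mu,\Phi\rangle$. Moreover, if $m>2$ then $$\mathrm{Aut}(K)/\mathrm{Aut}_2(K)\cong \big((\mathbb{Z}/2^{m-1}\mathbb{Z})^\times\times(\mathbb{Z}/2\mathbb{Z})^2\big)\rtimes\mathbb{Z}/2\mathbb{Z},$$ with $\mathbb{Z}/2\mathbb{Z}$ acting by inversion on $(\mathbb{Z}/2^{m-1}\mathbb{Z})^\times$ and by switching factors on $(\mathbb{Z}/2\mathbb{Z})^2$, and if $m=2$ then $\mathrm{Aut}(K)/\mathrm{Aut}_2(K)\cong\mathrm{GL}_2(\mathbb{Z}/2\mathbb{Z})$. In particular, $\mathrm{Aut}(K)$ has order $2^{7m-1}$ if $m>2$, and $2^{11}\times 3$ if $m=2$, in which case $P$ is surjective. Furthermore, if $m>2$ then every element of $\mathrm{Aut}(K)$ can be written uniquely in the form $gf_n\Phi^i(\Phi^\mu)^j\mu^k$, where $g\in\mathrm{Aut}_2(K)$, $1\le n<2^{m-1}$ is odd, and $0\le i,j,k\le 1$; and if $m=2$ then every element of $\mathrm{Aut}(K)$ can be written uniquely in the form $g(\mu\Phi)^i\mu^k$, where $g\in\mathrm{Aut}_2(K)$,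 $0\le i\le 2$ and $0\le k\le 1$.
   Context: Notation: $[a,b]=a^{-1}b^{-1}ab$, $b^a=a^{-1}ba$, $\alpha=1+2^m\ell$, $r=2^{m-2}$. Function composition proceeds from left to right, and $x^P$ denotes the image of $x$ under $P$; $\Phi^\mu=\mu^{-1}\Phi\mu$. Let $$J=\langle A,B\mid A^{[A,B]}=A^{\alpha},\ B^{[B,A]}=B^{\alpha},\ A^{2^{3m-1}}=B^{2^{3m-1}}=1\rangle$$ and $K=J/Z_2(J)$, which has the presentation $$K=\langle a,b\mid a^{[a,b]}=a^{\alpha},\ b^{[b,a]}=b^{\alpha},\ a^{2^{2m-1}}=b^{2^{2m-1}}=[a,b]^{2^{m-1}}=1\rangle.$$ For a group $T$, $Z_0(T)=1, Z_1(T),Z_2(T),\dots$ denotes the upper central series, and $\mathrm{Aut}_i(T)$ is the kernel of the canonical map $\mathrm{Aut}(T)\to\mathrm{Aut}(T/Z_i(T))$. The following automorphisms of $K$ exist: $\mu$, given by $a\mapsto b$, $b\mapsto a$; $\Phi$, given by $a\mapsto ab^r$, $b\mapsto b$; and, for each odd $n\in\mathbb{Z}$, $f_n$, given by $a\mapsto a^n$, $b\mapsto b^t$, where $t\in\mathbb{Z}$ satisfies $nt\equiv 1\mod 2^{2m-1}$. The set $S=\{f_n: n \text{ odd}\}$ is a subgroup of $\mathrm{Aut}(K)$, isomorphic to $(\mathbb{Z}/2^{2m-1}\mathbb{Z})^\times$. *)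

theory Defs
  imports
    "HOL-Algebra.Algebra"
    "HOL-Number_Theory.Number_Theory"
    "HOL-Analysis.Analysis"
    "HOL-Library.Z2"
begin

section \<open>Groups given by generators and relations\<close>

text \<open>Elements of the free group are the freely reduced words. The letter (x, True) stands for the
  generator x and (x, False) for its inverse.\<close>

type_synonym 'x word = "('x \<times> bool) list"

fun freely_reduced :: "'x word \<Rightarrow> bool" where
  "freely_reduced [] \<longleftrightarrow> True"
| "freely_reduced [p] \<longleftrightarrow> True"
| "freely_reduced (p # q # w) \<longleftrightarrow> \<not> (fst p = fst q \<and> snd p \<noteq> snd q) \<and> freely_reduced (q # w)"

fun cons_reduce :: "'x \<times> bool \<Rightarrow> 'x word \<Rightarrow> 'x word" where
  "cons_reduce p [] = [p]"
| "cons_reduce p (q # w) = (if fst p = fst q \<and> snd p \<noteq> snd q then w else p # q # w)"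

definition free_group :: "'x word monoid" where
  "free_group = \<lparr>carrier = {w. freely_reduced w}, monoid.mult = (\<lambda>u v. foldr cons_reduce u v), one = []\<rparr>"

definition free_gen :: "'x \<Rightarrow> 'x word" where
  "free_gen x = [(x, True)]"

definition normal_closure :: "('a, 'c) monoid_scheme \<Rightarrow> 'a set \<Rightarrow> 'a set" where
  "normal_closure G R = \<Inter> {N. N \<lhd> G \<and> R \<subseteq> N}"

text \<open>The group G, with the elements s x as images of the generators x, is presented by the
  relators R.\<close>

definition has_presentation ::
    "('a, 'c) monoid_scheme \<Rightarrow> ('x \<Rightarrow> 'a) \<Rightarrow> 'x word set \<Rightarrow> bool" where
  "has_presentation G s R \<longleftrightarrow> group G \<and>
     (\<exists>h \<in> hom free_group G. (\<forall>x. h (free_gen x) = s x) \<and>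
        h ` carrier free_group = carrier G \<and>
        kernel free_group G h = normal_closure free_group R)"

lemma reduced_Cons: "freely_reduced (p # w) \<Longrightarrow> freely_reduced w"
  by (cases w) auto

lemma reduced_cons_reduce: "freely_reduced w \<Longrightarrow> freely_reduced (cons_reduce p w)"
  by (cases w) (auto dest: reduced_Cons)

lemma reduced_foldr: "freely_reduced v \<Longrightarrow> freely_reduced (foldr cons_reduce u v)"
  by (induction u) (auto intro: reduced_cons_reduce)

lemma cons_reduce_cancel:
  assumes "freely_reduced w"
  shows "cons_reduce (x, s) (cons_reduce (x, \<not> s) w) = w"
proof (cases w)
  case (Cons q w')
  show ?thesis
  proof (cases w')
    case (Cons q' w'')
    then show ?thesis using assms \<open>w = q # w'\<close> by (cases q; cases q') auto
  qed (use Cons in \<open>cases q; auto\<close>)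
qed simp

lemma foldr_cons_reduce:
  assumes "freely_reduced w"
  shows "foldr cons_reduce (cons_reduce p v) w = cons_reduce p (foldr cons_reduce v w)"
proof (cases v)
  case (Cons q v')
  obtain x s where p: "p = (x, s)" by fastforce
  show ?thesis
  proof (cases "fst p = fst q \<and> snd p \<noteq> snd q")
    case True
    then have "q = (x, \<not> s)" using p by (cases q) auto
    then show ?thesis using Cons p cons_reduce_cancel[OF reduced_foldr[OF assms]] by simp
  next
    case False
    then have "cons_reduce p v = p # v" using Cons by auto
    then show ?thesis by simp
  qed
qed simp

lemma foldr_cons_reduce_assoc:
  assumes "freely_reduced w"
  shows "foldr cons_reduce (foldr cons_reduce u v) w = foldr cons_reduce u (foldr cons_reduce v w)"
  by (induction u) (simp_all add: foldr_cons_reduce assms)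

lemma foldr_cons_reduce_Nil: "freely_reduced w \<Longrightarrow> foldr cons_reduce w [] = w"
  by (induction w rule: freely_reduced.induct) auto

lemma free_group_left_inverse:
  "\<exists>v. freely_reduced v \<and> foldr cons_reduce v w = []" if "freely_reduced w"
  using that
proof (induction w)
  case (Cons p w)
  obtain x s where p: "p = (x, s)" by fastforce
  from Cons obtain v where v: "freely_reduced v" "foldr cons_reduce v w = []"
    using reduced_Cons by blast
  let ?v = "foldr cons_reduce v [(x, \<not> s)]"
  have "foldr cons_reduce ?v (p # w) = foldr cons_reduce v (foldr cons_reduce [(x, \<not> s)] (p # w))"
    by (rule foldr_cons_reduce_assoc) (use Cons in auto)
  also have "\<dots> = []" using v p by simp
  finally show ?case using reduced_foldr[of "[(x, \<not> s)]" v] by auto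
qed (auto intro: exI[of _ "[]"])

lemma group_free_group: "group (free_group :: 'x word monoid)"
proof (rule groupI)
  fix w :: "'x word"
  assume "w \<in> carrier free_group"
  then show "\<exists>v \<in> carrier free_group. v \<otimes>\<^bsub>free_group\<^esub> w = \<one>\<^bsub>free_group\<^esub>"
    using free_group_left_inverse[of w] by (auto simp: free_group_def)
qed (auto simp: free_group_def reduced_foldr foldr_cons_reduce_assoc)

lemma normal_normal_closure:
  assumes "group G" "R \<subseteq> carrier G"
  shows "normal_closure G R \<lhd> G"
proof -
  interpret group G by fact
  let ?C = "{N. N \<lhd> G \<and> R \<subseteq> N}"
  have ne: "carrier G \<in> ?C" using assms(2) normal_self by auto
  have "subgroup (\<Inter> ?C) G"
    using ne by (intro subgroups_Inter) (auto dest: normal_imp_subgroup)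
  moreover have "x \<otimes>\<^bsub>G\<^esub> h \<otimes>\<^bsub>G\<^esub> inv\<^bsub>G\<^esub> x \<in> \<Inter> ?C" if "x \<in> carrier G" "h \<in> \<Inter> ?C" for x h
    using that by (auto intro: normal.inv_op_closed2)
  ultimately show ?thesis
    unfolding normal_closure_def by (simp add: normal_inv_iff)
qed

text \<open>Every set of relators does present a group.\<close>

lemma has_presentation_quotient:
  fixes R :: "'x word set"
  assumes "R \<subseteq> carrier free_group"
  defines "N \<equiv> normal_closure free_group R"
  shows "has_presentation (free_group Mod N) (\<lambda>x. N #>\<^bsub>free_group\<^esub> free_gen x) R"
proof -
  interpret normal N free_group
    unfolding N_def by (rule normal_normal_closure[OF group_free_group assms(1)])
  let ?h = "\<lambda>x. N #>\<^bsub>free_group\<^esub> x"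
  have "?h x = N \<longleftrightarrow> x \<in> N" if "x \<in> carrier free_group" for x
    using coset_join1[OF _ that is_subgroup] coset_join2[OF that is_subgroup] by blast
  then have "kernel free_group (free_group Mod N) ?h = N"
    using subset by (auto simp: kernel_def FactGroup_def)
  moreover have "?h ` carrier free_group = carrier (free_group Mod N)"
    by (auto simp: FactGroup_def RCOSETS_def)
  moreover have "?h \<in> hom free_group (free_group Mod N)"
    by (rule r_coset_hom_Mod)
  ultimately show ?thesis
    unfolding has_presentation_def N_def[symmetric]
    using factorgroup_is_group by (intro conjI bexI[of _ ?h]) simp_all
qed

section \<open>Commutators, centre and automorphisms\<close>

definition commutator :: "('a, 'c) monoid_scheme \<Rightarrow> 'a \<Rightarrow> 'a \<Rightarrow> 'a" where
  "commutator G x y = inv\<^bsub>G\<^esub> x \<otimes>\<^bsub>G\<^esub> inv\<^bsub>G\<^esub> y \<otimes>\<^bsub>G\<^esub> x \<otimes>\<^bsub>G\<^esub> y"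

text \<open>conj_by G x y is \<open>x\<^sup>y = y\<^sup>-\<^sup>1 x y\<close>.\<close>

definition conj_by :: "('a, 'c) monoid_scheme \<Rightarrow> 'a \<Rightarrow> 'a \<Rightarrow> 'a" where
  "conj_by G x y = inv\<^bsub>G\<^esub> y \<otimes>\<^bsub>G\<^esub> x \<otimes>\<^bsub>G\<^esub> y"

definition center :: "('a, 'c) monoid_scheme \<Rightarrow> 'a set" where
  "center G = {z \<in> carrier G. \<forall>x \<in> carrier G. z \<otimes>\<^bsub>G\<^esub> x = x \<otimes>\<^bsub>G\<^esub> z}"

primrec upper_central :: "('a, 'c) monoid_scheme \<Rightarrow> nat \<Rightarrow> 'a set" where
  "upper_central G 0 = {\<one>\<^bsub>G\<^esub>}"
| "upper_central G (Suc i) =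
     {x \<in> carrier G. upper_central G i #>\<^bsub>G\<^esub> x \<in> center (G Mod upper_central G i)}"

text \<open>Automorphisms are composed from left to right, so this is the opposite of the library's
  automorphism group.\<close>

definition Aut :: "('a, 'c) monoid_scheme \<Rightarrow> ('a \<Rightarrow> 'a) monoid" where
  "Aut G = AutoGroup G \<lparr>monoid.mult := \<lambda>f g. g \<otimes>\<^bsub>AutoGroup G\<^esub> f\<rparr>"

definition induced_aut :: "('a, 'c) monoid_scheme \<Rightarrow> 'a set \<Rightarrow> ('a \<Rightarrow> 'a) \<Rightarrow> ('a set \<Rightarrow> 'a set)" where
  "induced_aut G N \<psi> = (\<lambda>C \<in> carrier (G Mod N). \<psi> ` C)"

definition Aut_i :: "('a, 'c) monoid_scheme \<Rightarrow> nat \<Rightarrow> ('a \<Rightarrow> 'a) set" where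
  "Aut_i G i =
     kernel (Aut G) (Aut (G Mod upper_central G i)) (induced_aut G (upper_central G i))"

section \<open>Semidirect products and general linear groups\<close>

definition semidirect_product ::
    "('a, 'c) monoid_scheme \<Rightarrow> ('b, 'd) monoid_scheme \<Rightarrow> ('b \<Rightarrow> 'a \<Rightarrow> 'a) \<Rightarrow> ('a \<times> 'b) monoid" where
  "semidirect_product N H \<theta> =
     \<lparr>carrier = carrier N \<times> carrier H,
      monoid.mult = (\<lambda>(n, h) (n', h'). (n \<otimes>\<^bsub>N\<^esub> \<theta> h n', h \<otimes>\<^bsub>H\<^esub> h')),
      one = (\<one>\<^bsub>N\<^esub>, \<one>\<^bsub>H\<^esub>)\<rparr>"

definition GL :: "('a::field ^ 'n ^ 'n) monoid" where
  "GL = \<lparr>carrier = {M. invertible M}, monoid.mult = (**), one = mat 1\<rparr>"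

text \<open>\<open>((\<int>/q)\<^sup>\<times> \<times> (\<int>/2)\<^sup>2) \<rtimes> \<int>/2\<close>, where the generator of \<open>\<int>/2\<close> inverts the units
  and switches the two factors \<open>\<int>/2\<close>.\<close>

definition units_semidirect :: "int \<Rightarrow> ((int \<times> int \<times> int) \<times> int) monoid" where
  "units_semidirect q =
     (let U = units_of (residue_ring q); C = integer_mod_group 2 in
      semidirect_product (U \<times>\<times> (C \<times>\<times> C)) C
        (\<lambda>k (u, x, y). if k = 0 then (u, x, y) else (inv\<^bsub>U\<^esub> u, y, x)))"

section \<open>The group K and its automorphisms\<close>

datatype gen2 = GenA | GenB

text \<open>A relation u = v is encoded by the relator \<open>u v\<^sup>-\<^sup>1\<close>; here \<open>\<alpha> = 1 + 2\<^sup>m \<ell>\<close> may be negative.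
  The relators are those of the presentation of \<open>K = J/Z\<^sub>2(J)\<close>.\<close>

definition K_relators :: "nat \<Rightarrow> int \<Rightarrow> gen2 word set" where
  "K_relators m l =
     (let F = free_group; a = free_gen GenA; b = free_gen GenB; \<alpha> = 1 + 2 ^ m * l in
      {conj_by F a (commutator F a b) \<otimes>\<^bsub>F\<^esub> inv\<^bsub>F\<^esub> (a [^]\<^bsub>F\<^esub> \<alpha>),
       conj_by F b (commutator F b a) \<otimes>\<^bsub>F\<^esub> inv\<^bsub>F\<^esub> (b [^]\<^bsub>F\<^esub> \<alpha>),
       a [^]\<^bsub>F\<^esub> (2 ^ (2 * m - 1) :: nat),
       b [^]\<^bsub>F\<^esub> (2 ^ (2 * m - 1) :: nat),
       commutator F a b [^]\<^bsub>F\<^esub> (2 ^ (m - 1) :: nat)})"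

text \<open>An automorphism of a group generated by a and b is determined by the images of a and b.\<close>

definition aut_with :: "('a, 'c) monoid_scheme \<Rightarrow> 'a \<Rightarrow> 'a \<Rightarrow> 'a \<Rightarrow> 'a \<Rightarrow> ('a \<Rightarrow> 'a)" where
  "aut_with G a b x y = (THE \<psi>. \<psi> \<in> auto G \<and> \<psi> a = x \<and> \<psi> b = y)"

definition K_mu :: "('a, 'c) monoid_scheme \<Rightarrow> 'a \<Rightarrow> 'a \<Rightarrow> ('a \<Rightarrow> 'a)" where
  "K_mu K a b = aut_with K a b b a"

definition K_Phi :: "('a, 'c) monoid_scheme \<Rightarrow> 'a \<Rightarrow> 'a \<Rightarrow> nat \<Rightarrow> ('a \<Rightarrow> 'a)" where
  "K_Phi K a b m = aut_with K a b (a \<otimes>\<^bsub>K\<^esub> b [^]\<^bsub>K\<^esub> (2 ^ (m - 2) :: nat)) b"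

definition K_f :: "('a, 'c) monoid_scheme \<Rightarrow> 'a \<Rightarrow> 'a \<Rightarrow> nat \<Rightarrow> int \<Rightarrow> ('a \<Rightarrow> 'a)" where
  "K_f K a b m n =
     (THE \<psi>. \<exists>t::int. [n * t = 1] (mod 2 ^ (2 * m - 1)) \<and>
        \<psi> \<in> auto K \<and> \<psi> a = a [^]\<^bsub>K\<^esub> n \<and> \<psi> b = b [^]\<^bsub>K\<^esub> t)"

definition K_S :: "('a, 'c) monoid_scheme \<Rightarrow> 'a \<Rightarrow> 'a \<Rightarrow> nat \<Rightarrow> ('a \<Rightarrow> 'a) set" where
  "K_S K a b m = {K_f K a b m n |n. odd n}"

end

theory Submission
  imports Defs
begin

text \<open>
  Let c = [a,b], u = 2^m l, q = 2^(m-1) and N = 2^(2m-1) = 2 q q. Conjugation by b sends a to ac, so it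
  sends \<open>a\<^sup>n\<close> to \<open>(ac)\<^sup>n\<close>, which the relations collect into a power of a times \<open>c\<^sup>n\<close>. For n a
  multiple of 2 q nothing but \<open>a\<^sup>n\<close> remains: these powers of a, and by symmetry those of b, are
  central. Hence K has class three and consists of the normal forms \<open>a\<^sup>x b\<^sup>y c\<^sup>z\<close>. Their multiplication is
  given by polynomials in the exponents, and these polynomials define a group structure on the
  triples of residues modulo N, N and q which satisfies the relations of K. By von Dyck's theorem K
  maps onto it, so exponents are unique (\<open>E_eq_iff\<close>, \<open>E_mult\<close>). Everything else is arithmetic of
  exponents. In particular \<open>Z\<^sub>2(K)\<close> consists of the normal forms with x and y divisible by q, so
  \<open>K/Z\<^sub>2(K)\<close> is the square of the integers modulo q.

  Let g and h have exponents (x, y) and (x', y') and put d = x y' - x' y. The commutator of g and h is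
  \<open>c\<^sup>d\<close> up to a central factor, and \<open>g\<^sup>u\<close> has exponents u x and u y. So the relation
  \<open>g\<^bsup>[g,h]\<^esup> = g\<^bsup>1+u\<^esup>\<close> says that q divides x (d - 1) and y (d + 1), and the relation for h says that q
  divides x' (d + 1) and y' (d - 1); the order relations always hold (\<open>satisfies_K_relations_iff\<close>). The
  endomorphism determined by g and h is bijective exactly when d is odd: if it is, the endomorphism is
  injective on the centre and hence on the nilpotent group K (\<open>automorphism_exists\<close>,
  \<open>automorphism_condition\<close>).

  These conditions depend on the matrix of exponents modulo q only. So the elements of \<open>Aut\<^sub>2(K)\<close>
  correspond to the pairs in \<open>a Z\<^sub>2(K) \<times> b Z\<^sub>2(K)\<close>, which gives its order, and \<open>Aut(K)/Aut\<^sub>2(K)\<close> is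
  the group of matrices that satisfy the conditions. If m > 2 these are the matrices with diagonal
  (n, 1/n) and multiples of q/2 off the diagonal, and those obtained by interchanging the columns
  (\<open>shape_exists\<close>); if m = 2 they are all invertible matrices modulo two. In both cases the products of
  named automorphisms in the theorem represent each matrix once. The unique factorisation, the order
  and the structure of the quotient follow by the general facts on a transversal of a kernel
  (\<open>kernel_transversal\<close>).
\<close>

section \<open>Homomorphisms out of a presented group\<close>

definition word_eval :: "('a, 'c) monoid_scheme \<Rightarrow> ('x \<Rightarrow> 'a) \<Rightarrow> 'x word \<Rightarrow> 'a" where
  "word_eval G t w =
     foldr (\<lambda>p g. (if snd p then t (fst p) else inv\<^bsub>G\<^esub> t (fst p)) \<otimes>\<^bsub>G\<^esub> g) w \<one>\<^bsub>G\<^esub>"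

lemma (in group) word_eval_closed:
  assumes "\<And>x. t x \<in> carrier G"
  shows "word_eval G t w \<in> carrier G"
  using assms by (induction w) (auto simp: word_eval_def)

lemma (in group) word_eval_cons_reduce:
  assumes "\<And>x. t x \<in> carrier G"
  shows "word_eval G t (cons_reduce p w) = word_eval G t (p # w)"
proof (cases w)
  case (Cons q w')
  have c: "word_eval G t w' \<in> carrier G" using assms by (rule word_eval_closed)
  then have "y \<otimes> (inv y \<otimes> word_eval G t w') = word_eval G t w'"
    "inv y \<otimes> (y \<otimes> word_eval G t w') = word_eval G t w'" if "y \<in> carrier G" for y
    using that by (simp_all flip: m_assoc)
  then show ?thesis using Cons assms c by (cases p; cases q) (auto simp: word_eval_def)
qed simp

lemma (in group) word_eval_hom:
  fixes t :: "'x \<Rightarrow> 'a"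
  assumes "\<And>x. t x \<in> carrier G"
  shows "word_eval G t \<in> hom free_group G"
proof (rule homI)
  fix u v :: "'x word"
  have "word_eval G t (foldr cons_reduce u v) = word_eval G t u \<otimes> word_eval G t v"
  proof (induction u)
    case Nil
    then show ?case using word_eval_closed[of t v] assms by (simp add: word_eval_def)
  next
    case (Cons p u)
    have *: "word_eval G t (p # w) = (if snd p then t (fst p) else inv t (fst p)) \<otimes> word_eval G t w" for w
      by (simp add: word_eval_def)
    show ?case
      using Cons word_eval_closed[of t u] word_eval_closed[of t v] assms
      by (simp add: word_eval_cons_reduce * m_assoc)
  qed
  then show "word_eval G t (u \<otimes>\<^bsub>free_group\<^esub> v) = word_eval G t u \<otimes> word_eval G t v"
    by (simp add: free_group_def)
qed (use word_eval_closed assms in auto)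

lemma (in group) word_eval_free_gen:
  assumes "\<And>x. t x \<in> carrier G"
  shows "word_eval G t (free_gen x) = t x"
  using assms by (simp add: word_eval_def free_gen_def)

lemma free_gen_closed: "free_gen x \<in> carrier free_group"
  by (simp add: free_gen_def free_group_def)

lemma free_group_Cons_True:
  "freely_reduced ((x, True) # w) \<Longrightarrow> (x, True) # w = free_gen x \<otimes>\<^bsub>free_group\<^esub> w"
  by (cases w) (auto simp: free_gen_def free_group_def)

lemma inv_free_gen: "inv\<^bsub>free_group\<^esub> (free_gen x) = [(x, False)]"
  by (rule group.inv_equality[OF group_free_group]) (auto simp: free_gen_def free_group_def)

lemma free_group_Cons_False:
  "freely_reduced ((x, False) # w) \<Longrightarrow> (x, False) # w = inv\<^bsub>free_group\<^esub> (free_gen x) \<otimes>\<^bsub>free_group\<^esub> w"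
  unfolding inv_free_gen by (cases w) (auto simp: free_group_def)

lemma hom_inv: "h \<in> hom G H \<Longrightarrow> group G \<Longrightarrow> group H \<Longrightarrow> x \<in> carrier G \<Longrightarrow> h (inv\<^bsub>G\<^esub> x) = inv\<^bsub>H\<^esub> h x"
  by (simp add: group_hom.hom_inv group_hom_def group_hom_axioms_def)

text \<open>By induction on reduced words: every word is a product of letters, which lie in the
  subgroup.\<close>

lemma presented_group_generated:
  assumes "has_presentation G s R" "subgroup N G" "\<And>x. s x \<in> N"
  shows "carrier G \<subseteq> N"
proof -
  obtain h where G: "group G" and h: "h \<in> hom free_group G" "\<And>x. h (free_gen x) = s x"
      "h ` carrier free_group = carrier G"
    using assms(1) unfolding has_presentation_def by blast
  have "h w \<in> N" if "freely_reduced w" for w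
    using that
  proof (induction w)
    case Nil
    have "h \<one>\<^bsub>free_group\<^esub> = \<one>\<^bsub>G\<^esub>" using hom_one[OF h(1) group_free_group G] .
    then show ?case using assms(2) subgroup.one_closed by (force simp: free_group_def)
  next
    case (Cons p w)
    then have w: "w \<in> carrier free_group" "h w \<in> N"
      using reduced_Cons[of p w] by (auto simp: free_group_def)
    obtain x b where p: "p = (x, b)" by fastforce
    have "h (inv\<^bsub>free_group\<^esub> (free_gen x)) = inv\<^bsub>G\<^esub> s x"
      using h(1,2) G by (simp add: hom_inv group_free_group free_gen_closed)
    then have i: "h (inv\<^bsub>free_group\<^esub> (free_gen x)) \<in> N"
      using assms(2,3) by (simp add: subgroup.m_inv_closed)
    have "h (p # w) = h (if b then free_gen x else inv\<^bsub>free_group\<^esub> (free_gen x)) \<otimes>\<^bsub>G\<^esub> h w"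
    proof (cases b)
      case True
      then show ?thesis using Cons(2) p free_group_Cons_True[of x w] w h(1) free_gen_closed[of x]
        by (simp add: hom_mult)
    next
      case False
      then show ?thesis using Cons(2) p free_group_Cons_False[of x w] w h(1) free_gen_closed[of x]
        by (simp add: hom_mult group.inv_closed group_free_group)
    qed
    then show ?case using w i h(2) assms by (auto intro: subgroup.m_closed)
  qed
  then have "h ` carrier free_group \<subseteq> N" by (auto simp: free_group_def)
  then show ?thesis using h(3) by simp
qed

text \<open>Evaluating words at images that satisfy the relators kills the normal closure, hence does
  not depend on the word chosen to represent an element.\<close>

theorem von_Dyck:
  assumes "has_presentation G s R" "R \<subseteq> carrier free_group" "group H" "\<And>x. t x \<in> carrier H"
    and rel: "\<And>w. w \<in> R \<Longrightarrow> word_eval H t w = \<one>\<^bsub>H\<^esub>"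
  shows "\<exists>\<phi> \<in> hom G H. \<forall>x. \<phi> (s x) = t x"
proof -
  obtain h where G: "group G" and h: "h \<in> hom free_group G" "\<And>x. h (free_gen x) = s x"
      "h ` carrier free_group = carrier G" "kernel free_group G h = normal_closure free_group R"
    using assms(1) unfolding has_presentation_def by blast
  let ?e = "word_eval H t"
  interpret H: group H by fact
  interpret gh: group_hom free_group G h
    using G h(1) group_free_group by (simp add: group_hom_def group_hom_axioms_def)
  interpret e: group_hom free_group H ?e
    using H.word_eval_hom[of t] assms(4) group_free_group
    by (simp add: group_hom_def group_hom_axioms_def)
  have "normal_closure free_group R \<subseteq> kernel free_group H ?e"
    unfolding normal_closure_def using e.normal_kernel assms(2) rel by (auto simp: kernel_def)
  then have *: "?e v = ?e w"
    if "v \<in> carrier free_group" "w \<in> carrier free_group" "h v = h w" for v w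
  proof -
    have "v \<otimes>\<^bsub>free_group\<^esub> inv\<^bsub>free_group\<^esub> w \<in> kernel free_group G h"
      using that gh.hom_closed by (simp add: kernel_def)
    then have "?e (v \<otimes>\<^bsub>free_group\<^esub> inv\<^bsub>free_group\<^esub> w) = \<one>\<^bsub>H\<^esub>"
      using \<open>normal_closure free_group R \<subseteq> kernel free_group H ?e\<close> h(4) by (auto simp: kernel_def)
    then have "?e v \<otimes>\<^bsub>H\<^esub> inv\<^bsub>H\<^esub> ?e w = \<one>\<^bsub>H\<^esub>" using that by simp
    then show ?thesis using that by (metis H.inv_closed H.inv_equality H.inv_inv e.hom_closed)
  qed
  have *: "?e (SOME v. v \<in> carrier free_group \<and> h v = g) = ?e w"
    if "g = h w" "w \<in> carrier free_group" for g w
  proof -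
    have "(SOME v. v \<in> carrier free_group \<and> h v = g) \<in> carrier free_group \<and>
        h (SOME v. v \<in> carrier free_group \<and> h v = g) = g"
      by (rule someI[of _ w]) (use that in simp)
    then show ?thesis using *[of _ w] that by metis
  qed
  let ?\<phi> = "\<lambda>g. ?e (SOME v. v \<in> carrier free_group \<and> h v = g)"
  have "?\<phi> \<in> hom G H"
  proof (rule homI)
    fix x y assume "x \<in> carrier G" "y \<in> carrier G"
    then obtain v w where vw: "v \<in> carrier free_group" "w \<in> carrier free_group" "x = h v" "y = h w"
      using h(3) by (metis imageE)
    show "?\<phi> x \<in> carrier H" using *[OF vw(3,1)] vw by simp
    show "?\<phi> (x \<otimes>\<^bsub>G\<^esub> y) = ?\<phi> x \<otimes>\<^bsub>H\<^esub> ?\<phi> y"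
      using *[OF vw(3,1)] *[OF vw(4,2)] *[of "x \<otimes>\<^bsub>G\<^esub> y" "v \<otimes>\<^bsub>free_group\<^esub> w"] vw by simp
  qed
  moreover have "?\<phi> (s x) = t x" for x
    using *[of "s x" "free_gen x"] h(2)[of x] free_gen_closed[of x] H.word_eval_free_gen[of t x] assms(4)
    by simp
  ultimately show ?thesis by (intro bexI[of _ ?\<phi>] allI)
qed

text \<open>The equations that the relators of K express for a pair of elements of an arbitrary group.\<close>

definition satisfies_K_relations :: "('a, 'c) monoid_scheme \<Rightarrow> nat \<Rightarrow> int \<Rightarrow> 'a \<Rightarrow> 'a \<Rightarrow> bool" where
  "satisfies_K_relations G m l x y \<longleftrightarrow>
     conj_by G x (commutator G x y) = x [^]\<^bsub>G\<^esub> (1 + 2 ^ m * l) \<and>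
     conj_by G y (commutator G y x) = y [^]\<^bsub>G\<^esub> (1 + 2 ^ m * l) \<and>
     x [^]\<^bsub>G\<^esub> (2 ^ (2 * m - 1) :: nat) = \<one>\<^bsub>G\<^esub> \<and>
     y [^]\<^bsub>G\<^esub> (2 ^ (2 * m - 1) :: nat) = \<one>\<^bsub>G\<^esub> \<and>
     commutator G x y [^]\<^bsub>G\<^esub> (2 ^ (m - 1) :: nat) = \<one>\<^bsub>G\<^esub>"

lemma (in group) commutator_closed [simp, intro]:
  "x \<in> carrier G \<Longrightarrow> y \<in> carrier G \<Longrightarrow> commutator G x y \<in> carrier G"
  by (simp add: commutator_def)

lemma (in group) conj_by_closed [simp, intro]:
  "x \<in> carrier G \<Longrightarrow> y \<in> carrier G \<Longrightarrow> conj_by G x y \<in> carrier G"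
  by (simp add: conj_by_def)

lemma (in group_hom) hom_commutator:
  "x \<in> carrier G \<Longrightarrow> y \<in> carrier G \<Longrightarrow> h (commutator G x y) = commutator H (h x) (h y)"
  by (simp add: commutator_def)

lemma (in group_hom) hom_conj_by:
  "x \<in> carrier G \<Longrightarrow> y \<in> carrier G \<Longrightarrow> h (conj_by G x y) = conj_by H (h x) (h y)"
  by (simp add: conj_by_def)

lemma (in group) mult_inv_eq_one_iff:
  "x \<in> carrier G \<Longrightarrow> y \<in> carrier G \<Longrightarrow> x \<otimes> inv y = \<one> \<longleftrightarrow> x = y"
  by (metis inv_closed inv_equality inv_inv r_inv)

lemma K_relators_closed: "K_relators m l \<subseteq> carrier free_group"
proof -
  interpret group "free_group :: gen2 word monoid" by (rule group_free_group)
  show ?thesis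
    using free_gen_closed[of GenA] free_gen_closed[of GenB] by (auto simp: K_relators_def Let_def)
qed

lemma K_relators_iff:
  fixes h :: "gen2 word \<Rightarrow> 'a"
  assumes "group G" "h \<in> hom free_group G"
  shows "(\<forall>w \<in> K_relators m l. h w = \<one>\<^bsub>G\<^esub>) \<longleftrightarrow>
    satisfies_K_relations G m l (h (free_gen GenA)) (h (free_gen GenB))"
proof -
  interpret group_hom free_group G h
    using assms group_free_group by (simp add: group_hom_def group_hom_axioms_def)
  note [simp] = free_gen_closed[of GenA] free_gen_closed[of GenB]
  show ?thesis
    by (simp add: K_relators_def Let_def satisfies_K_relations_def hom_nat_pow hom_int_pow hom_commutator
        hom_conj_by H.mult_inv_eq_one_iff)
qed

lemma K_presentation_relations:
  assumes "has_presentation G (case_gen2 x y) (K_relators m l)"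
  shows "group G" "x \<in> carrier G" "y \<in> carrier G" "satisfies_K_relations G m l x y"
proof -
  obtain h where G: "group G" and h: "h \<in> hom free_group G" "\<And>i. h (free_gen i) = case_gen2 x y i"
      "kernel free_group G h = normal_closure free_group (K_relators m l)"
    using assms unfolding has_presentation_def by blast
  have "K_relators m l \<subseteq> normal_closure free_group (K_relators m l)"
    by (auto simp: normal_closure_def)
  then have "\<forall>w \<in> K_relators m l. h w = \<one>\<^bsub>G\<^esub>" using h(3) by (auto simp: kernel_def)
  then show "satisfies_K_relations G m l x y" using K_relators_iff[OF G h(1)] h(2) by auto
  show "x \<in> carrier G" "y \<in> carrier G"
    using hom_in_carrier[OF h(1) free_gen_closed] h(2)[of GenA] h(2)[of GenB] by (metis gen2.simps(3,4))+
qed (use assms in \<open>simp add: has_presentation_def\<close>)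

lemma K_presentation_hom:
  assumes "has_presentation G (case_gen2 x y) (K_relators m l)"
    and "group H" "x' \<in> carrier H" "y' \<in> carrier H" "satisfies_K_relations H m l x' y'"
  shows "\<exists>\<phi> \<in> hom G H. \<phi> x = x' \<and> \<phi> y = y'"
proof -
  have t: "case_gen2 x' y' i \<in> carrier H" for i using assms by (cases i) auto
  let ?e = "word_eval H (case_gen2 x' y')"
  have "?e w = \<one>\<^bsub>H\<^esub>" if "w \<in> K_relators m l" for w
    using that K_relators_iff[OF assms(2) group.word_eval_hom[where t = "case_gen2 x' y'", OF assms(2) t]]
      assms(5) by (auto simp: group.word_eval_free_gen[where t = "case_gen2 x' y'", OF assms(2) t])
  then obtain \<phi> where "\<phi> \<in> hom G H" "\<forall>i. \<phi> (case_gen2 x y i) = case_gen2 x' y' i"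
    using von_Dyck[where t = "case_gen2 x' y'", OF assms(1) K_relators_closed assms(2) t] by blast
  then show ?thesis by (metis gen2.simps(3,4))
qed

section \<open>The normal form arithmetic\<close>

text \<open>The binomial coefficient n over 2, for all integers n.\<close>

definition tri :: "int \<Rightarrow> int" where
  "tri n = n * (n - 1) div 2"

lemma two_tri: "2 * tri n = n * (n - 1)"
  unfolding tri_def by (simp add: algebra_simps)

lemma tri_0 [simp]: "tri 0 = 0" and tri_1 [simp]: "tri 1 = 0"
  by (simp_all add: tri_def)

lemma tri_add: "tri (s + t) = tri s + tri t + s * t"
  using two_tri[of s] two_tri[of t] two_tri[of "s + t"] by (simp add: algebra_simps)

locale K_parameters =
  fixes m :: nat and l :: int
  assumes m_gt_1: "m > 1" and odd_l: "odd l"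
begin

definition q :: int where "q = 2 ^ (m - 1)"
definition N :: int where "N = 2 ^ (2 * m - 1)"
definition u :: int where "u = 2 ^ m * l"

lemma two_q: "2 ^ m = 2 * q"
  unfolding q_def using m_gt_1 by (metis Suc_diff_1 less_trans power_Suc zero_less_one)

lemma N_eq: "N = 2 * q * q"
proof -
  have "2 * m - 1 = 1 + (m - 1) + (m - 1)" using m_gt_1 by simp
  then show ?thesis unfolding N_def q_def by (metis power_add power_one_right)
qed

lemma u_eq: "u = 2 * q * l"
  by (simp add: u_def two_q)

lemma q_pos [simp]: "q > 0" and N_pos [simp]: "N > 0"
  by (simp_all add: q_def N_def)

lemma even_q: "even q"
  using m_gt_1 by (simp add: q_def)

lemma coprime_l_q: "coprime l q"
  unfolding q_def using odd_l by simp

text \<open>Here u is 2 q times a unit modulo q, and N = 2 q q. This is why corrections of the form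
  \<open>u s\<close> need to be known modulo q only.\<close>

lemma u_mult_cong_iff: "[u * s = u * t] (mod N) \<longleftrightarrow> [s = t] (mod q)"
proof -
  have "u * s - u * t = (2 * q) * (l * (s - t))" by (simp add: u_eq algebra_simps)
  then have "N dvd u * s - u * t \<longleftrightarrow> q dvd l * (s - t)"
    using q_pos N_eq by (metis dvd_times_left_cancel_iff mult_eq_0_iff order_less_irrefl zero_neq_numeral)
  also have "\<dots> \<longleftrightarrow> q dvd s - t"
    using coprime_l_q by (simp add: coprime_commute coprime_dvd_mult_right_iff)
  finally show ?thesis by (simp add: cong_iff_dvd_diff)
qed

lemma u_mult_cong: "[s = t] (mod q) \<Longrightarrow> [u * s = u * t] (mod N)"
  by (simp add: u_mult_cong_iff)

lemma cong_N_imp_cong_q: "[s = t] (mod N) \<Longrightarrow> [s = t] (mod q)"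
  using cong_dvd_modulus[of s t N q] by (simp add: N_eq)

lemma cong_add_u_mult: "[s + u * t = s] (mod q)"
  by (simp add: cong_iff_dvd_diff u_eq)

lemma tri_cong: assumes "[s = t] (mod 2 * q)" shows "[tri s = tri t] (mod q)"
proof -
  obtain k where k: "s = t + 2 * q * k"
    using assms by (metis cong_iff_lin cong_sym)
  have "2 * (tri s - tri t) = 2 * (q * (k * (2 * t + 2 * q * k - 1)))"
    using two_tri[of s] two_tri[of t] by (simp add: k algebra_simps)
  then have "tri s - tri t = q * (k * (2 * t + 2 * q * k - 1))"
    using mult_cancel_left[of 2 "tri s - tri t"] by simp
  then show ?thesis by (simp add: cong_iff_dvd_diff)
qed

lemma tri_cong_N: "[s = t] (mod N) \<Longrightarrow> [tri s = tri t] (mod q)"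
  using cong_dvd_modulus[of s t N "2 * q"] tri_cong by (simp add: N_eq)

lemma tri_add_u_mult: "[tri (s + u * t) = tri s] (mod q)"
  by (rule tri_cong) (simp add: cong_iff_dvd_diff u_eq)

text \<open>Multiplication of the normal forms \<open>a\<^sup>x b\<^sup>y c\<^sup>z\<close>, where \<open>c = [a,b]\<close>. Collecting \<open>b\<^sup>y a\<^sup>x\<close> produces
  \<open>c\<^sup>-\<^sup>x\<^sup>y\<close>, and the terms with the factor u come from the central commutators
  \<open>[a,c] = a\<^sup>u\<close> and \<open>[b,c] = b\<^sup>-\<^sup>u\<close>. Without the identification of these commutators with powers
  of a and b it is the law of the free nilpotent group of class three.\<close>

definition law :: "int \<times> int \<times> int \<Rightarrow> int \<times> int \<times> int \<Rightarrow> int \<times> int \<times> int" where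
  "law = (\<lambda>(x, y, z) (x', y', z').
     (x + x' + u * (y * tri x' - z * x'),
      y + y' + u * (z * y' - x' * tri y - x' * y * y'),
      z + z' - x' * y))"

definition red :: "int \<times> int \<times> int \<Rightarrow> int \<times> int \<times> int" where
  "red = (\<lambda>(x, y, z). (x mod N, y mod N, z mod q))"

lemma red_eq_iff:
  "red (x, y, z) = red (x', y', z') \<longleftrightarrow> [x = x'] (mod N) \<and> [y = y'] (mod N) \<and> [z = z'] (mod q)"
  by (simp add: red_def Cong.cong_def)

lemma red_red [simp]: "red (red p) = red p"
  by (cases p) (simp add: red_def)

lemma red_law_cong:
  assumes "red p = red r" "red p' = red r'"
  shows "red (law p p') = red (law r r')"
proof -
  obtain x y z x' y' z' where p: "p = (x, y, z)" "p' = (x', y', z')" by (metis prod_cases3)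
  obtain i j k i' j' k' where r: "r = (i, j, k)" "r' = (i', j', k')" by (metis prod_cases3)
  have c: "[x = i] (mod N)" "[y = j] (mod N)" "[z = k] (mod q)"
      "[x' = i'] (mod N)" "[y' = j'] (mod N)" "[z' = k'] (mod q)"
    using assms by (auto simp: p r red_eq_iff)
  note cq = this(3,6) c(1,2,4,5)[THEN cong_N_imp_cong_q] c(1,2,4,5)[THEN tri_cong_N]
  show ?thesis unfolding p r law_def prod.case red_eq_iff
    by (intro conjI cong_add cong_diff cong_mult u_mult_cong c cq cong_refl)
qed

lemma red_law_red [simp]: "red (law (red p) p') = red (law p p')" "red (law p (red p')) = red (law p p')"
  by (auto intro: red_law_cong)

text \<open>The corrections of both sides agree exactly once the terms with a further factor u, which are
  trivial modulo q, are dropped.\<close>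

lemma red_law_assoc: "red (law (law p p') p'') = red (law p (law p' p''))"
proof -
  obtain x y z x' y' z' x'' y'' z'' where
    p: "p = (x, y, z)" "p' = (x', y', z')" "p'' = (x'', y'', z'')" by (metis prod_cases3)
  define U where "U = y' * tri x'' - z' * x''"
  define Y where "Y = z * y' - x' * tri y - x' * y * y'"
  have [simp]: "[u = 0] (mod q)" by (simp add: cong_0_iff u_eq)
  have d: "[w + u * t = w] (mod q)" "[tri (w + u * t) = tri w] (mod q)" for w t
    by (rule cong_add_u_mult tri_add_u_mult)+
  have 1: "[(y * tri x' - z * x') + ((y + y' + u * Y) * tri x'' - (z + z' - x' * y) * x'')
      = U + (y * tri (x' + x'' + u * U) - z * (x' + x'' + u * U))] (mod q)"
  proof -
    have "[(y * tri x' - z * x') + ((y + y' + u * Y) * tri x'' - (z + z' - x' * y) * x'') =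
        (y * tri x' - z * x') + ((y + y') * tri x'' - (z + z' - x' * y) * x'')] (mod q)"
      by (intro cong_add cong_diff cong_mult d cong_refl)
    also have "(y * tri x' - z * x') + ((y + y') * tri x'' - (z + z' - x' * y) * x'') =
        U + (y * tri (x' + x'') - z * (x' + x''))"
      by (simp add: U_def tri_add algebra_simps)
    also have "[\<dots> = U + (y * tri (x' + x'' + u * U) - z * (x' + x'' + u * U))] (mod q)"
      by (intro cong_add cong_diff cong_mult d[THEN cong_sym] cong_refl)
    finally show ?thesis .
  qed
  define V where "V = z' * y'' - x'' * tri y' - x'' * y' * y''"
  have 2: "[Y + ((z + z' - x' * y) * y'' - x'' * tri (y + y' + u * Y) - x'' * (y + y' + u * Y) * y'')
      = V + (z * (y' + y'' + u * V) - (x' + x'' + u * U) * tri y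
          - (x' + x'' + u * U) * y * (y' + y'' + u * V))] (mod q)"
  proof -
    have "[Y + ((z + z' - x' * y) * y'' - x'' * tri (y + y' + u * Y) - x'' * (y + y' + u * Y) * y'') =
        Y + ((z + z' - x' * y) * y'' - x'' * tri (y + y') - x'' * (y + y') * y'')] (mod q)"
      by (intro cong_add cong_diff cong_mult d cong_refl)
    also have "Y + ((z + z' - x' * y) * y'' - x'' * tri (y + y') - x'' * (y + y') * y'') =
        V + (z * (y' + y'') - (x' + x'') * tri y - (x' + x'') * y * (y' + y''))"
      by (simp add: Y_def V_def tri_add algebra_simps)
    also have "[\<dots> = V + (z * (y' + y'' + u * V) - (x' + x'' + u * U) * tri y
          - (x' + x'' + u * U) * y * (y' + y'' + u * V))] (mod q)"
      by (intro cong_add cong_diff cong_mult d[THEN cong_sym] cong_refl)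
    finally show ?thesis .
  qed
  have 3: "[z + z' - x' * y + z'' - x'' * (y + y' + u * Y) =
      z + (z' + z'' - x'' * y') - (x' + x'' + u * U) * y] (mod q)"
  proof -
    have "[z + z' - x' * y + z'' - x'' * (y + y' + u * Y) = z + z' - x' * y + z'' - x'' * (y + y')] (mod q)"
      by (intro cong_add cong_diff cong_mult d cong_refl)
    also have "z + z' - x' * y + z'' - x'' * (y + y') = z + (z' + z'' - x'' * y') - (x' + x'') * y"
      by (simp add: algebra_simps)
    also have "[\<dots> = z + (z' + z'' - x'' * y') - (x' + x'' + u * U) * y] (mod q)"
      by (intro cong_add cong_diff cong_mult d[THEN cong_sym] cong_refl)
    finally show ?thesis .
  qed
  show ?thesis
    unfolding p law_def prod.case red_eq_iff
      U_def[symmetric] Y_def[symmetric] V_def[symmetric]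
    using cong_add[OF cong_refl[of "x + x' + x''"] u_mult_cong[OF 1]]
      cong_add[OF cong_refl[of "y + y' + y''"] u_mult_cong[OF 2]] 3
    by (simp add: algebra_simps)
qed

text \<open>Modulo q the inverse of \<open>(x, y, z)\<close> is \<open>(- x, - y, - z - x y)\<close>. Since the corrections depend on
  residues modulo q only, subtracting their values at this triple gives an inverse modulo N.\<close>

lemma red_law_inverse:
  fixes x y z :: int
  defines "z' \<equiv> - z - x * y"
  shows "red (law (- x - u * (- y * tri x - z' * x), - y - u * (z' * y - x * tri (- y) + x * y * y), z') (x, y, z))
    = red (0, 0, 0)"
proof -
  define U where "U = - y * tri x - z' * x"
  define Y where "Y = z' * y - x * tri (- y) + x * y * y"
  have d: "[- w - u * t = - w] (mod q)" "[tri (- w - u * t) = tri (- w)] (mod q)" for w t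
    using cong_add_u_mult[of "- w" "- t"] tri_add_u_mult[of "- w" "- t"] by simp_all
  have "[(- y - u * Y) * tri x - z' * x = U] (mod q)"
    unfolding U_def by (intro cong_diff cong_mult d cong_refl)
  then have 1: "[- x - u * U + x + u * ((- y - u * Y) * tri x - z' * x) = - x - u * U + x + u * U] (mod N)"
    by (intro cong_add u_mult_cong cong_refl)
  have "[z' * y - x * tri (- y - u * Y) - x * (- y - u * Y) * y = z' * y - x * tri (- y) - x * (- y) * y] (mod q)"
    by (intro cong_diff cong_mult d cong_refl)
  then have "[z' * y - x * tri (- y - u * Y) - x * (- y - u * Y) * y = Y] (mod q)" by (simp add: Y_def)
  then have 2: "[- y - u * Y + y + u * (z' * y - x * tri (- y - u * Y) - x * (- y - u * Y) * y) =
      - y - u * Y + y + u * Y] (mod N)"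
    by (intro cong_add u_mult_cong cong_refl)
  have "[z' + z - x * (- y - u * Y) = z' + z - x * (- y)] (mod q)"
    by (intro cong_add cong_diff cong_mult d cong_refl)
  then show ?thesis
    unfolding law_def prod.case U_def[symmetric] Y_def[symmetric] red_eq_iff
    using 1 2 by (simp add: z'_def)
qed

definition normal_form_group :: "(int \<times> int \<times> int) monoid" where
  "normal_form_group =
     \<lparr>carrier = {0..<N} \<times> {0..<N} \<times> {0..<q}, monoid.mult = (\<lambda>p p'. red (law p p')), one = (0, 0, 0)\<rparr>"

lemma red_closed: "red p \<in> carrier normal_form_group"
  by (cases p) (simp add: normal_form_group_def red_def)

lemma red_id: "p \<in> carrier normal_form_group \<Longrightarrow> red p = p"
  by (cases p) (simp add: normal_form_group_def red_def)

lemma mult_normal_form [simp]: "red p \<otimes>\<^bsub>normal_form_group\<^esub> red p' = red (law p p')"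
  by (simp add: normal_form_group_def)

lemma one_normal_form: "\<one>\<^bsub>normal_form_group\<^esub> = red (0, 0, 0)"
  by (simp add: normal_form_group_def red_def)

lemma law_one: "law (0, 0, 0) p = p"
  by (cases p) (simp add: law_def)

lemma group_normal_form: "group normal_form_group"
proof (rule groupI)
  fix p p' p'' assume "p \<in> carrier normal_form_group" "p' \<in> carrier normal_form_group"
    "p'' \<in> carrier normal_form_group"
  then have "red p = p" "red p' = p'" "red p'' = p''" by (simp_all add: red_id)
  then show "p \<otimes>\<^bsub>normal_form_group\<^esub> p' \<otimes>\<^bsub>normal_form_group\<^esub> p'' =
      p \<otimes>\<^bsub>normal_form_group\<^esub> (p' \<otimes>\<^bsub>normal_form_group\<^esub> p'')"
    by (metis mult_normal_form red_law_assoc)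
next
  fix p assume "p \<in> carrier normal_form_group"
  then have p: "red p = p" by (simp add: red_id)
  then show "\<one>\<^bsub>normal_form_group\<^esub> \<otimes>\<^bsub>normal_form_group\<^esub> p = p"
    by (metis mult_normal_form law_one one_normal_form)
  obtain x y z where "p = (x, y, z)" by (metis prod_cases3)
  then show "\<exists>p' \<in> carrier normal_form_group. p' \<otimes>\<^bsub>normal_form_group\<^esub> p = \<one>\<^bsub>normal_form_group\<^esub>"
    using red_law_inverse[of x y z] p mult_normal_form by (metis one_normal_form red_closed)
next
  fix p p' assume "p \<in> carrier normal_form_group" "p' \<in> carrier normal_form_group"
  show "p \<otimes>\<^bsub>normal_form_group\<^esub> p' \<in> carrier normal_form_group"
    using red_closed by (simp add: normal_form_group_def)
qed (simp add: one_normal_form red_closed)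

end

text \<open>Powers of an explicitly given element are computed below by exhibiting the one-parameter
  subgroup through it.\<close>

lemma (in group) int_pow_eqI:
  fixes f :: "int \<Rightarrow> 'a"
  assumes "\<And>s. f s \<in> carrier G" "\<And>s t. f (s + t) = f s \<otimes> f t"
  shows "f 1 [^] n = f n"
proof -
  have 0: "f 0 = \<one>" using assms by (metis add.right_neutral r_cancel_one')
  have *: "f 1 [^] k = f (int k)" for k :: nat
    by (induction k) (use 0 assms(2)[symmetric] in \<open>auto simp: add.commute\<close>)
  have "f (- s) = inv f s" for s using assms 0 by (metis add.left_inverse inv_equality)
  then show ?thesis
    by (cases n rule: int_cases2) (simp_all add: int_pow_int int_pow_neg_int * assms)
qed

lemma (in group) commutator_eqI:
  "x \<in> carrier G \<Longrightarrow> y \<in> carrier G \<Longrightarrow> c \<in> carrier G \<Longrightarrow> x \<otimes> y = y \<otimes> x \<otimes> c \<Longrightarrow> commutator G x y = c"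
  unfolding commutator_def by (metis inv_closed inv_mult_group inv_solve_left m_assoc m_closed)

lemma (in group) mult_commutator:
  "x \<in> carrier G \<Longrightarrow> y \<in> carrier G \<Longrightarrow> y \<otimes> x \<otimes> commutator G x y = x \<otimes> y"
  unfolding commutator_def by (metis inv_closed inv_mult_group inv_solve_left m_assoc m_closed)

lemma (in group) conj_by_eq_iff:
  "x \<in> carrier G \<Longrightarrow> y \<in> carrier G \<Longrightarrow> w \<in> carrier G \<Longrightarrow> conj_by G x y = w \<longleftrightarrow> x \<otimes> y = y \<otimes> w"
  unfolding conj_by_def by (metis inv_closed inv_solve_left m_assoc m_closed)

lemma (in group) inv_commutator:
  "x \<in> carrier G \<Longrightarrow> y \<in> carrier G \<Longrightarrow> inv (commutator G x y) = commutator G y x"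
  unfolding commutator_def by (simp add: inv_mult_group m_assoc)

context K_parameters
begin

lemma normal_form_pow:
  "red (1, 0, 0) [^]\<^bsub>normal_form_group\<^esub> n = red (n, 0, 0)"
  "red (0, 1, 0) [^]\<^bsub>normal_form_group\<^esub> n = red (0, n, 0)"
  "red (0, 0, 1) [^]\<^bsub>normal_form_group\<^esub> n = red (0, 0, n)" for n :: int
  using group.int_pow_eqI[OF group_normal_form, of "\<lambda>s. red (s, 0, 0)" n]
    group.int_pow_eqI[OF group_normal_form, of "\<lambda>s. red (0, s, 0)" n]
    group.int_pow_eqI[OF group_normal_form, of "\<lambda>s. red (0, 0, s)" n]
  by (simp_all add: red_closed law_def)

lemma normal_form_pow_nat:
  "red (1, 0, 0) [^]\<^bsub>normal_form_group\<^esub> n = red (int n, 0, 0)"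
  "red (0, 1, 0) [^]\<^bsub>normal_form_group\<^esub> n = red (0, int n, 0)"
  "red (0, 0, 1) [^]\<^bsub>normal_form_group\<^esub> n = red (0, 0, int n)" for n :: nat
  using normal_form_pow[of "int n"] by (simp_all add: int_pow_int)

lemma u_square: "[u * u = 0] (mod N)"
  by (simp add: cong_0_iff u_eq N_eq)

lemma normal_form_satisfies_K_relations:
  "satisfies_K_relations normal_form_group m l (red (1, 0, 0)) (red (0, 1, 0))"
proof -
  interpret group normal_form_group by (rule group_normal_form)
  note [simp] = red_closed
  have c: "commutator normal_form_group (red (1, 0, 0)) (red (0, 1, 0)) = red (0, 0, 1)"
    by (rule commutator_eqI) (simp_all add: law_def)
  have "inv\<^bsub>normal_form_group\<^esub> red (0, 0, 1) = red (0, 0, - 1)"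
    by (rule inv_equality) (simp_all add: law_def one_normal_form)
  then have d: "commutator normal_form_group (red (0, 1, 0)) (red (1, 0, 0)) = red (0, 0, - 1)"
    using inv_commutator[of "red (1, 0, 0)" "red (0, 1, 0)"] c by simp
  have 1: "conj_by normal_form_group (red (1, 0, 0)) (red (0, 0, 1)) = red (1 + u, 0, 0)"
    using u_square by (simp add: conj_by_eq_iff) (simp add: law_def red_eq_iff algebra_simps cong_iff_dvd_diff)
  have 2: "conj_by normal_form_group (red (0, 1, 0)) (red (0, 0, - 1)) = red (0, 1 + u, 0)"
    using u_square by (simp add: conj_by_eq_iff) (simp add: law_def red_eq_iff algebra_simps cong_iff_dvd_diff)
  have "red (0, 0, int (2 ^ (m - 1))) = red (0, 0, 0)" "red (int (2 ^ (2 * m - 1)), 0, 0) = red (0, 0, 0)"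
    "red (0, int (2 ^ (2 * m - 1)), 0) = red (0, 0, 0)"
    by (simp_all add: red_def q_def N_def)
  then show ?thesis
    unfolding satisfies_K_relations_def c d normal_form_pow normal_form_pow_nat one_normal_form
    using 1 2 by (simp add: u_def)
qed

lemma normal_form_product:
  "red (1, 0, 0) [^]\<^bsub>normal_form_group\<^esub> x \<otimes>\<^bsub>normal_form_group\<^esub> red (0, 1, 0) [^]\<^bsub>normal_form_group\<^esub> y
    \<otimes>\<^bsub>normal_form_group\<^esub> red (0, 0, 1) [^]\<^bsub>normal_form_group\<^esub> z = red (x, y, z)" for x y z :: int
  by (simp add: normal_form_pow law_def)

end

section \<open>Normal forms in K\<close>

lemma (in group) int_pow_cong:
  assumes "x \<in> carrier G" "x [^] n = \<one>" "[s = t] (mod int n)"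
  shows "x [^] s = x [^] t"
proof -
  obtain k where "t = s + int n * k" using assms(3) by (metis cong_iff_lin)
  then have "x [^] t = x [^] s \<otimes> (x [^] int n) [^] k" using assms(1) by (simp add: int_pow_mult int_pow_pow)
  then show ?thesis using assms(1,2) by (simp add: int_pow_int)
qed

lemma (in group) inv_mult_cancel [simp]:
  "x \<in> carrier G \<Longrightarrow> y \<in> carrier G \<Longrightarrow> inv x \<otimes> (x \<otimes> y) = y"
  "x \<in> carrier G \<Longrightarrow> y \<in> carrier G \<Longrightarrow> x \<otimes> (inv x \<otimes> y) = y"
  by (simp_all flip: m_assoc)

lemma (in group) int_pow_conj:
  assumes "x \<in> carrier G" "g \<in> carrier G"
  shows "(inv g \<otimes> x \<otimes> g) [^] (n::int) = inv g \<otimes> x [^] n \<otimes> g"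
  using assms int_pow_eqI[of "\<lambda>n. inv g \<otimes> x [^] n \<otimes> g" n] by (simp add: int_pow_mult m_assoc)

lemma (in group) int_pow_commutes:
  assumes "x \<in> carrier G" "g \<in> carrier G" "x \<otimes> g = g \<otimes> x"
  shows "x [^] (n::int) \<otimes> g = g \<otimes> x [^] n"
  proof -
  have "inv g \<otimes> x \<otimes> g = x" using assms by (simp add: m_assoc)
  then have "x [^] n = inv g \<otimes> (x [^] n \<otimes> g)" using assms int_pow_conj[of x g n] by (simp add: m_assoc)
  then have "g \<otimes> x [^] n = g \<otimes> (inv g \<otimes> (x [^] n \<otimes> g))" by simp
  then show ?thesis using assms by simp
qed

text \<open>The computations that only use the relations. Interchanging the two elements preserves the
  relations and inverts their commutator, so each rule comes with a mirror image.\<close>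

locale K_pair = K_parameters + group G for G (structure) +
  fixes a b
  assumes a_closed [simp, intro]: "a \<in> carrier G" and b_closed [simp, intro]: "b \<in> carrier G"
    and relations: "satisfies_K_relations G m l a b"
begin

definition "c = commutator G a b"

lemma c_closed [simp, intro]: "c \<in> carrier G"
  by (simp add: c_def)

lemma commutator_b_a: "commutator G b a = inv c"
  by (simp add: c_def inv_commutator)

lemma mirror: "K_pair m l G b a"
proof
  have "inv c [^] (2 ^ (m - 1) :: nat) = \<one>"
    using relations by (simp add: satisfies_K_relations_def nat_pow_inv flip: c_def)
  then show "satisfies_K_relations G m l b a"
    using relations by (simp add: satisfies_K_relations_def commutator_b_a)
qed auto

lemma mirror_c: "K_pair.c G b a = inv c"
  using K_pair.c_def[OF mirror] by (simp add: commutator_b_a)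

lemma a_pow_cong: "[s = t] (mod N) \<Longrightarrow> a [^] s = a [^] t"
  using relations int_pow_cong[of a "2 ^ (2 * m - 1)" s t]
  by (simp add: satisfies_K_relations_def N_def)

lemma c_pow_cong: "[s = t] (mod q) \<Longrightarrow> c [^] s = c [^] t"
  using relations int_pow_cong[of c "2 ^ (m - 1)" s t]
  by (simp add: satisfies_K_relations_def q_def flip: c_def)

lemma a_pow_mult_c: "a [^] n \<otimes> c = c \<otimes> a [^] (n + u * n)" for n :: int
proof -
  have "a \<otimes> c = c \<otimes> a [^] (1 + u)"
    using relations conj_by_eq_iff[of a c "a [^] (1 + u)"]
    by (simp add: satisfies_K_relations_def u_def c_def)
  then have "inv c \<otimes> a \<otimes> c = a [^] (1 + u)" by (simp add: m_assoc inv_solve_left')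
  moreover have "inv c \<otimes> a [^] n \<otimes> c = (inv c \<otimes> a \<otimes> c) [^] n"
    by (simp add: int_pow_conj)
  ultimately have "inv c \<otimes> a [^] n \<otimes> c = a [^] (n + u * n)"
    by (simp add: int_pow_pow algebra_simps)
  then show ?thesis by (simp add: m_assoc inv_solve_left')
qed

lemma c_mult_a_pow: "c \<otimes> a [^] n = a [^] (n - u * n) \<otimes> c" for n :: int
proof -
  have "a [^] (n - u * n + u * (n - u * n)) = a [^] n"
    by (rule a_pow_cong) (use u_square in \<open>simp add: cong_iff_dvd_diff algebra_simps\<close>)
  then show ?thesis using a_pow_mult_c[of "n - u * n"] by simp
qed

text \<open>Conjugation by c raises a to the power \<open>1 + u\<close>. Because N divides the square of u, the z-th
  power of \<open>1 + u\<close> is \<open>1 + u z\<close>, for negative z too.\<close>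

lemma c_pow_mult_a_pow: "c [^] z \<otimes> a [^] n = a [^] (n - u * n * z) \<otimes> c [^] z" for n z :: int
proof (induction z rule: int_induct[where k = 0])
  case (step1 z)
  have "c [^] (z + 1) \<otimes> a [^] n = c \<otimes> (c [^] z \<otimes> a [^] n)"
    by (simp add: int_pow_mult add.commute[of z] m_assoc)
  also have "\<dots> = c \<otimes> a [^] (n - u * n * z) \<otimes> c [^] z"
    using step1 by (simp add: m_assoc)
  also have "\<dots> = a [^] (n - u * n * z - u * (n - u * n * z)) \<otimes> c [^] (z + 1)"
    by (simp add: c_mult_a_pow int_pow_mult add.commute[of z] m_assoc)
  also have "a [^] (n - u * n * z - u * (n - u * n * z)) = a [^] (n - u * n * (z + 1))"
    by (rule a_pow_cong) (use u_square in \<open>simp add: cong_iff_dvd_diff algebra_simps\<close>)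
  finally show ?case .
next
  case (step2 z)
  have *: "inv c \<otimes> a [^] s = a [^] (s + u * s) \<otimes> inv c" for s
  proof -
    have "inv c \<otimes> a [^] s = inv c \<otimes> (a [^] s \<otimes> c) \<otimes> inv c" by (simp add: m_assoc)
    then show ?thesis by (simp add: a_pow_mult_c)
  qed
  have "c [^] (z - 1) \<otimes> a [^] n = inv c \<otimes> (c [^] z \<otimes> a [^] n)"
    using int_pow_mult[of c "- 1" z] by (simp add: int_pow_neg m_assoc)
  also have "\<dots> = inv c \<otimes> a [^] (n - u * n * z) \<otimes> c [^] z"
    using step2 by (simp add: m_assoc)
  also have "\<dots> = a [^] (n - u * n * z + u * (n - u * n * z)) \<otimes> c [^] (z - 1)"
    using int_pow_mult[of c "- 1" z] by (simp add: * int_pow_neg m_assoc)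
  also have "a [^] (n - u * n * z + u * (n - u * n * z)) = a [^] (n - u * n * (z - 1))"
    by (rule a_pow_cong) (use u_square in \<open>simp add: cong_iff_dvd_diff algebra_simps\<close>)
  finally show ?case .
qed simp

text \<open>Conjugation by b sends a to ac, so it sends powers of a to powers of ac, which are collected
  by the previous rule.\<close>

lemma a_pow_mult_b: "a [^] n \<otimes> b = b \<otimes> a [^] (n - u * tri n) \<otimes> c [^] n" for n :: int
proof -
  let ?f = "\<lambda>n. a [^] (n - u * tri n) \<otimes> c [^] n"
  have "?f (s + t) = ?f s \<otimes> ?f t" for s t
  proof -
    have "?f s \<otimes> ?f t = a [^] (s - u * tri s) \<otimes> (c [^] s \<otimes> a [^] (t - u * tri t)) \<otimes> c [^] t"
      by (simp add: m_assoc)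
    also have "\<dots> = a [^] (s - u * tri s + (t - u * tri t - u * (t - u * tri t) * s)) \<otimes> c [^] (s + t)"
      by (simp only: c_pow_mult_a_pow) (simp add: int_pow_mult m_assoc)
    also have "a [^] (s - u * tri s + (t - u * tri t - u * (t - u * tri t) * s)) = a [^] (s + t - u * tri (s + t))"
      by (rule a_pow_cong) (use u_square in \<open>simp add: cong_iff_dvd_diff algebra_simps tri_add\<close>)
    finally show ?thesis by simp
  qed
  then have f: "(a \<otimes> c) [^] n = ?f n" using int_pow_eqI[of ?f n] by simp
  have "inv b \<otimes> a [^] n \<otimes> b = (inv b \<otimes> a \<otimes> b) [^] n"
    by (simp add: int_pow_conj)
  moreover have "inv b \<otimes> a \<otimes> b = a \<otimes> c"
    using mult_commutator[of a b] by (simp add: c_def m_assoc inv_solve_left')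
  ultimately show ?thesis using f by (simp add: m_assoc inv_solve_left')
qed

text \<open>At multiples of u both corrections in the previous rule vanish. So \<open>a\<^sup>u\<close> is central, and by
  the mirror image also \<open>b\<^sup>u\<close>: the group has class at most three.\<close>

lemma a_pow_u_commutes: "a [^] (u * k) \<otimes> b = b \<otimes> a [^] (u * k)"
proof -
  have "[tri (u * k) = 0] (mod q)" using tri_add_u_mult[of 0 k] by simp
  then have "[u * k - u * tri (u * k) = u * k - u * 0] (mod N)"
    by (intro cong_diff u_mult_cong cong_refl)
  then have "a [^] (u * k - u * tri (u * k)) = a [^] (u * k)" by (intro a_pow_cong) simp
  moreover have "c [^] (u * k) = c [^] (0::int)"
    by (rule c_pow_cong) (simp add: cong_0_iff u_eq)
  ultimately show ?thesis using a_pow_mult_b[of "u * k"] by simp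
qed

lemma mirror_c_pow: "inv c [^] z = c [^] (- z)" for z :: int
  by (simp add: int_pow_inv int_pow_neg)

lemma b_pow_cong: "[s = t] (mod N) \<Longrightarrow> b [^] s = b [^] t"
  by (rule K_pair.a_pow_cong[OF mirror])

lemma c_pow_mult_b_pow: "c [^] z \<otimes> b [^] n = b [^] (n + u * n * z) \<otimes> c [^] z" for n z :: int
  using K_pair.c_pow_mult_a_pow[OF mirror, of "- z" n] by (simp add: mirror_c mirror_c_pow)

lemma b_pow_mult_a: "b [^] n \<otimes> a = a \<otimes> b [^] (n - u * tri n) \<otimes> c [^] (- n)" for n :: int
  using K_pair.a_pow_mult_b[OF mirror, of n] by (simp add: mirror_c mirror_c_pow)

definition E :: "int \<times> int \<times> int \<Rightarrow> 'a" where
  "E = (\<lambda>(x, y, z). a [^] x \<otimes> b [^] y \<otimes> c [^] z)"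

lemma E_closed [simp, intro]: "E p \<in> carrier G"
  by (simp add: E_def split: prod.split)

lemma E_red_cong: "red p = red p' \<Longrightarrow> E p = E p'"
  by (cases p; cases p') (auto simp: red_eq_iff E_def intro!: a_pow_cong b_pow_cong c_pow_cong
      arg_cong2[where f = "(\<otimes>)"])

lemma E_0: "E (0, 0, 0) = \<one>" and E_a: "E (1, 0, 0) = a" and E_b: "E (0, 1, 0) = b"
  by (simp_all add: E_def)

lemma finite_range_E: "finite (range E)"
proof -
  have "range E \<subseteq> E ` carrier normal_form_group"
  proof
    fix g assume "g \<in> range E"
    then obtain p where "g = E (red p)" using E_red_cong by (metis imageE red_red)
    then show "g \<in> E ` carrier normal_form_group" using red_closed by blast
  qed
  then show ?thesis by (rule finite_subset) (simp add: normal_form_group_def)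
qed

lemma E_mult_b: "E (x, y, z) \<otimes> b = E (x, y + 1 + u * z, z)"
proof -
  have "E (x, y, z) \<otimes> b = a [^] x \<otimes> b [^] y \<otimes> (c [^] z \<otimes> b [^] (1::int))"
    by (simp add: E_def m_assoc)
  also have "\<dots> = E (x, y + 1 + u * z, z)"
    by (simp only: c_pow_mult_b_pow) (simp add: E_def m_assoc int_pow_mult)
  finally show ?thesis .
qed

lemma E_mult_a: "E (x, y, z) \<otimes> a = E (x + 1 - u * z, y - u * tri y, z - y)"
proof -
  \<comment> \<open>Moving a to the left of \<open>c\<^sup>z\<close> leaves a central power of a, with this exponent.\<close>
  let ?v = "u * (- z)"
  have comm: "b [^] y \<otimes> a [^] ?v = a [^] ?v \<otimes> b [^] y"
    using a_pow_u_commutes[of "- z"] by (intro int_pow_commutes) auto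
  have "E (x, y, z) \<otimes> a = a [^] x \<otimes> b [^] y \<otimes> (c [^] z \<otimes> a [^] (1::int))"
    by (simp add: E_def m_assoc)
  also have "\<dots> = a [^] x \<otimes> b [^] y \<otimes> (a [^] (?v + 1) \<otimes> c [^] z)"
    by (simp only: c_pow_mult_a_pow) (simp add: algebra_simps)
  also have "\<dots> = a [^] x \<otimes> (b [^] y \<otimes> a [^] ?v) \<otimes> a \<otimes> c [^] z"
    by (simp only: int_pow_mult a_closed) (simp add: m_assoc)
  also have "\<dots> = a [^] x \<otimes> a [^] ?v \<otimes> (b [^] y \<otimes> a) \<otimes> c [^] z"
    by (simp only: comm) (simp add: m_assoc)
  also have "\<dots> = a [^] (x + ?v + 1) \<otimes> b [^] (y - u * tri y) \<otimes> c [^] (- y + z)"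
    by (simp only: b_pow_mult_a int_pow_mult a_closed) (simp add: m_assoc flip: int_pow_mult)
  finally show ?thesis by (simp add: E_def algebra_simps)
qed

end

locale K_group = K_parameters + group K for K (structure) +
  fixes a b
  assumes pres: "has_presentation K (case_gen2 a b) (K_relators m l)"

sublocale K_group \<subseteq> K_pair m l K a b
  using K_presentation_relations[OF pres] by unfold_locales auto

context K_group
begin

lemma generated: "subgroup S K \<Longrightarrow> a \<in> S \<Longrightarrow> b \<in> S \<Longrightarrow> carrier K \<subseteq> S"
  by (rule presented_group_generated[OF pres]) (auto split: gen2.split)

text \<open>The set of normal forms is closed under right multiplication by a and b. As it is finite,
  right multiplication by a and b permutes it, and therefore so does every element of K.\<close>

lemma range_E: "range E = carrier K"
proof -
  let ?S = "{g \<in> carrier K. (\<lambda>h. h \<otimes> g) ` range E = range E}"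
  have *: "g \<in> ?S" if "g \<in> carrier K" "\<And>p. E p \<otimes> g \<in> range E" for g
  proof -
    have "inj_on (\<lambda>h. h \<otimes> g) (range E)" by (rule inj_onI) (use that in auto)
    then have "(\<lambda>h. h \<otimes> g) ` range E = range E"
      using that(2) finite_range_E by (intro card_subset_eq) (auto simp: card_image)
    then show ?thesis using that(1) by simp
  qed
  have "subgroup ?S K"
  proof
    show "\<one> \<in> ?S" by (rule *) auto
  next
    fix g h assume g: "g \<in> ?S" and h: "h \<in> ?S"
    have "E p \<otimes> g \<in> range E" for p using g by blast
    moreover have "w \<otimes> h \<in> range E" if "w \<in> range E" for w using h that by blast
    ultimately have "E p \<otimes> g \<otimes> h \<in> range E" for p by blast
    then show "g \<otimes> h \<in> ?S" using g h by (intro *) (auto simp: m_assoc)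
  next
    fix g assume g: "g \<in> ?S"
    have "E p \<otimes> inv g \<in> range E" for p
    proof -
      have "E p \<in> (\<lambda>w. w \<otimes> g) ` range E" using g by blast
      then obtain p' where "E p = E p' \<otimes> g" by blast
      then have "E p \<otimes> inv g = E p'" using g by (simp add: m_assoc)
      then show ?thesis by simp
    qed
    then show "inv g \<in> ?S" using g by (intro *) auto
  qed auto
  moreover have "a \<in> ?S" by (rule *) (auto simp: E_mult_a)
  moreover have "b \<in> ?S" by (rule *) (auto simp: E_mult_b)
  ultimately have "carrier K \<subseteq> ?S" by (rule generated)
  then have "E (0, 0, 0) \<otimes> g \<in> range E" if "g \<in> carrier K" for g
    using that by blast
  then have "g \<in> range E" if "g \<in> carrier K" for g
    using that by (simp add: E_0)
  then show ?thesis by auto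
qed

text \<open>The group of reduced triples satisfies the defining relations, so K maps onto it. This bounds
  the order of K from below: the exponents in a normal form are determined by the element.\<close>

lemma normal_form_hom:
  obtains \<phi> where "\<phi> \<in> hom K normal_form_group" "\<And>p. \<phi> (E p) = red p"
proof -
  obtain \<phi> where \<phi>: "\<phi> \<in> hom K normal_form_group" "\<phi> a = red (1, 0, 0)" "\<phi> b = red (0, 1, 0)"
    using K_presentation_hom[OF pres group_normal_form red_closed red_closed
        normal_form_satisfies_K_relations] by blast
  interpret \<phi>: group_hom K normal_form_group \<phi>
    using \<phi>(1) group_normal_form by (simp add: group_hom_def group_hom_axioms_def)
  have "\<phi> c = commutator normal_form_group (red (1, 0, 0)) (red (0, 1, 0))"
    by (simp add: c_def \<phi>.hom_commutator \<phi>(2,3))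
  also have "\<dots> = red (0, 0, 1)"
    by (rule \<phi>.H.commutator_eqI) (simp_all add: law_def red_closed)
  finally have "\<phi> c = red (0, 0, 1)" .
  then have "\<phi> (E p) = red p" for p
    using normal_form_product by (cases p) (simp add: E_def \<phi>.hom_int_pow \<phi>(2,3))
  then show ?thesis using that \<phi>(1) by blast
qed

theorem E_eq_iff: "E p = E p' \<longleftrightarrow> red p = red p'"
  using normal_form_hom E_red_cong by metis

text \<open>Equality in K can be tested after applying the homomorphism to triples, where multiplication is
  the law by definition.\<close>

theorem E_mult: "E p \<otimes> E p' = E (law p p')"
proof -
  obtain \<phi> where \<phi>: "\<phi> \<in> hom K normal_form_group" "\<And>p. \<phi> (E p) = red p"
    using normal_form_hom by blast
  have "E p \<otimes> E p' \<in> range E" by (simp add: range_E)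
  then obtain r where r: "E p \<otimes> E p' = E r" by blast
  have "red r = \<phi> (E p \<otimes> E p')" by (simp add: r \<phi>(2))
  also have "\<dots> = red (law p p')" using \<phi> by (simp add: hom_mult)
  finally show ?thesis by (simp add: r E_eq_iff)
qed

end

section \<open>The upper central series\<close>

lemma (in normal) rcoset_eq_iff:
  assumes "x \<in> carrier G" "y \<in> carrier G"
  shows "H #> x = H #> y \<longleftrightarrow> x \<otimes> inv y \<in> H"
proof
  assume "H #> x = H #> y"
  then have "x \<in> H #> y" using rcos_self[OF assms(1) is_subgroup] by simp
  then show "x \<otimes> inv y \<in> H" using rcos_module_imp[OF is_group] assms by simp
next
  assume "x \<otimes> inv y \<in> H"
  then have "x \<in> H #> y" using rcos_module_rev[OF is_group] assms by simp
  then show "H #> x = H #> y" using repr_independence[OF _ assms(2) is_subgroup] by simp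
qed

lemma (in normal) coset_in_center_iff:
  assumes x: "x \<in> carrier G"
  shows "H #> x \<in> center (G Mod H) \<longleftrightarrow> (\<forall>g \<in> carrier G. commutator G x g \<in> H)"
proof -
  have "H #> x \<otimes> g = H #> g \<otimes> x \<longleftrightarrow> commutator G x g \<in> H" if g: "g \<in> carrier G" for g
  proof -
    have "H #> x \<otimes> g = H #> g \<otimes> x \<longleftrightarrow> (x \<otimes> g) \<otimes> inv (g \<otimes> x) \<in> H"
      using x g by (intro rcoset_eq_iff) auto
    \<comment> \<open>The commutator is the conjugate of this element by \<open>g x\<close>.\<close>
    also have "\<dots> \<longleftrightarrow> inv (g \<otimes> x) \<otimes> ((x \<otimes> g) \<otimes> inv (g \<otimes> x)) \<otimes> (g \<otimes> x) \<in> H"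
      using inv_op_closed1[of "g \<otimes> x"] inv_op_closed2[of "g \<otimes> x"] x g
      by (metis (no_types, lifting) inv_closed inv_mult_cancel(2) m_assoc m_closed r_inv r_one)
    also have "inv (g \<otimes> x) \<otimes> ((x \<otimes> g) \<otimes> inv (g \<otimes> x)) \<otimes> (g \<otimes> x) = commutator G x g"
      using x g by (simp add: commutator_def m_assoc inv_mult_group)
    finally show ?thesis .
  qed
  then show ?thesis
    using x by (auto simp: center_def carrier_FactGroup rcos_sum)
qed

lemma (in normal) normal_next_central:
  defines "Z \<equiv> {x \<in> carrier G. \<forall>g \<in> carrier G. commutator G x g \<in> H}"
  shows "Z \<lhd> G"
proof -
  have mult: "commutator G (x \<otimes> y) g = inv y \<otimes> commutator G x g \<otimes> y \<otimes> commutator G y g"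
    if "x \<in> carrier G" "y \<in> carrier G" "g \<in> carrier G" for x y g
    using that by (simp add: commutator_def inv_mult_group m_assoc)
  have inv: "commutator G (inv x) g = x \<otimes> inv (commutator G x g) \<otimes> inv x"
    if "x \<in> carrier G" "g \<in> carrier G" for x g
    using that by (simp add: commutator_def inv_mult_group m_assoc)
  have conj: "commutator G (h \<otimes> x \<otimes> inv h) g = h \<otimes> commutator G x (inv h \<otimes> g \<otimes> h) \<otimes> inv h"
    if "x \<in> carrier G" "h \<in> carrier G" "g \<in> carrier G" for x h g
    using that by (simp add: commutator_def inv_mult_group m_assoc)
  have "subgroup Z G"
  proof
    show "\<one> \<in> Z" by (simp add: Z_def commutator_def)
    show "x \<otimes> y \<in> Z" if "x \<in> Z" "y \<in> Z" for x y
      using that by (auto simp: Z_def mult inv_op_closed1)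
    show "inv x \<in> Z" if "x \<in> Z" for x
      using that by (auto simp: Z_def inv inv_op_closed2)
  qed (auto simp: Z_def)
  then show ?thesis
    by (auto simp: normal_inv_iff Z_def conj inv_op_closed2)
qed

lemma (in group)
  shows normal_upper_central: "upper_central G i \<lhd> G"
    and upper_central_Suc_eq:
      "upper_central G (Suc i) = {x \<in> carrier G. \<forall>g \<in> carrier G. commutator G x g \<in> upper_central G i}"
proof -
  have *: "upper_central G (Suc i) = {x \<in> carrier G. \<forall>g \<in> carrier G. commutator G x g \<in> upper_central G i}"
    if "upper_central G i \<lhd> G" for i
    using normal.coset_in_center_iff[OF that] by auto
  show "upper_central G i \<lhd> G"
  proof (induction i)
    case (Suc i)
    show ?case unfolding *[OF Suc] by (rule normal.normal_next_central[OF Suc])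
  qed (use one_is_normal in simp)
  then show "upper_central G (Suc i) = {x \<in> carrier G. \<forall>g \<in> carrier G. commutator G x g \<in> upper_central G i}"
    by (rule *)
qed

lemma (in group) commutator_eq_one_iff:
  assumes "x \<in> carrier G" "y \<in> carrier G"
  shows "commutator G x y = \<one> \<longleftrightarrow> x \<otimes> y = y \<otimes> x"
proof -
  have "x \<otimes> y = y \<otimes> x \<longleftrightarrow> y \<otimes> x \<otimes> commutator G x y = y \<otimes> x"
    by (simp only: mult_commutator[OF assms])
  also have "\<dots> \<longleftrightarrow> commutator G x y = \<one>"
    using assms by (intro l_cancel_one commutator_closed m_closed)
  finally show ?thesis by (rule sym)
qed

context K_group
begin

lemma obtain_E:
  assumes "g \<in> carrier K"
  obtains x y z where "g = E (x, y, z)"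
proof -
  have "g \<in> range E" using assms by (simp add: range_E)
  then obtain p where "g = E p" by blast
  then show ?thesis using that by (cases p) blast
qed

lemma ball_E: "(\<forall>g \<in> carrier K. R g) \<longleftrightarrow> (\<forall>x y z. R (E (x, y, z)))"
proof (intro iffI allI ballI)
  fix g assume "\<forall>x y z. R (E (x, y, z))" "g \<in> carrier K"
  then show "R g" by (metis obtain_E)
qed (simp add: E_closed)

lemma double_q_dvd_N: "2 * q dvd N" and double_q_dvd_u: "2 * q dvd u"
  and q_dvd_N: "q dvd N"
  by (simp_all add: N_eq u_eq)

lemma E_cong:
  assumes "[x = x'] (mod N)" "[y = y'] (mod N)" "[z = z'] (mod q)"
  shows "E (x, y, z) = E (x', y', z')"
  using assms by (simp add: E_eq_iff red_eq_iff)

lemma u_mult_dvd: "q dvd t \<Longrightarrow> [u * t = 0] (mod N)"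
  using u_mult_cong[of t 0] by (simp add: cong_0_iff)

lemma tri_dvd: "2 * q dvd n \<Longrightarrow> q dvd tri n"
  using tri_cong[of n 0] by (simp add: cong_0_iff)

lemma double_q_dvd_q: "2 * q dvd n \<Longrightarrow> q dvd (n::int)"
  by (rule dvd_mult_right)

text \<open>When the exponents of a and b are multiples of 2 q the element is central up to its power of c,
  which acts by multiplying exponents of a and b by \<open>1 - u k\<close> and \<open>1 + u k\<close>.\<close>

lemma mult_near_central:
  assumes "2 * q dvd i" "2 * q dvd j"
  shows "E (x, y, z) \<otimes> E (i, j, k) = E (x + i, y + j, z + k)"
    and "E (i, j, k) \<otimes> E (x, y, z) = E (x + i - u * (k * x), y + j + u * (k * y), z + k)"
proof -
  note d = assms[THEN double_q_dvd_q] assms[THEN tri_dvd]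
  have "q dvd y * tri i - z * i" "q dvd z * j - i * tri y - i * y * j" "[i * y = 0] (mod q)"
    using d by (auto intro!: dvd_diff simp: cong_0_iff)
  note this(1,2)[THEN u_mult_dvd] this(3)
  then show "E (x, y, z) \<otimes> E (i, j, k) = E (x + i, y + j, z + k)"
    unfolding E_mult law_def prod.case
    by (intro E_cong) (auto simp: cong_iff_dvd_diff)
  have "[j * tri x - k * x = - (k * x)] (mod q)" "[k * y - x * tri j - x * j * y = k * y] (mod q)"
    "[x * j = 0] (mod q)"
    using d by (auto simp: cong_iff_dvd_diff)
  note this(1,2)[THEN u_mult_cong] this(3)
  then show "E (i, j, k) \<otimes> E (x, y, z) = E (x + i - u * (k * x), y + j + u * (k * y), z + k)"
    unfolding E_mult law_def prod.case
    by (intro E_cong) (auto simp: cong_iff_dvd_diff algebra_simps)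
qed

lemma near_central_pow:
  fixes n :: int
  assumes "2 * q dvd i" "2 * q dvd j"
  shows "E (i, j, k) [^] n = E (n * i, n * j, n * k)"
  using int_pow_eqI[of "\<lambda>n. E (n * i, n * j, n * k)" n] assms
  by (simp add: mult_near_central algebra_simps)

text \<open>Comparing exponents in \<open>g h = h g [g,h]\<close>: modulo 2 q the exponents of a and b add up, so
  those of the commutator vanish, and the exponent of c modulo q is the determinant.\<close>

lemma commutator_E:
  obtains i j k where "commutator K (E (x, y, z)) (E (x', y', z')) = E (i, j, k)"
    "2 * q dvd i" "2 * q dvd j" "[k = x * y' - x' * y] (mod q)"
proof -
  obtain i j k where e: "commutator K (E (x, y, z)) (E (x', y', z')) = E (i, j, k)"
    using obtain_E[of "commutator K (E (x, y, z)) (E (x', y', z'))"] by auto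
  have "E (x', y', z') \<otimes> E (x, y, z) \<otimes> E (i, j, k) = E (x, y, z) \<otimes> E (x', y', z')"
    using mult_commutator[of "E (x, y, z)" "E (x', y', z')"] by (simp add: e)
  then have *: "red (law (law (x', y', z') (x, y, z)) (i, j, k)) = red (law (x, y, z) (x', y', z'))"
    by (simp add: E_mult E_eq_iff)
  obtain s t where
    1: "law (law (x', y', z') (x, y, z)) (i, j, k) =
      (x + x' + i + u * s, y + y' + j + u * t, z + z' - x * y' + k - i * (y + y' + u * (z' * y - x * tri y' - x * y' * y)))"
    by (simp add: law_def) (metis (no_types, opaque_lifting) add.assoc add.commute distrib_left)
  have "law (x, y, z) (x', y', z') =
      (x + x' + u * (y * tri x' - z * x'), y + y' + u * (z * y' - x' * tri y - x' * y * y'), z + z' - x' * y)"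
    by (simp add: law_def)
  then obtain s' t' where "law (x, y, z) (x', y', z') = (x + x' + u * s', y + y' + u * t', z + z' - x' * y)"
    by blast
  note * = *[unfolded 1 this red_eq_iff]
  have "2 * q dvd (x + x' + i + u * s) - (x + x' + u * s')" "2 * q dvd (y + y' + j + u * t) - (y + y' + u * t')"
    using * double_q_dvd_N by (auto simp: cong_iff_dvd_diff intro: dvd_trans)
  moreover have "i = (x + x' + i + u * s) - (x + x' + u * s') + u * (s' - s)"
    "j = (y + y' + j + u * t) - (y + y' + u * t') + u * (t' - t)" by (simp_all add: algebra_simps)
  ultimately have ij: "2 * q dvd i" "2 * q dvd j"
    using double_q_dvd_u by (metis dvd_add dvd_mult2)+
  then have "[i * (y + y' + u * (z' * y - x * tri y' - x * y' * y)) = 0] (mod q)"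
    using double_q_dvd_q by (simp add: cong_0_iff)
  moreover have "q dvd z + z' - x * y' + k - i * (y + y' + u * (z' * y - x * tri y' - x * y' * y)) - (z + z' - x' * y)"
    using * by (simp add: cong_iff_dvd_diff)
  ultimately have "q dvd (z + z' - x * y' + k - i * (y + y' + u * (z' * y - x * tri y' - x * y' * y)) - (z + z' - x' * y))
      + i * (y + y' + u * (z' * y - x * tri y' - x * y' * y))"
    by (simp only: cong_0_iff dvd_add)
  then have "[k = x * y' - x' * y] (mod q)"
    by (simp add: cong_iff_dvd_diff algebra_simps)
  then show ?thesis using that e ij by blast
qed

text \<open>Of the two factors of \<open>n (n - 1)\<close> the second is odd, so the power of two 2 q divides the
  first.\<close>

lemma dvd_of_dvd_tri: "q dvd n \<Longrightarrow> q dvd tri n \<Longrightarrow> 2 * q dvd n"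
proof -
  assume n: "q dvd n" "q dvd tri n"
  then have "2 * q dvd n * (n - 1)" by (simp flip: two_tri)
  moreover have "coprime (2 * q) (n - 1)"
    using dvd_trans[OF even_q n(1)] by (simp flip: two_q)
  ultimately show "2 * q dvd n" using coprime_dvd_mult_left_iff by blast
qed

lemma center_iff: "g \<in> upper_central K 1 \<longleftrightarrow> g \<in> carrier K \<and> (\<forall>h \<in> carrier K. g \<otimes> h = h \<otimes> g)"
  unfolding One_nat_def upper_central_Suc_eq upper_central.simps(1) singleton_iff mem_Collect_eq
  by (rule conj_cong[OF refl], rule ball_cong[OF refl], rule commutator_eq_one_iff)

text \<open>It suffices to commute with a and b. Commuting with a makes q divide z, y and tri y, and
  commuting with b makes q divide x and tri x.\<close>

lemma Z1_iff: "E (x, y, z) \<in> upper_central K 1 \<longleftrightarrow> 2 * q dvd x \<and> 2 * q dvd y \<and> q dvd z"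
proof
  assume mem: "E (x, y, z) \<in> upper_central K 1"
  have comm: "E (x, y, z) \<otimes> g = g \<otimes> E (x, y, z)" if "g \<in> carrier K" for g
    using bspec[OF conjunct2[OF iffD1[OF center_iff mem]] that] .
  have "E (x, y, z) \<otimes> E (1, 0, 0) = E (1, 0, 0) \<otimes> E (x, y, z)" by (rule comm) simp
  then have 1: "[u * z = u * 0] (mod N)" "[u * tri y = u * 0] (mod N)" "q dvd y"
    by (auto simp: E_mult law_def E_eq_iff red_eq_iff cong_iff_dvd_diff)
  have "E (x, y, z) \<otimes> E (0, 1, 0) = E (0, 1, 0) \<otimes> E (x, y, z)" by (rule comm) simp
  then have 2: "[u * tri x = u * 0] (mod N)" "q dvd x"
    by (auto simp: E_mult law_def E_eq_iff red_eq_iff cong_iff_dvd_diff)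
  show "2 * q dvd x \<and> 2 * q dvd y \<and> q dvd z"
    using 1 2 dvd_of_dvd_tri unfolding u_mult_cong_iff cong_0_iff by blast
next
  assume d: "2 * q dvd x \<and> 2 * q dvd y \<and> q dvd z"
  have comm: "E (x, y, z) \<otimes> g = g \<otimes> E (x, y, z)" if "g \<in> carrier K" for g
  proof -
    obtain x' y' z' where g: "g = E (x', y', z')" using \<open>g \<in> carrier K\<close> obtain_E by blast
    have "[u * (z * x') = 0] (mod N)" "[u * (z * y') = 0] (mod N)" using d by (auto intro: u_mult_dvd)
    then show ?thesis using d unfolding g
      by (simp add: mult_near_central) (intro E_cong; auto simp: cong_iff_dvd_diff algebra_simps)
  qed
  show "E (x, y, z) \<in> upper_central K 1"
    by (rule iffD2[OF center_iff], rule conjI[OF E_closed], rule ballI, rule comm)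
qed

lemma Z2_iff: "E (x, y, z) \<in> upper_central K 2 \<longleftrightarrow> q dvd x \<and> q dvd y"
proof -
  have "E (x, y, z) \<in> upper_central K 2 \<longleftrightarrow>
      (\<forall>x' y' z'. commutator K (E (x, y, z)) (E (x', y', z')) \<in> upper_central K 1)"
  proof -
    have "upper_central K 2 = {g \<in> carrier K. \<forall>h \<in> carrier K. commutator K g h \<in> upper_central K 1}"
      using upper_central_Suc_eq[of 1] by (simp only: Suc_1)
    then show ?thesis by (simp only: mem_Collect_eq E_closed simp_thms ball_E)
  qed
  also have "\<dots> \<longleftrightarrow> (\<forall>x' y'. q dvd x * y' - x' * y)"
  proof -
    have "commutator K (E (x, y, z)) (E (x', y', z')) \<in> upper_central K 1 \<longleftrightarrow> q dvd x * y' - x' * y" for x' y' z'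
    proof -
      obtain i j k where "commutator K (E (x, y, z)) (E (x', y', z')) = E (i, j, k)"
        "2 * q dvd i" "2 * q dvd j" "[k = x * y' - x' * y] (mod q)"
        using commutator_E .
      then show ?thesis using Z1_iff by (simp add: cong_dvd_iff)
    qed
    then show ?thesis by simp
  qed
  also have "\<dots> \<longleftrightarrow> q dvd x \<and> q dvd y"
  proof
    assume *: "\<forall>x' y'. q dvd x * y' - x' * y"
    show "q dvd x \<and> q dvd y" using *[rule_format, of 1 0] *[rule_format, of 0 1] by simp
  qed auto
  finally show ?thesis .
qed

lemma commutator_in_Z2:
  assumes "g \<in> carrier K" "h \<in> carrier K"
  shows "commutator K g h \<in> upper_central K 2"
proof -
  obtain x y z x' y' z' where "g = E (x, y, z)" "h = E (x', y', z')"
    using assms obtain_E by metis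
  then show ?thesis using commutator_E[of x y z x' y' z'] double_q_dvd_q Z2_iff by metis
qed

section \<open>Pairs of elements satisfying the relations\<close>

text \<open>Each squaring doubles the exponents of a and b up to an error which gains a factor two. After m
  squarings the errors vanish modulo N, and the exponent of c vanishes modulo q.\<close>

lemma E_pow_two_power:
  "\<exists>r s t. E (x, y, z) [^] (2 ^ Suc k :: nat) = E (r, s, t) \<and> u * 2 ^ k dvd r - 2 ^ Suc k * x \<and>
    u * 2 ^ k dvd s - 2 ^ Suc k * y \<and> 2 ^ k dvd t"
proof (induction k)
  case 0
  have "E (x, y, z) [^] (2 ^ Suc 0 :: nat) =
      E (2 * x + u * (y * tri x - z * x), 2 * y + u * (z * y - x * tri y - x * y * y), 2 * z - x * y)"
    by (simp add: E_mult law_def numeral_2_eq_2)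
  then show ?case by (intro exI conjI) (assumption, simp_all)
next
  case (Suc k)
  then obtain r s t where e: "E (x, y, z) [^] (2 ^ Suc k :: nat) = E (r, s, t)"
    and d: "u * 2 ^ k dvd r - 2 ^ Suc k * x" "u * 2 ^ k dvd s - 2 ^ Suc k * y" "2 ^ k dvd t" by blast
  have "2 ^ Suc k dvd u * 2 ^ k" by (simp add: u_eq)
  then have r: "2 ^ Suc k dvd r" and s: "2 ^ Suc k dvd s"
    using dvd_add[OF dvd_trans[OF _ d(1)] dvd_triv_left[of "2 ^ Suc k" x]]
      dvd_add[OF dvd_trans[OF _ d(2)] dvd_triv_left[of "2 ^ Suc k" y]] by simp_all
  have "(2::nat) ^ Suc (Suc k) = 2 ^ Suc k + 2 ^ Suc k" by simp
  then have "E (x, y, z) [^] (2 ^ Suc (Suc k) :: nat) = E (r, s, t) \<otimes> E (r, s, t)"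
    by (simp only: nat_pow_mult[symmetric] E_closed e)
  also have "\<dots> = E (2 * r + u * (s * tri r - t * r), 2 * s + u * (t * s - r * tri s - r * s * s), 2 * t - r * s)"
    by (simp add: E_mult law_def)
  finally have e2: "E (x, y, z) [^] (2 ^ Suc (Suc k) :: nat) =
      E (2 * r + u * (s * tri r - t * r), 2 * s + u * (t * s - r * tri s - r * s * s), 2 * t - r * s)" .
  have "2 ^ Suc k dvd s * tri r - t * r" "2 ^ Suc k dvd t * s - r * tri s - r * s * s"
    using r s by (auto intro!: dvd_diff simp del: power_Suc)
  note c = this[THEN mult_dvd_mono[OF dvd_refl[of u]]]
  have "u * 2 ^ Suc k dvd 2 * (r - 2 ^ Suc k * x)" "u * 2 ^ Suc k dvd 2 * (s - 2 ^ Suc k * y)"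
    using d(1,2)[THEN mult_dvd_mono[OF dvd_refl[of 2]]] by (simp_all add: mult.left_commute)
  note c = dvd_add[OF this(1) c(1)] dvd_add[OF this(2) c(2)]
  have "2 * (r - 2 ^ Suc k * x) + u * (s * tri r - t * r) = 2 * r + u * (s * tri r - t * r) - 2 ^ Suc (Suc k) * x"
    "2 * (s - 2 ^ Suc k * y) + u * (t * s - r * tri s - r * s * s) =
      2 * s + u * (t * s - r * tri s - r * s * s) - 2 ^ Suc (Suc k) * y"
    by simp_all
  note c = c[unfolded this]
  moreover have "2 ^ Suc k dvd 2 * t - r * s" using d(3) r by (auto intro: dvd_diff)
  ultimately show ?case using e2 by blast
qed

lemma E_pow_double_q: "E (x, y, z) [^] (2 * q) = E (2 * q * x, 2 * q * y, 0)"
proof -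
  have m: "Suc (m - 1) = m" using m_gt_1 by simp
  obtain r s t where e: "E (x, y, z) [^] (2 ^ m :: nat) = E (r, s, t)"
    and d: "u * q dvd r - 2 * q * x" "u * q dvd s - 2 * q * y" "q dvd t"
    using E_pow_two_power[of x y z "m - 1"] unfolding m q_def[symmetric] two_q by blast
  have "N dvd u * q" by (simp add: N_eq u_eq)
  then have "E (r, s, t) = E (2 * q * x, 2 * q * y, 0)"
    using d by (intro E_cong) (auto simp: cong_iff_dvd_diff intro: dvd_trans)
  then show ?thesis using e int_pow_int[of K "E (x, y, z)" "2 ^ m"] by (simp add: two_q)
qed

lemma E_pow_u: "E (x, y, z) [^] u = E (u * x, u * y, 0)"
proof -
  have "E (x, y, z) [^] u = (E (x, y, z) [^] (2 * q)) [^] l" by (simp add: int_pow_pow u_eq)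
  also have "\<dots> = E (l * (2 * q * x), l * (2 * q * y), 0)"
    by (simp add: E_pow_double_q near_central_pow)
  finally show ?thesis by (simp add: u_eq algebra_simps)
qed

lemma E_pow_N: "g \<in> carrier K \<Longrightarrow> g [^] (2 ^ (2 * m - 1) :: nat) = \<one>"
proof -
  assume "g \<in> carrier K"
  then obtain x y z where g: "g = E (x, y, z)" using obtain_E by blast
  have "int (2 ^ (2 * m - 1)) = 2 * q * q" using N_eq by (simp add: N_def)
  then have "g [^] (int (2 ^ (2 * m - 1))) = g [^] (2 * q * q)" by simp
  also have "\<dots> = (g [^] (2 * q)) [^] q" using \<open>g \<in> carrier K\<close> by (simp add: int_pow_pow)
  also have "\<dots> = E (q * (2 * q * x), q * (2 * q * y), 0)"
    by (simp add: g E_pow_double_q near_central_pow)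
  also have "\<dots> = E (0, 0, 0)" by (rule E_cong) (simp_all add: cong_0_iff N_eq)
  finally show ?thesis using int_pow_int[of K g "2 ^ (2 * m - 1)"] by (simp add: E_0)
qed

lemma commutator_pow_q:
  assumes "g \<in> carrier K" "h \<in> carrier K"
  shows "commutator K g h [^] (2 ^ (m - 1) :: nat) = \<one>"
proof -
  obtain x y z x' y' z' where "g = E (x, y, z)" "h = E (x', y', z')"
    using assms obtain_E by metis
  then obtain i j k where e: "commutator K g h = E (i, j, k)" "2 * q dvd i" "2 * q dvd j"
    using commutator_E by metis
  have "int (2 ^ (m - 1)) = q" by (simp add: q_def)
  then have "commutator K g h [^] (int (2 ^ (m - 1))) = E (q * i, q * j, q * k)"
    using e by (simp only: near_central_pow)
  also have "\<dots> = E (0, 0, 0)" using e by (intro E_cong) (auto simp: cong_0_iff N_eq)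
  finally show ?thesis using int_pow_int[of K "commutator K g h" "2 ^ (m - 1)"] by (simp add: E_0)
qed

text \<open>The commutator acts on the first element like \<open>c\<^sup>d\<close>, hence multiplies its exponents by
  \<open>1 + u d\<close> and \<open>1 - u d\<close> respectively, whereas the power \<open>1 + u\<close> multiplies both exponents by
  \<open>1 + u\<close>. Comparing the two gives a condition for each exponent.\<close>

lemma conj_by_commutator_eq_pow_iff:
  fixes x y x' y' :: int
  defines "d \<equiv> x * y' - x' * y"
  shows "conj_by K (E (x, y, z)) (commutator K (E (x, y, z)) (E (x', y', z'))) = E (x, y, z) [^] (1 + 2 ^ m * l)
    \<longleftrightarrow> q dvd x * (d - 1) \<and> q dvd y * (d + 1)"
proof -
  obtain i j k where e: "commutator K (E (x, y, z)) (E (x', y', z')) = E (i, j, k)"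
    and ij: "2 * q dvd i" "2 * q dvd j" and k: "[k = d] (mod q)"
    using commutator_E unfolding d_def by blast
  have "E (x, y, z) [^] (1 + 2 ^ m * l) = E (x, y, z) \<otimes> E (u * x, u * y, 0)"
    by (simp add: int_pow_mult E_pow_u flip: u_def)
  then have "conj_by K (E (x, y, z)) (E (i, j, k)) = E (x, y, z) [^] (1 + 2 ^ m * l) \<longleftrightarrow>
      E (x, y, z) \<otimes> E (i, j, k) = E (i, j, k) \<otimes> E (x, y, z) \<otimes> E (u * x, u * y, 0)"
    by (simp add: conj_by_eq_iff m_assoc)
  also have "\<dots> \<longleftrightarrow> E (x + i, y + j, z + k) =
      E (x + i - u * (k * x) + u * x, y + j + u * (k * y) + u * y, z + k)"
    using ij double_q_dvd_u by (simp add: mult_near_central)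
  also have "\<dots> \<longleftrightarrow> [u * (x * (k - 1)) = u * 0] (mod N) \<and> [u * (y * (k + 1)) = u * 0] (mod N)"
  proof -
    have "x + i - (x + i - u * (k * x) + u * x) = u * (x * (k - 1)) - u * 0"
      "y + j - (y + j + u * (k * y) + u * y) = - (u * (y * (k + 1)) - u * 0)" by (simp_all add: algebra_simps)
    then show ?thesis unfolding E_eq_iff red_eq_iff cong_iff_dvd_diff by simp
  qed
  also have "\<dots> \<longleftrightarrow> q dvd x * (d - 1) \<and> q dvd y * (d + 1)"
    unfolding u_mult_cong_iff cong_0_iff
    using cong_mult[OF cong_refl[of x q] cong_diff[OF k cong_refl[of 1]]]
      cong_mult[OF cong_refl[of y q] cong_add[OF k cong_refl[of 1]]]
    by (simp add: cong_dvd_iff)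
  finally show ?thesis by (simp add: e)
qed

definition admissible :: "int \<Rightarrow> int \<Rightarrow> int \<Rightarrow> int \<Rightarrow> bool" where
  "admissible x y x' y' \<longleftrightarrow> (let d = x * y' - x' * y in
     q dvd x * (d - 1) \<and> q dvd y * (d + 1) \<and> q dvd x' * (d + 1) \<and> q dvd y' * (d - 1))"

text \<open>The order relations hold for all pairs. The two conjugation relations are mirror images,
  with the sign of the determinant reversed.\<close>

theorem satisfies_K_relations_iff:
  "satisfies_K_relations K m l (E (x, y, z)) (E (x', y', z')) \<longleftrightarrow> admissible x y x' y'"
proof -
  have d: "x' * y - x * y' = - (x * y' - x' * y)" by simp
  have s: "- t - 1 = - (t + 1)" "- t + 1 = - (t - 1)" for t :: int by simp_all
  show ?thesis
    using conj_by_commutator_eq_pow_iff[of x y z x' y' z'] conj_by_commutator_eq_pow_iff[of x' y' z' x y z]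
    unfolding d s mult_minus_right dvd_minus_iff satisfies_K_relations_def admissible_def Let_def
      E_pow_N[OF E_closed] commutator_pow_q[OF E_closed E_closed] by blast
qed

end

section \<open>Automorphism groups and induced automorphisms\<close>

lemma carrier_Aut: "carrier (Aut G) = auto G"
  by (simp add: Aut_def AutoGroup_def)

lemma Aut_mult: "f \<in> auto G \<Longrightarrow> g \<in> auto G \<Longrightarrow> f \<otimes>\<^bsub>Aut G\<^esub> g = compose (carrier G) g f"
  by (simp add: Aut_def AutoGroup_def BijGroup_def auto_def)

lemma Aut_one: "\<one>\<^bsub>Aut G\<^esub> = (\<lambda>x \<in> carrier G. x)"
  by (simp add: Aut_def AutoGroup_def BijGroup_def)

lemma (in group) group_Aut: "group (Aut G)"
proof -
  interpret A: group "AutoGroup G" by (rule AutoGroup)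
  show ?thesis
  proof (rule groupI)
    fix f assume "f \<in> carrier (Aut G)"
    then have "f \<in> carrier (AutoGroup G)" by (simp add: Aut_def)
    then show "\<exists>g \<in> carrier (Aut G). g \<otimes>\<^bsub>Aut G\<^esub> f = \<one>\<^bsub>Aut G\<^esub>"
      by (intro bexI[of _ "inv\<^bsub>AutoGroup G\<^esub> f"]) (simp_all add: Aut_def)
  qed (simp_all add: Aut_def A.m_assoc)
qed

lemma auto_hom: "\<psi> \<in> auto G \<Longrightarrow> \<psi> \<in> hom G G"
  by (simp add: auto_def)

lemma auto_closed: "\<psi> \<in> auto G \<Longrightarrow> x \<in> carrier G \<Longrightarrow> \<psi> x \<in> carrier G"
  using hom_in_carrier[OF auto_hom] .

lemma auto_bij: "\<psi> \<in> auto G \<Longrightarrow> bij_betw \<psi> (carrier G) (carrier G)"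
  by (simp add: auto_def Bij_def)

lemma auto_eqI:
  assumes "\<psi> \<in> auto G" "\<psi>' \<in> auto G" "\<And>x. x \<in> carrier G \<Longrightarrow> \<psi> x = \<psi>' x"
  shows "\<psi> = \<psi>'"
  using assms by (auto simp: auto_def Bij_def intro: extensionalityI)

lemma autoI:
  assumes "\<psi> \<in> hom G G" "bij_betw \<psi> (carrier G) (carrier G)" "group G"
  shows "(\<lambda>x \<in> carrier G. \<psi> x) \<in> auto G"
proof -
  have "bij_betw (\<lambda>x \<in> carrier G. \<psi> x) (carrier G) (carrier G)"
    by (rule iffD2[OF bij_betw_cong assms(2)]) simp
  moreover have "(\<lambda>x \<in> carrier G. \<psi> x) \<in> hom G G"
    using assms(1,3) by (auto intro!: homI simp: hom_mult hom_in_carrier group.is_monoid monoid.m_closed)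
  ultimately show ?thesis by (simp add: auto_def Bij_def)
qed

lemma (in group) auto_group_hom: "\<psi> \<in> auto G \<Longrightarrow> group_hom G G \<psi>"
  by (simp add: group_hom_def group_hom_axioms_def auto_hom)

lemma Aut_apply:
  "\<psi> \<in> auto G \<Longrightarrow> \<psi>' \<in> auto G \<Longrightarrow> x \<in> carrier G \<Longrightarrow> (\<psi> \<otimes>\<^bsub>Aut G\<^esub> \<psi>') x = \<psi>' (\<psi> x)"
  by (simp add: Aut_mult compose_def)

lemma (in group) upper_central_characteristic:
  assumes "\<psi> \<in> auto G" "x \<in> carrier G"
  shows "\<psi> x \<in> upper_central G i \<longleftrightarrow> x \<in> upper_central G i"
  using assms(2)
proof (induction i arbitrary: x)
  case 0
  interpret \<psi>: group_hom G G \<psi> by (rule auto_group_hom[OF assms(1)])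
  have "inj_on \<psi> (carrier G)" using auto_bij[OF assms(1)] by (simp add: bij_betw_def)
  then show ?case using 0 \<psi>.hom_one inj_onD[of \<psi> "carrier G" x \<one>] by auto
next
  case (Suc i)
  interpret \<psi>: group_hom G G \<psi> by (rule auto_group_hom[OF assms(1)])
  have surj: "carrier G = \<psi> ` carrier G" using auto_bij[OF assms(1)] by (simp add: bij_betw_def)
  have "(\<forall>g \<in> carrier G. commutator G (\<psi> x) g \<in> upper_central G i) \<longleftrightarrow>
      (\<forall>h \<in> carrier G. commutator G (\<psi> x) (\<psi> h) \<in> upper_central G i)"
    by (subst surj) blast
  also have "\<dots> \<longleftrightarrow> (\<forall>h \<in> carrier G. commutator G x h \<in> upper_central G i)"
    using Suc by (simp flip: \<psi>.hom_commutator)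
  finally show ?case using Suc.prems by (simp add: upper_central_Suc_eq del: upper_central.simps)
qed

locale characteristic_subgroup = normal +
  assumes invariant: "\<psi> \<in> auto G \<Longrightarrow> x \<in> carrier G \<Longrightarrow> \<psi> x \<in> H \<longleftrightarrow> x \<in> H"
begin

lemma image_coset:
  assumes "\<psi> \<in> auto G" "x \<in> carrier G"
  shows "\<psi> ` (H #> x) = H #> \<psi> x"
proof -
  interpret \<psi>: group_hom G G \<psi> by (rule auto_group_hom[OF assms(1)])
  have "\<psi> ` H = H"
  proof
    show "\<psi> ` H \<subseteq> H" using invariant[OF assms(1)] by auto
    show "H \<subseteq> \<psi> ` H"
    proof
      fix h assume h: "h \<in> H"
      then obtain g where "g \<in> carrier G" "h = \<psi> g"
        using auto_bij[OF assms(1)] by (metis bij_betw_imp_surj_on imageE mem_carrier)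
      then show "h \<in> \<psi> ` H" using h invariant[OF assms(1)] by blast
    qed
  qed
  moreover have "\<psi> ` (H #> x) = (\<psi> ` H) #> \<psi> x"
  proof -
    have "\<psi> ` (H #> x) = (\<lambda>h. \<psi> (h \<otimes> x)) ` H" "(\<psi> ` H) #> \<psi> x = (\<lambda>h. \<psi> h \<otimes> \<psi> x) ` H"
      by (auto simp: r_coset_def)
    then show ?thesis using assms(2) by simp
  qed
  ultimately show ?thesis by simp
qed

lemma induced_aut_coset:
  assumes "\<psi> \<in> auto G" "x \<in> carrier G"
  shows "induced_aut G H \<psi> (H #> x) = H #> \<psi> x"
  using assms by (simp add: induced_aut_def image_coset carrier_FactGroup)

lemma induced_aut_closed:
  assumes "\<psi> \<in> auto G"
  shows "induced_aut G H \<psi> \<in> auto (G Mod H)"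
proof -
  interpret \<psi>: group_hom G G \<psi> by (rule auto_group_hom[OF assms(1)])
  have "(\<lambda>C. \<psi> ` C) \<in> hom (G Mod H) (G Mod H)"
    using assms by (auto simp: hom_def carrier_FactGroup image_coset rcos_sum auto_closed)
  moreover have "bij_betw (\<lambda>C. \<psi> ` C) (carrier (G Mod H)) (carrier (G Mod H))"
  proof (rule bij_betw_imageI)
    show "inj_on (\<lambda>C. \<psi> ` C) (carrier (G Mod H))"
    proof (rule inj_onI)
      fix C D assume "C \<in> carrier (G Mod H)" "D \<in> carrier (G Mod H)" and eq: "\<psi> ` C = \<psi> ` D"
      then obtain x y where xy: "x \<in> carrier G" "C = H #> x" "y \<in> carrier G" "D = H #> y"
        by (auto simp: carrier_FactGroup)
      then have "\<psi> (x \<otimes> inv y) \<in> H"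
        using eq assms by (simp add: image_coset rcoset_eq_iff auto_closed)
      then show "C = D" using xy invariant[OF assms, of "x \<otimes> inv y"] by (simp add: rcoset_eq_iff)
    qed
    have "(\<lambda>C. \<psi> ` C) ` carrier (G Mod H) = (\<lambda>x. H #> \<psi> x) ` carrier G"
      using assms by (simp add: carrier_FactGroup image_image image_coset)
    also have "\<dots> = (\<lambda>x. H #> x) ` \<psi> ` carrier G" by (simp only: image_image)
    also have "\<dots> = carrier (G Mod H)"
      using auto_bij[OF assms] by (simp add: bij_betw_def carrier_FactGroup)
    finally show "(\<lambda>C. \<psi> ` C) ` carrier (G Mod H) = carrier (G Mod H)" .
  qed
  ultimately show ?thesis unfolding induced_aut_def by (rule autoI) (rule factorgroup_is_group)
qed

lemma group_hom_induced_aut: "group_hom (Aut G) (Aut (G Mod H)) (induced_aut G H)"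
proof -
  interpret Q: group "G Mod H" by (rule factorgroup_is_group)
  interpret A: group "Aut G" by (rule group_Aut)
  have "induced_aut G H (\<psi> \<otimes>\<^bsub>Aut G\<^esub> \<psi>') = induced_aut G H \<psi> \<otimes>\<^bsub>Aut (G Mod H)\<^esub> induced_aut G H \<psi>'"
    if "\<psi> \<in> auto G" "\<psi>' \<in> auto G" for \<psi> \<psi>'
  proof -
    have c: "\<psi> \<otimes>\<^bsub>Aut G\<^esub> \<psi>' \<in> auto G" using that A.m_closed by (simp add: carrier_Aut)
    interpret Q': group "Aut (G Mod H)" by (rule Q.group_Aut)
    show ?thesis
    proof (rule auto_eqI[of _ "G Mod H"])
      show "induced_aut G H \<psi> \<otimes>\<^bsub>Aut (G Mod H)\<^esub> induced_aut G H \<psi>' \<in> auto (G Mod H)"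
        using that Q'.m_closed by (simp add: induced_aut_closed carrier_Aut)
      fix C assume C: "C \<in> carrier (G Mod H)"
      then obtain x where x: "x \<in> carrier G" "C = H #> x" by (auto simp: carrier_FactGroup)
      have "induced_aut G H (\<psi> \<otimes>\<^bsub>Aut G\<^esub> \<psi>') C = H #> \<psi>' (\<psi> x)"
        using c x that by (simp add: induced_aut_coset Aut_apply)
      also have "\<dots> = induced_aut G H \<psi>' (induced_aut G H \<psi> C)"
        using x that by (simp add: induced_aut_coset auto_closed)
      finally show "induced_aut G H (\<psi> \<otimes>\<^bsub>Aut G\<^esub> \<psi>') C =
          (induced_aut G H \<psi> \<otimes>\<^bsub>Aut (G Mod H)\<^esub> induced_aut G H \<psi>') C"
        using that C by (simp add: Aut_apply induced_aut_closed)
    qed (rule induced_aut_closed[OF c])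
  qed
  then have "induced_aut G H \<in> hom (Aut G) (Aut (G Mod H))"
    by (intro homI) (simp_all add: carrier_Aut induced_aut_closed)
  then show ?thesis by (simp add: group_hom_def group_hom_axioms_def Q.group_Aut A.is_group)
qed

lemma kernel_induced_aut:
  "kernel (Aut G) (Aut (G Mod H)) (induced_aut G H) =
    {\<psi> \<in> auto G. \<forall>x \<in> carrier G. H #> \<psi> x = H #> x}"
proof -
  have "induced_aut G H \<psi> = \<one>\<^bsub>Aut (G Mod H)\<^esub> \<longleftrightarrow> (\<forall>x \<in> carrier G. H #> \<psi> x = H #> x)" if "\<psi> \<in> auto G" for \<psi>
  proof
    assume *: "induced_aut G H \<psi> = \<one>\<^bsub>Aut (G Mod H)\<^esub>"
    show "\<forall>x \<in> carrier G. H #> \<psi> x = H #> x"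
    proof
      fix x assume x: "x \<in> carrier G"
      then have "induced_aut G H \<psi> (H #> x) = H #> x"
        by (simp add: * Aut_one carrier_FactGroup)
      then show "H #> \<psi> x = H #> x" using that x by (simp add: induced_aut_coset)
    qed
  next
    assume *: "\<forall>x \<in> carrier G. H #> \<psi> x = H #> x"
    show "induced_aut G H \<psi> = \<one>\<^bsub>Aut (G Mod H)\<^esub>"
      unfolding induced_aut_def Aut_one
    proof (rule restrict_ext)
      fix C assume "C \<in> carrier (G Mod H)"
      then obtain x where "x \<in> carrier G" "C = H #> x" by (auto simp: carrier_FactGroup)
      then show "\<psi> ` C = C" using * that by (simp add: image_coset)
    qed
  qed
  then show ?thesis by (auto simp: kernel_def carrier_Aut)
qed

end

lemma (in group) characteristic_upper_central: "characteristic_subgroup (upper_central G i) G"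
  by (intro characteristic_subgroup.intro characteristic_subgroup_axioms.intro normal_upper_central)
    (rule upper_central_characteristic)

section \<open>Which pairs are images of the generators under automorphisms\<close>

context K_group
begin

text \<open>The exponents of a and b modulo q are the coordinates of \<open>K/Z\<^sub>2(K)\<close>.\<close>

definition exp_a :: "'a \<Rightarrow> int" where "exp_a g = fst (SOME p. E p = g) mod q"
definition exp_b :: "'a \<Rightarrow> int" where "exp_b g = fst (snd (SOME p. E p = g)) mod q"

lemma exp_E [simp]: "exp_a (E (x, y, z)) = x mod q" "exp_b (E (x, y, z)) = y mod q"
proof -
  obtain x' y' z' where s: "(SOME p. E p = E (x, y, z)) = (x', y', z')" by (metis prod_cases3)
  have "E (SOME p. E p = E (x, y, z)) = E (x, y, z)" by (rule someI[of _ "(x, y, z)"]) simp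
  from this[unfolded s, unfolded E_eq_iff red_eq_iff] have "[x' = x] (mod N)" "[y' = y] (mod N)" by auto
  from this[THEN cong_N_imp_cong_q, unfolded Cong.cong_def]
  show "exp_a (E (x, y, z)) = x mod q" "exp_b (E (x, y, z)) = y mod q"
    by (simp_all add: exp_a_def exp_b_def s)
qed

lemma nat_q: "int (2 ^ (m - 1)) = q" "int (2 ^ (m - Suc 0)) = q"
  by (simp_all add: q_def)

lemma exp_a_hom: "exp_a \<in> hom K (integer_mod_group (2 ^ (m - 1)))"
  and exp_b_hom: "exp_b \<in> hom K (integer_mod_group (2 ^ (m - 1)))"
proof -
  have 1: "exp_a (g \<otimes> h) = (exp_a g + exp_a h) mod q" "exp_b (g \<otimes> h) = (exp_b g + exp_b h) mod q"
    if gh: "g \<in> carrier K" "h \<in> carrier K" for g h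
  proof -
    obtain x y z where g: "g = E (x, y, z)" by (rule obtain_E[OF gh(1)])
    obtain x' y' z' where h: "h = E (x', y', z')" by (rule obtain_E[OF gh(2)])
    have "[x + x' + u * (y * tri x' - z * x') = x + x'] (mod q)"
      "[y + y' + u * (z * y' - x' * tri y - x' * y * y') = y + y'] (mod q)"
      by (rule cong_add_u_mult)+
    then show "exp_a (g \<otimes> h) = (exp_a g + exp_a h) mod q" "exp_b (g \<otimes> h) = (exp_b g + exp_b h) mod q"
      by (simp_all add: g h E_mult law_def Cong.cong_def mod_add_eq)
  qed
  have 2: "exp_a g \<in> {0..<q}" "exp_b g \<in> {0..<q}" for g
    by (simp_all add: exp_a_def exp_b_def)
  show "exp_a \<in> hom K (integer_mod_group (2 ^ (m - 1)))" "exp_b \<in> hom K (integer_mod_group (2 ^ (m - 1)))"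
    using 1 2 by (auto intro!: homI simp: carrier_integer_mod_group nat_q simp del: of_nat_power)
qed

lemma hom_to_cyclic_E:
  assumes "f \<in> hom K (integer_mod_group (2 ^ (m - 1)))"
  shows "f (E (x, y, z)) = (x * f a + y * f b) mod q"
proof -
  interpret C: comm_group "integer_mod_group (2 ^ (m - 1))" by (rule abelian_integer_mod_group)
  interpret f: group_hom K "integer_mod_group (2 ^ (m - 1))" f
    using assms by (simp add: group_hom_def group_hom_axioms_def)
  have "f c = \<one>\<^bsub>integer_mod_group (2 ^ (m - 1))\<^esub>"
    unfolding c_def f.hom_commutator[OF a_closed b_closed]
    by (intro iffD2[OF C.commutator_eq_one_iff] C.m_comm f.hom_closed a_closed b_closed)
  then have "f c = 0" by simp
  then show ?thesis
    by (simp add: E_def f.hom_int_pow int_pow_integer_mod_group nat_q mod_simps del: of_nat_power)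
qed

lemma mod_linear_combination:
  "(x mod q * s + y mod q * t) mod q = (x * s + y * t) mod q"
  "(x * (s mod q) + y * (t mod q)) mod q = (x * s + y * t) mod q"
proof -
  have "[x mod q * s + y mod q * t = x * s + y * t] (mod q)" for x y s t
    by (intro cong_add cong_mult cong_refl) simp_all
  from this[of x s y t] this[of s x t y]
  show "(x mod q * s + y mod q * t) mod q = (x * s + y * t) mod q"
    "(x * (s mod q) + y * (t mod q)) mod q = (x * s + y * t) mod q"
    by (simp_all only: Cong.cong_def mult.commute)
qed

lemma exp_hom_image:
  assumes "\<psi> \<in> hom K K" "g \<in> carrier K"
  shows "exp_a (\<psi> g) = (exp_a g * exp_a (\<psi> a) + exp_b g * exp_a (\<psi> b)) mod q"
    and "exp_b (\<psi> g) = (exp_a g * exp_b (\<psi> a) + exp_b g * exp_b (\<psi> b)) mod q"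
proof -
  obtain x y z where g: "g = E (x, y, z)" by (rule obtain_E[OF assms(2)])
  show "exp_a (\<psi> g) = (exp_a g * exp_a (\<psi> a) + exp_b g * exp_a (\<psi> b)) mod q"
    using hom_to_cyclic_E[OF hom_compose[OF assms(1) exp_a_hom], of x y z] by (simp add: g mod_linear_combination compose_def)
  show "exp_b (\<psi> g) = (exp_a g * exp_b (\<psi> a) + exp_b g * exp_b (\<psi> b)) mod q"
    using hom_to_cyclic_E[OF hom_compose[OF assms(1) exp_b_hom], of x y z] by (simp add: g mod_linear_combination compose_def)
qed

lemma exp_range: "0 \<le> exp_a g" "exp_a g < q" "0 \<le> exp_b g" "exp_b g < q"
  by (simp_all add: exp_a_def exp_b_def)

lemma coset_Z2_eq_iff:
  assumes "g \<in> carrier K" "h \<in> carrier K"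
  shows "upper_central K 2 #> g = upper_central K 2 #> h \<longleftrightarrow> exp_a g = exp_a h \<and> exp_b g = exp_b h"
proof -
  interpret Z: characteristic_subgroup "upper_central K 2" K by (rule characteristic_upper_central)
  obtain i j k where w: "g \<otimes> inv h = E (i, j, k)"
    by (rule obtain_E[of "g \<otimes> inv h"]) (use assms in auto)
  then have g: "g = E (i, j, k) \<otimes> h" using assms by (simp add: m_assoc flip: w)
  have "exp_a g = (i mod q + exp_a h) mod q" "exp_b g = (j mod q + exp_b h) mod q"
    using exp_a_hom exp_b_hom assms unfolding g
    by (simp_all add: hom_mult nat_q mod_simps del: of_nat_power)
  moreover have "(s mod q + t) mod q = t \<longleftrightarrow> q dvd s" if "0 \<le> t" "t < q" for s t
  proof -
    have "(s mod q + t) mod q = t \<longleftrightarrow> [s + t = t] (mod q)" using that by (simp add: Cong.cong_def mod_simps)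
    then show ?thesis by (simp add: cong_iff_dvd_diff)
  qed
  ultimately show ?thesis
    using assms exp_range by (simp add: Z.rcoset_eq_iff w Z2_iff)
qed

definition aut_condition :: "int \<Rightarrow> int \<Rightarrow> int \<Rightarrow> int \<Rightarrow> bool" where
  "aut_condition x y x' y' \<longleftrightarrow> admissible x y x' y' \<and> odd (x * y' - x' * y)"

lemma admissible_cong:
  assumes "[x = i] (mod q)" "[y = j] (mod q)" "[x' = i'] (mod q)" "[y' = j'] (mod q)"
  shows "admissible x y x' y' \<longleftrightarrow> admissible i j i' j'"
proof -
  have d: "[x * y' - x' * y = i * j' - i' * j] (mod q)" by (intro cong_mult cong_diff assms)
  note cong_mult[OF assms(1) cong_diff[OF d cong_refl[of 1]], THEN cong_dvd_iff]
    cong_mult[OF assms(2) cong_add[OF d cong_refl[of 1]], THEN cong_dvd_iff]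
    cong_mult[OF assms(3) cong_add[OF d cong_refl[of 1]], THEN cong_dvd_iff]
    cong_mult[OF assms(4) cong_diff[OF d cong_refl[of 1]], THEN cong_dvd_iff]
  then show ?thesis unfolding admissible_def Let_def by (simp only:)
qed

lemma odd_det_cong:
  assumes "[x = i] (mod q)" "[y = j] (mod q)" "[x' = i'] (mod q)" "[y' = j'] (mod q)"
  shows "odd (x * y' - x' * y) \<longleftrightarrow> odd (i * j' - i' * j)"
proof -
  have "[x * y' - x' * y = i * j' - i' * j] (mod q)" by (intro cong_mult cong_diff assms)
  from cong_dvd_iff[OF cong_dvd_modulus[OF this even_q]] show ?thesis by (rule arg_cong)
qed

lemma aut_condition_mod_q [simp]:
  "aut_condition (x mod q) (y mod q) (x' mod q) (y' mod q) \<longleftrightarrow> aut_condition x y x' y'"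
  unfolding aut_condition_def
  using admissible_cong[of "x mod q" x "y mod q" y "x' mod q" x' "y' mod q" y']
    odd_det_cong[of "x mod q" x "y mod q" y "x' mod q" x' "y' mod q" y'] by simp

text \<open>The kernel is a normal subgroup of a nilpotent group, so it is trivial as soon as it meets the
  centre trivially. The centre is generated by the powers of a and b with exponent 2 q, and an
  endomorphism acts on it by its matrix, which is invertible modulo q when the determinant is
  odd.\<close>

lemma endomorphism_inj:
  assumes "\<psi> \<in> hom K K" "\<psi> a = E (x, y, z)" "\<psi> b = E (x', y', z')" "odd (x * y' - x' * y)"
  shows "inj_on \<psi> (carrier K)"
proof -
  interpret \<psi>: group_hom K K \<psi> using assms by (simp add: group_hom_def group_hom_axioms_def)
  have center: "g = \<one>" if "g \<in> upper_central K 1" "\<psi> g = \<one>" for g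
  proof -
    have "g \<in> carrier K" using iffD1[OF center_iff that(1)] by blast
    then obtain i j k where g: "g = E (i, j, k)" by (rule obtain_E)
    then have "2 * q dvd i" "2 * q dvd j" "q dvd k" using that(1) Z1_iff by auto
    then obtain s t where st: "i = 2 * q * s" "j = 2 * q * t" by (meson dvdE)
    have "E (i, j, k) = E (i, j, 0)" using \<open>q dvd k\<close> by (intro E_cong) (auto simp: cong_0_iff)
    also have "\<dots> = (a [^] (2 * q)) [^] s \<otimes> (b [^] (2 * q)) [^] t"
      by (simp add: E_def st int_pow_pow)
    finally have g: "g = (a [^] (2 * q)) [^] s \<otimes> (b [^] (2 * q)) [^] t" by (simp add: g)
    have "\<psi> g = (\<psi> a [^] (2 * q)) [^] s \<otimes> (\<psi> b [^] (2 * q)) [^] t"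
      by (simp add: g \<psi>.hom_int_pow)
    also have "\<dots> = E (2 * q * (s * x + t * x'), 2 * q * (s * y + t * y'), 0)"
      by (simp add: assms E_pow_double_q near_central_pow mult_near_central) (simp add: algebra_simps)
    finally have "E (2 * q * (s * x + t * x'), 2 * q * (s * y + t * y'), 0) = E (0, 0, 0)"
      using that(2) by (simp add: E_0)
    then have "2 * q * q dvd 2 * q * (s * x + t * x')" "2 * q * q dvd 2 * q * (s * y + t * y')"
      by (simp_all add: E_eq_iff red_eq_iff cong_0_iff flip: N_eq)
    then have 1: "q dvd s * x + t * x'" "q dvd s * y + t * y'" using q_pos by auto
    have "q dvd (s * x + t * x') * y' - (s * y + t * y') * x'" "q dvd (s * y + t * y') * x - (s * x + t * x') * y"
      using 1 by (auto intro!: dvd_diff)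
    then have 2: "q dvd s * (x * y' - x' * y)" "q dvd t * (x * y' - x' * y)" by (simp_all add: algebra_simps)
    have "coprime q (x * y' - x' * y)" using assms(4) by (simp add: q_def)
    then have "q dvd s" "q dvd t" using 2 by (simp_all add: coprime_dvd_mult_left_iff)
    then have "E (i, j, 0) = E (0, 0, 0)" by (intro E_cong) (auto simp: st N_eq cong_0_iff)
    then show "g = \<one>" using \<open>E (i, j, k) = E (i, j, 0)\<close> by (simp add: E_0 \<open>g = E (i, j, k)\<close>)
  qed
  have step: "g = \<one>" if "g \<in> carrier K" "\<psi> g = \<one>"
    and "\<And>h. h \<in> carrier K \<Longrightarrow> commutator K g h = \<one>" for g
  proof (rule center[OF _ that(2)], rule iffD2[OF center_iff], rule conjI[OF that(1)], rule ballI)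
    fix h assume "h \<in> carrier K"
    then show "g \<otimes> h = h \<otimes> g" using that(1,3) commutator_eq_one_iff by blast
  qed
  have kernel: "\<psi> (commutator K g h) = \<one>" if "g \<in> carrier K" "\<psi> g = \<one>" "h \<in> carrier K" for g h
    using that by (simp add: \<psi>.hom_commutator) (simp add: commutator_def)
  \<comment> \<open>Climb the central series: commutators with K stay in the kernel and lie one term lower.\<close>
  have second: "g = \<one>" if g: "g \<in> upper_central K 2" "\<psi> g = \<one>" for g
  proof -
    have "upper_central K 2 = {g \<in> carrier K. \<forall>h \<in> carrier K. commutator K g h \<in> upper_central K 1}"
      using upper_central_Suc_eq[of 1] by (simp only: Suc_1)
    then have "g \<in> carrier K" "h \<in> carrier K \<Longrightarrow> commutator K g h \<in> upper_central K 1" for h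
      using g(1) by blast+
    then show ?thesis using step center kernel g(2) by blast
  qed
  have "g = \<one>" if "g \<in> carrier K" "\<psi> g = \<one>" for g
    using step[OF that] second[OF commutator_in_Z2] kernel[OF that] that by blast
  then show ?thesis by (simp add: \<psi>.inj_on_one_iff)
qed

lemma finite_K: "finite (carrier K)"
  using finite_range_E by (simp only: range_E)

text \<open>The relations provide an endomorphism, which is injective because the determinant is odd, and
  hence bijective because K is finite.\<close>

theorem automorphism_exists:
  assumes "g \<in> carrier K" "h \<in> carrier K" "aut_condition (exp_a g) (exp_b g) (exp_a h) (exp_b h)"
  obtains \<psi> where "\<psi> \<in> auto K" "\<psi> a = g" "\<psi> b = h"
proof -
  obtain x y z where g: "g = E (x, y, z)" by (rule obtain_E[OF assms(1)])
  obtain x' y' z' where h: "h = E (x', y', z')" by (rule obtain_E[OF assms(2)])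
  note gh = g h
  then have c: "admissible x y x' y'" "odd (x * y' - x' * y)"
    using assms(3) by (simp_all add: aut_condition_def[symmetric]) (simp_all add: aut_condition_def)
  then have "satisfies_K_relations K m l g h" by (simp add: gh satisfies_K_relations_iff)
  then obtain \<psi> where \<psi>: "\<psi> \<in> hom K K" "\<psi> a = g" "\<psi> b = h"
    using K_presentation_hom[OF pres is_group assms(1,2)] by blast
  have inj: "inj_on \<psi> (carrier K)" using endomorphism_inj \<psi> gh c(2) by simp
  then have "bij_betw \<psi> (carrier K) (carrier K)"
    using finite_K hom_carrier[OF \<psi>(1)] by (simp add: bij_betw_def endo_inj_surj)
  then have "(\<lambda>g \<in> carrier K. \<psi> g) \<in> auto K" using autoI[OF \<psi>(1)] is_group by blast
  then show ?thesis using that \<psi>(2,3) by simp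
qed

text \<open>Writing a and b as images shows that the matrix has an inverse modulo q, hence modulo two.\<close>

theorem automorphism_condition:
  assumes "\<psi> \<in> auto K"
  shows "aut_condition (exp_a (\<psi> a)) (exp_b (\<psi> a)) (exp_a (\<psi> b)) (exp_b (\<psi> b))"
proof -
  interpret \<psi>: group_hom K K \<psi> by (rule auto_group_hom[OF assms])
  obtain x y z where ea: "\<psi> a = E (x, y, z)" by (rule obtain_E[OF \<psi>.hom_closed[OF a_closed]])
  obtain x' y' z' where eb: "\<psi> b = E (x', y', z')" by (rule obtain_E[OF \<psi>.hom_closed[OF b_closed]])
  note e = ea eb
  have "satisfies_K_relations K m l (\<psi> a) (\<psi> b)"
    using relations unfolding satisfies_K_relations_def
    by (simp flip: \<psi>.hom_commutator \<psi>.hom_conj_by \<psi>.hom_int_pow \<psi>.hom_nat_pow)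
  then have adm: "admissible x y x' y'" by (simp add: e satisfies_K_relations_iff)
  have "carrier K = \<psi> ` carrier K" using auto_bij[OF assms] by (simp add: bij_betw_def)
  then have "a \<in> \<psi> ` carrier K" "b \<in> \<psi> ` carrier K" using a_closed b_closed by auto
  then obtain g h where gh: "g \<in> carrier K" "\<psi> g = a" "h \<in> carrier K" "\<psi> h = b" by blast
  obtain i j k where g': "g = E (i, j, k)" by (rule obtain_E[OF gh(1)])
  obtain i' j' k' where h': "h = E (i', j', k')" by (rule obtain_E[OF gh(3)])
  note gh' = g' h'
  have "exp_a a = 1 mod q" "exp_b a = 0" "exp_a b = 0" "exp_b b = 1 mod q"
    using exp_E[of 1 0 0] exp_E[of 0 1 0] by (simp_all add: E_a E_b)
  then have "[1 = i * x + j * x'] (mod q)" "[0 = i * y + j * y'] (mod q)"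
    "[0 = i' * x + j' * x'] (mod q)" "[1 = i' * y + j' * y'] (mod q)"
    using exp_hom_image[OF auto_hom[OF assms] gh(1)] exp_hom_image[OF auto_hom[OF assms] gh(3)]
    unfolding gh(2,4) unfolding e gh' exp_E
    by (simp_all add: Cong.cong_def mod_linear_combination)
  note p = this[THEN cong_dvd_modulus[OF _ even_q]]
  have "[1 * 1 - 0 * 0 = (i * x + j * x') * (i' * y + j' * y') - (i * y + j * y') * (i' * x + j' * x')] (mod 2)"
    by (intro cong_diff cong_mult p)
  moreover have "(i * x + j * x') * (i' * y + j' * y') - (i * y + j * y') * (i' * x + j' * x') =
      (i * j' - i' * j) * (x * y' - x' * y)" by (simp add: algebra_simps)
  ultimately have "[1 = (i * j' - i' * j) * (x * y' - x' * y)] (mod 2)" by simp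
  then have "odd (x * y' - x' * y)" by (metis cong_dvd_iff dvd_mult odd_one)
  then show ?thesis using adm by (simp add: e) (simp add: aut_condition_def)
qed

lemma automorphism_unique:
  assumes "\<psi> \<in> auto K" "\<psi>' \<in> auto K" "\<psi> a = \<psi>' a" "\<psi> b = \<psi>' b"
  shows "\<psi> = \<psi>'"
proof (rule auto_eqI[OF assms(1,2)])
  interpret \<psi>: group_hom K K \<psi> by (rule auto_group_hom[OF assms(1)])
  interpret \<psi>': group_hom K K \<psi>' by (rule auto_group_hom[OF assms(2)])
  fix g assume "g \<in> carrier K"
  then obtain x y z where "g = E (x, y, z)" by (rule obtain_E)
  then show "\<psi> g = \<psi>' g"
    using assms(3,4)
    by (simp add: E_def \<psi>.hom_int_pow \<psi>'.hom_int_pow c_def \<psi>.hom_commutator \<psi>'.hom_commutator)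
qed

end

section \<open>Factorisation over a transversal of a kernel\<close>

text \<open>The value of h determines the representative, and the representative determines the kernel
  factor.\<close>

lemma (in group_hom) kernel_transversal:
  assumes T: "\<And>i. i \<in> I \<Longrightarrow> T i \<in> carrier G"
    and bij: "bij_betw (\<lambda>i. h (T i)) I (carrier H)" and x: "x \<in> carrier G"
  shows "\<exists>!p. fst p \<in> kernel G H h \<and> snd p \<in> I \<and> x = fst p \<otimes> T (snd p)"
proof -
  obtain i where i: "i \<in> I" "h (T i) = h x"
    using bij x by (metis bij_betw_imp_surj_on hom_closed imageE)
  show ?thesis
  proof (rule ex1I[of _ "(x \<otimes> inv T i, i)"])
    show "fst (x \<otimes> inv T i, i) \<in> kernel G H h \<and> snd (x \<otimes> inv T i, i) \<in> I \<and>
        x = fst (x \<otimes> inv T i, i) \<otimes> T (snd (x \<otimes> inv T i, i))"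
      using i x T by (simp add: kernel_def G.m_assoc)
  next
    fix p assume p: "fst p \<in> kernel G H h \<and> snd p \<in> I \<and> x = fst p \<otimes> T (snd p)"
    then have k: "fst p \<in> carrier G" "h (fst p) = \<one>\<^bsub>H\<^esub>" by (auto simp: kernel_def)
    then have "h (T (snd p)) = h (T i)" using p i T by simp
    then have "snd p = i" using bij i(1) p by (auto simp: bij_betw_def dest: inj_onD)
    moreover have "fst p = x \<otimes> inv T (snd p)" using p k(1) T by (simp add: G.m_assoc)
    ultimately show "p = (x \<otimes> inv T i, i)" by (simp add: prod_eq_iff)
  qed
qed

lemma (in group_hom) order_kernel_transversal:
  assumes T: "\<And>i. i \<in> I \<Longrightarrow> T i \<in> carrier G"
    and bij: "bij_betw (\<lambda>i. h (T i)) I (carrier H)"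
  shows "Coset.order G = card (kernel G H h) * card I"
proof -
  have "bij_betw (\<lambda>p. fst p \<otimes> T (snd p)) (kernel G H h \<times> I) (carrier G)"
    unfolding bij_betw_def
  proof
    show "inj_on (\<lambda>p. fst p \<otimes> T (snd p)) (kernel G H h \<times> I)"
    proof (rule inj_onI)
      fix p p' assume p: "p \<in> kernel G H h \<times> I" "p' \<in> kernel G H h \<times> I"
        and eq: "fst p \<otimes> T (snd p) = fst p' \<otimes> T (snd p')"
      have "fst p \<otimes> T (snd p) \<in> carrier G" using p T by (auto simp: kernel_def)
      note unique = the1_equality[OF kernel_transversal[where T = T, OF T bij this]]
      have "(THE s. fst s \<in> kernel G H h \<and> snd s \<in> I \<and> fst p \<otimes> T (snd p) = fst s \<otimes> T (snd s)) = p"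
        using p by (intro unique) auto
      moreover have "(THE s. fst s \<in> kernel G H h \<and> snd s \<in> I \<and> fst p \<otimes> T (snd p) = fst s \<otimes> T (snd s)) = p'"
        using p eq by (intro unique) auto
      ultimately show "p = p'" by simp
    qed
    show "(\<lambda>p. fst p \<otimes> T (snd p)) ` (kernel G H h \<times> I) = carrier G"
    proof
      show "(\<lambda>p. fst p \<otimes> T (snd p)) ` (kernel G H h \<times> I) \<subseteq> carrier G"
        using T by (auto simp: kernel_def)
      show "carrier G \<subseteq> (\<lambda>p. fst p \<otimes> T (snd p)) ` (kernel G H h \<times> I)"
      proof
        fix x assume "x \<in> carrier G"
        from kernel_transversal[where T = T, OF T bij this] obtain p where
          "fst p \<in> kernel G H h" "snd p \<in> I" "x = fst p \<otimes> T (snd p)" by blast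
        then show "x \<in> (\<lambda>p. fst p \<otimes> T (snd p)) ` (kernel G H h \<times> I)"
          by (intro image_eqI[of _ _ p]) (auto simp: mem_Times_iff)
      qed
    qed
  qed
  then have "card (kernel G H h \<times> I) = card (carrier G)" by (rule bij_betw_same_card)
  then show ?thesis by (simp add: Coset.order_def card_cartesian_product)
qed

lemma (in group_hom) surj_kernel_transversal:
  assumes T: "\<And>i. i \<in> I \<Longrightarrow> T i \<in> carrier G"
    and bij: "bij_betw (\<lambda>i. h (T i)) I (carrier H)"
  shows "G Mod kernel G H h \<cong> H"
proof -
  have "(\<lambda>i. h (T i)) ` I \<subseteq> h ` carrier G" using T by auto
  then have "carrier H \<subseteq> h ` carrier G" using bij by (simp add: bij_betw_def)
  then have "h ` carrier G = carrier H" by auto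
  then show ?thesis using FactGroup_iso_set is_isoI by blast
qed

section \<open>The action on the quotient by the second centre\<close>

context K_group
begin

abbreviation "A2 \<equiv> Aut_i K 2"

definition aut_matrix :: "('a \<Rightarrow> 'a) \<Rightarrow> int \<times> int \<times> int \<times> int" where
  "aut_matrix \<psi> = (exp_a (\<psi> a), exp_b (\<psi> a), exp_a (\<psi> b), exp_b (\<psi> b))"

lemma q_gt_1: "q > 1"
proof -
  have "q \<noteq> 1" using even_q by auto
  then show ?thesis using q_pos by linarith
qed

lemma exp_ab [simp]: "exp_a a = 1" "exp_b a = 0" "exp_a b = 0" "exp_b b = 1"
  using exp_E[of 1 0 0] exp_E[of 0 1 0] q_gt_1 by (simp_all add: E_a E_b)

lemma Aut_closed: "\<psi> \<in> auto K \<Longrightarrow> \<psi>' \<in> auto K \<Longrightarrow> \<psi> \<otimes>\<^bsub>Aut K\<^esub> \<psi>' \<in> auto K"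
  using monoid.m_closed[OF group.is_monoid[OF group_Aut]] by (simp add: carrier_Aut)

lemma aut_matrix_mult:
  assumes "\<psi> \<in> auto K" "\<psi>' \<in> auto K"
    and "aut_matrix \<psi> = (x, y, x', y')" "aut_matrix \<psi>' = (s, t, s', t')"
  shows "aut_matrix (\<psi> \<otimes>\<^bsub>Aut K\<^esub> \<psi>') =
    ((x * s + y * s') mod q, (x * t + y * t') mod q, (x' * s + y' * s') mod q, (x' * t + y' * t') mod q)"
  using assms exp_hom_image[OF auto_hom[OF assms(2)], of "\<psi> a"] exp_hom_image[OF auto_hom[OF assms(2)], of "\<psi> b"]
  by (simp add: aut_matrix_def Aut_apply auto_closed)

lemma A2_iff: "\<psi> \<in> A2 \<longleftrightarrow> \<psi> \<in> auto K \<and> aut_matrix \<psi> = (1, 0, 0, 1)"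
proof -
  interpret Z: characteristic_subgroup "upper_central K 2" K by (rule characteristic_upper_central)
  have "(\<forall>g \<in> carrier K. upper_central K 2 #> \<psi> g = upper_central K 2 #> g) \<longleftrightarrow> aut_matrix \<psi> = (1, 0, 0, 1)"
    if \<psi>: "\<psi> \<in> auto K"
  proof -
    have "(\<forall>g \<in> carrier K. upper_central K 2 #> \<psi> g = upper_central K 2 #> g) \<longleftrightarrow>
        (\<forall>g \<in> carrier K. exp_a (\<psi> g) = exp_a g \<and> exp_b (\<psi> g) = exp_b g)"
      by (intro ball_cong refl coset_Z2_eq_iff auto_closed[OF \<psi>])
    also have "\<dots> \<longleftrightarrow> aut_matrix \<psi> = (1, 0, 0, 1)"
    proof
      assume *: "\<forall>g \<in> carrier K. exp_a (\<psi> g) = exp_a g \<and> exp_b (\<psi> g) = exp_b g"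
      show "aut_matrix \<psi> = (1, 0, 0, 1)"
        using bspec[OF * a_closed] bspec[OF * b_closed] by (simp add: aut_matrix_def)
    next
      assume *: "aut_matrix \<psi> = (1, 0, 0, 1)"
      then have e: "exp_a (\<psi> a) = 1" "exp_b (\<psi> a) = 0" "exp_a (\<psi> b) = 0" "exp_b (\<psi> b) = 1"
        by (simp_all add: aut_matrix_def)
      show "\<forall>g \<in> carrier K. exp_a (\<psi> g) = exp_a g \<and> exp_b (\<psi> g) = exp_b g"
      proof
        fix g assume "g \<in> carrier K"
        from exp_hom_image[OF auto_hom[OF \<psi>] this, unfolded e]
        show "exp_a (\<psi> g) = exp_a g \<and> exp_b (\<psi> g) = exp_b g" using exp_range by simp
      qed
    qed
    finally show ?thesis .
  qed
  then show ?thesis by (auto simp: Aut_i_def Z.kernel_induced_aut)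
qed

lemma card_Z2: "card (upper_central K 2) = 2 ^ (3 * m - 1)"
proof -
  let ?M = "{i \<in> {0..<N}. q dvd i}"
  let ?B = "?M \<times> ?M \<times> {0..<q}"
  have "upper_central K 2 = E ` ?B"
  proof
    show "E ` ?B \<subseteq> upper_central K 2" using Z2_iff by auto
    show "upper_central K 2 \<subseteq> E ` ?B"
    proof
      fix g assume g: "g \<in> upper_central K 2"
      have "upper_central K 2 \<subseteq> carrier K"
        using normal_imp_subgroup[OF normal_upper_central] by (rule subgroup.subset)
      then have "g \<in> carrier K" using g by blast
      then obtain x y z where e: "g = E (x, y, z)" by (rule obtain_E)
      then have "q dvd x" "q dvd y" using g Z2_iff by auto
      then have "(x mod N, y mod N, z mod q) \<in> ?B" using q_dvd_N by (simp add: dvd_mod)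
      moreover have "g = E (x mod N, y mod N, z mod q)" unfolding e by (rule E_cong) simp_all
      ultimately show "g \<in> E ` ?B" by blast
    qed
  qed
  moreover have "inj_on E ?B" by (rule inj_onI) (auto simp: E_eq_iff red_def)
  ultimately have "card (upper_central K 2) = card ?M * (card ?M * nat q)"
    by (simp add: card_image card_cartesian_product)
  moreover have "card ?M = nat (2 * q)"
  proof -
    have "?M = (\<lambda>s. q * s) ` {0..<2 * q}"
    proof
      show "?M \<subseteq> (\<lambda>s. q * s) ` {0..<2 * q}"
      proof
        fix i assume "i \<in> ?M"
        then have "q dvd i" and i: "0 \<le> i" "i < N" by auto
        then obtain s where s: "i = q * s" by (meson dvdE)
        have "N = q * (2 * q)" by (simp add: N_eq)
        then have "0 \<le> s" "s < 2 * q" using i q_pos unfolding s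
          by (simp_all add: zero_le_mult_iff)
        then show "i \<in> (\<lambda>s. q * s) ` {0..<2 * q}" using s by simp
      qed
      show "(\<lambda>s. q * s) ` {0..<2 * q} \<subseteq> ?M"
      proof
        fix i assume "i \<in> (\<lambda>s. q * s) ` {0..<2 * q}"
        then obtain s where s: "i = q * s" "0 \<le> s" "s < 2 * q" by auto
        then have "0 \<le> q * s" "q * s < q * (2 * q)" using q_pos by simp_all
        moreover have "N = q * (2 * q)" by (simp add: N_eq)
        ultimately show "i \<in> ?M" using s(1) by simp
      qed
    qed
    moreover have "inj_on (\<lambda>s. q * s) {0..<2 * q}" using q_pos by (intro inj_onI) simp
    ultimately show ?thesis by (simp add: card_image)
  qed
  moreover have "int (nat (2 * q) * (nat (2 * q) * nat q)) = 2 ^ (3 * m - 1)"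
  proof -
    have "int (nat (2 * q) * (nat (2 * q) * nat q)) = 2 ^ m * (2 ^ m * 2 ^ (m - 1))"
      unfolding two_q using q_pos by (simp add: q_def)
    also have "\<dots> = 2 ^ (m + (m + (m - 1)))" by (simp only: power_add)
    also have "m + (m + (m - 1)) = 3 * m - 1" using m_gt_1 by simp
    finally show ?thesis .
  qed
  ultimately show ?thesis by (metis of_nat_eq_iff of_nat_numeral of_nat_power)
qed

text \<open>Any choice of images in the cosets of a and b gives an automorphism, because the condition
  only depends on the cosets.\<close>

lemma card_A2: "card A2 = 2 ^ (6 * m - 2)"
proof -
  interpret Z: characteristic_subgroup "upper_central K 2" K by (rule characteristic_upper_central)
  let ?C = "\<lambda>g. upper_central K 2 #> g"
  have coset: "h \<in> ?C g \<longleftrightarrow> h \<in> carrier K \<and> exp_a h = exp_a g \<and> exp_b h = exp_b g"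
    if "g \<in> carrier K" for g h
  proof -
    have "h \<in> ?C g \<longleftrightarrow> h \<in> carrier K \<and> ?C h = ?C g"
      using Z.is_subgroup Z.subset repr_independence[of h "upper_central K 2" g] r_coset_subset_G[of "upper_central K 2" g]
        rcos_self[of h "upper_central K 2"] that by blast
    then show ?thesis using that coset_Z2_eq_iff by auto
  qed
  have "bij_betw (\<lambda>\<psi>. (\<psi> a, \<psi> b)) A2 (?C a \<times> ?C b)"
    unfolding bij_betw_def
  proof
    show "inj_on (\<lambda>\<psi>. (\<psi> a, \<psi> b)) A2"
      by (rule inj_onI) (auto simp: A2_iff intro: automorphism_unique)
    show "(\<lambda>\<psi>. (\<psi> a, \<psi> b)) ` A2 = ?C a \<times> ?C b"
    proof
      show "(\<lambda>\<psi>. (\<psi> a, \<psi> b)) ` A2 \<subseteq> ?C a \<times> ?C b"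
        by (auto simp: A2_iff coset aut_matrix_def auto_closed)
      show "?C a \<times> ?C b \<subseteq> (\<lambda>\<psi>. (\<psi> a, \<psi> b)) ` A2"
      proof
        fix p assume "p \<in> ?C a \<times> ?C b"
        then obtain g h where p: "p = (g, h)" "g \<in> ?C a" "h \<in> ?C b" by auto
        then have gh: "g \<in> carrier K" "exp_a g = 1" "exp_b g = 0" "h \<in> carrier K" "exp_a h = 0" "exp_b h = 1"
          by (auto simp: coset)
        then have "aut_condition (exp_a g) (exp_b g) (exp_a h) (exp_b h)"
          by (simp add: aut_condition_def admissible_def)
        then obtain \<psi> where \<psi>: "\<psi> \<in> auto K" "\<psi> a = g" "\<psi> b = h"
          using automorphism_exists gh(1,4) by blast
        then have "\<psi> \<in> A2" using gh by (simp add: A2_iff aut_matrix_def)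
        then show "p \<in> (\<lambda>\<psi>. (\<psi> a, \<psi> b)) ` A2" using \<psi> p(1) by (intro image_eqI[of _ _ \<psi>]) auto
      qed
    qed
  qed
  then have "card A2 = card (?C a \<times> ?C b)" by (rule bij_betw_same_card)
  also have "\<dots> = card (upper_central K 2) * card (upper_central K 2)"
  proof -
    have "card (?C g) = card (upper_central K 2)" if "g \<in> carrier K" for g
      using card_cosets_equal[OF rcosetsI[OF Z.subset that] Z.subset] bij_betw_same_card by metis
    then show ?thesis by (simp add: card_cartesian_product)
  qed
  also have "\<dots> = 2 ^ (3 * m - 1 + (3 * m - 1))" by (simp only: card_Z2 power_add)
  also have "3 * m - 1 + (3 * m - 1) = 6 * m - 2" using m_gt_1 by simp
  finally show ?thesis .
qed

section \<open>The named automorphisms\<close>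

lemma aut_with_eq:
  assumes "\<psi> \<in> auto K" shows "aut_with K a b (\<psi> a) (\<psi> b) = \<psi>"
  unfolding aut_with_def using assms automorphism_unique by (intro the_equality) auto

definition r :: int where "r = 2 ^ (m - 2)"

lemma q_eq_r: "q = 2 * r"
  using m_gt_1 unfolding q_def r_def by (metis Suc_diff_Suc Suc_1 power_Suc)

lemma E_pow_ab: "a [^] (x::int) = E (x, 0, 0)" "b [^] (y::int) = E (0, y, 0)"
  by (simp_all add: E_def)

abbreviation "\<mu> \<equiv> K_mu K a b"
abbreviation "\<Phi> \<equiv> K_Phi K a b m"
abbreviation "f \<equiv> K_f K a b m"

lemma mu: "\<mu> \<in> auto K" "\<mu> a = b" "\<mu> b = a"
proof -
  have "aut_condition (exp_a b) (exp_b b) (exp_a a) (exp_b a)"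
    by (simp add: aut_condition_def admissible_def)
  then obtain \<psi> where \<psi>: "\<psi> \<in> auto K" "\<psi> a = b" "\<psi> b = a" using automorphism_exists by blast
  then have "\<mu> = \<psi>" using aut_with_eq[OF \<psi>(1)] by (simp only: K_mu_def)
  then show "\<mu> \<in> auto K" "\<mu> a = b" "\<mu> b = a" using \<psi> by simp_all
qed

lemma Phi: "\<Phi> \<in> auto K" "\<Phi> a = E (1, r, 0)" "\<Phi> b = b"
proof -
  have *: "a \<otimes> b [^] (2 ^ (m - 2) :: nat) = E (1, r, 0)"
    using int_pow_int[of K b "2 ^ (m - 2)"] by (simp add: E_def r_def)
  have "aut_condition 1 r 0 1" by (simp add: aut_condition_def admissible_def q_eq_r)
  then have "aut_condition (exp_a (E (1, r, 0))) (exp_b (E (1, r, 0))) (exp_a b) (exp_b b)"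
    using aut_condition_mod_q[of 1 r 0 1] q_gt_1 by simp
  then obtain \<psi> where \<psi>: "\<psi> \<in> auto K" "\<psi> a = E (1, r, 0)" "\<psi> b = b" using automorphism_exists by blast
  then have "\<Phi> = \<psi>" using aut_with_eq[OF \<psi>(1)] by (simp only: K_Phi_def *)
  then show "\<Phi> \<in> auto K" "\<Phi> a = E (1, r, 0)" "\<Phi> b = b" using \<psi> by simp_all
qed

text \<open>The exponent t is unique modulo N, which is the order of b, so the definite description of
  \<open>f n\<close> refers to a single automorphism.\<close>

lemma f_exists:
  assumes "odd n"
  obtains t where "[n * t = 1] (mod N)" "f n \<in> auto K" "f n a = a [^] n" "f n b = b [^] t"
proof -
  have "coprime n N" using assms by (simp add: N_def)
  then obtain t where t: "[n * t = 1] (mod N)" using cong_solve_coprime_int by blast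
  then have tq: "[n * t = 1] (mod q)" by (rule cong_N_imp_cong_q)
  have "odd (n * t)" using cong_dvd_iff[OF cong_dvd_modulus[OF tq even_q]] by simp
  then have "aut_condition n 0 0 t"
    using tq by (simp add: aut_condition_def admissible_def cong_iff_dvd_diff)
  then have "aut_condition (exp_a (a [^] n)) (exp_b (a [^] n)) (exp_a (b [^] t)) (exp_b (b [^] t))"
    using aut_condition_mod_q[of n 0 0 t] by (simp add: E_pow_ab)
  then obtain \<psi> where \<psi>: "\<psi> \<in> auto K" "\<psi> a = a [^] n" "\<psi> b = b [^] t"
    using automorphism_exists int_pow_closed a_closed b_closed by metis
  have "f n = \<psi>"
    unfolding K_f_def
  proof (rule the_equality)
    show "\<exists>t. [n * t = 1] (mod 2 ^ (2 * m - 1)) \<and> \<psi> \<in> auto K \<and> \<psi> a = a [^] n \<and> \<psi> b = b [^] t"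
      using t \<psi> unfolding N_def by blast
  next
    fix \<psi>' assume "\<exists>t. [n * t = 1] (mod 2 ^ (2 * m - 1)) \<and> \<psi>' \<in> auto K \<and> \<psi>' a = a [^] n \<and> \<psi>' b = b [^] t"
    then obtain t' where t': "[n * t' = 1] (mod N)" "\<psi>' \<in> auto K" "\<psi>' a = a [^] n" "\<psi>' b = b [^] t'"
      unfolding N_def by blast
    have "[n * t' = n * t] (mod N)" using cong_trans[OF t'(1) cong_sym[OF t]] .
    then have "[t' = t] (mod N)" using \<open>coprime n N\<close> by (simp add: cong_mult_lcancel)
    then show "\<psi>' = \<psi>" using t' \<psi> b_pow_cong by (intro automorphism_unique) auto
  qed
  then show ?thesis using that t \<psi> by blast
qed

lemma f_1: "f 1 = \<one>\<^bsub>Aut K\<^esub>"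
proof -
  obtain t where t: "[1 * t = 1] (mod N)" "f 1 \<in> auto K" "f 1 a = a [^] (1::int)" "f 1 b = b [^] t"
    by (rule f_exists[of 1]) simp_all
  have "b [^] t = b [^] (1::int)" by (rule b_pow_cong) (use t(1) in simp)
  moreover have "\<one>\<^bsub>Aut K\<^esub> \<in> auto K"
    using monoid.one_closed[OF group.is_monoid[OF group_Aut]] by (simp add: carrier_Aut)
  ultimately show ?thesis using t by (intro automorphism_unique) (auto simp: Aut_one)
qed

lemma aut_matrix_mu: "aut_matrix \<mu> = (0, 1, 1, 0)"
  by (simp add: aut_matrix_def mu)

lemma aut_matrix_Phi: "aut_matrix \<Phi> = (1, r, 0, 1)"
  using q_gt_1 q_eq_r by (simp add: aut_matrix_def Phi)

lemma aut_matrix_f: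
  assumes "odd n"
  obtains t where "[n * t = 1] (mod q)" "aut_matrix (f n) = (n mod q, 0, 0, t mod q)"
proof -
  obtain t where t: "[n * t = 1] (mod N)" "f n \<in> auto K" "f n a = a [^] n" "f n b = b [^] t"
    by (rule f_exists[OF assms])
  show ?thesis
    by (rule that[OF cong_N_imp_cong_q[OF t(1)]]) (simp add: aut_matrix_def t E_pow_ab)
qed

lemma mu_square: "\<mu> \<otimes>\<^bsub>Aut K\<^esub> \<mu> = \<one>\<^bsub>Aut K\<^esub>"
proof (rule automorphism_unique)
  show "\<one>\<^bsub>Aut K\<^esub> \<in> auto K"
    using monoid.one_closed[OF group.is_monoid[OF group_Aut]] by (simp add: carrier_Aut)
qed (simp_all add: Aut_closed mu Aut_apply Aut_one)

end

section \<open>The quotient for m greater than two\<close>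

text \<open>A structure that is not yet known to be a group inherits the group axioms as a homomorphic
  image.\<close>

lemma group_of_surj_hom:
  fixes H :: "'b monoid"
  assumes "group G" "h \<in> hom G H" "h ` carrier G = carrier H" "h \<one>\<^bsub>G\<^esub> = \<one>\<^bsub>H\<^esub>"
  shows "group_hom G H h"
proof -
  have "group (H \<lparr> carrier := h ` carrier G, one := h \<one>\<^bsub>G\<^esub> \<rparr>)"
    by (rule group.hom_imp_img_group[OF assms(1,2)])
  then have "group H" by (simp add: assms(3,4))
  then show ?thesis using assms(1,2) by (simp add: group_hom_def group_hom_axioms_def)
qed

locale K_group_large = K_group +
  assumes m_gt_2: "m > 2"
begin

lemma even_r: "even r" and r_pos: "r > 0"
  using m_gt_2 by (simp_all add: r_def)

lemma q_dvd_r_mult_iff: "q dvd r * s \<longleftrightarrow> even s"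
  using r_pos by (simp add: q_eq_r mult.commute[of 2])

lemma q_dvd_r_r: "q dvd r * (r * s)"
  using even_r by (simp add: q_dvd_r_mult_iff)

text \<open>The matrices modulo q that occur for m greater than two: up to a swap of the columns the
  diagonal is \<open>(n, n\<^sup>-\<^sup>1)\<close> and the other entries are multiples of \<open>q/2\<close>.\<close>

definition shape :: "int \<times> int \<times> int \<times> int \<Rightarrow> int \<Rightarrow> int \<Rightarrow> int \<Rightarrow> int \<Rightarrow> bool" where
  "shape M n i j k \<longleftrightarrow> (\<exists>n'. [n * n' = 1] (mod q) \<and> (case M of (x, y, x', y') \<Rightarrow>
     if k = 0 then [x = n] (mod q) \<and> [y = r * i] (mod q) \<and> [x' = r * j] (mod q) \<and> [y' = n'] (mod q)
     else [x = r * i] (mod q) \<and> [y = n] (mod q) \<and> [x' = n'] (mod q) \<and> [y' = r * j] (mod q)))"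

lemma odd_of_inverse:
  assumes "[n * n' = 1] (mod q)" shows "odd n" "odd n'"
  using cong_dvd_iff[OF cong_dvd_modulus[OF assms even_q]] by simp_all

text \<open>In the condition q | s t with \<open>t \<equiv> 2\<close> or \<open>t \<equiv> - 2\<close> the second factor only accounts for one
  factor two, so s is a multiple of \<open>r = q / 2\<close>.\<close>

lemma admissible_halves:
  assumes "q dvd s * t" "q dvd t - w" "w = 2 \<or> w = - 2"
  obtains i where "i \<in> {0, 1}" "[s = r * i] (mod q)"
proof -
  have "q dvd s * t - s * (t - w)" using assms(1,2) by (intro dvd_diff) auto
  then have "2 * r dvd 2 * s" using assms(3) by (auto simp: q_eq_r algebra_simps)
  then have "r dvd s" by simp
  then obtain v where v: "s = r * v" by (meson dvdE)
  have "even (v - v mod 2)" by simp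
  then have "[s = r * (v mod 2)] (mod q)"
    unfolding cong_iff_dvd_diff v right_diff_distrib[symmetric] q_dvd_r_mult_iff .
  then show ?thesis by (intro that[of "v mod 2"]) auto
qed

lemma q_dvd_mult_halves:
  assumes "[s = r * i] (mod q)" "[t = r * j] (mod q)"
  shows "q dvd s * t"
proof -
  have "[s * t = r * i * (r * j)] (mod q)" by (intro cong_mult assms)
  then show ?thesis using q_dvd_r_r[of "i * j"] by (simp add: cong_dvd_iff mult_ac)
qed

text \<open>If the first entry of the top row is odd then \<open>d \<equiv> 1\<close>, and then the conditions involving
  \<open>d + 1 \<equiv> 2\<close> leave the two off-diagonal entries with values 0 and r. If it is even the other
  entry is odd, \<open>d \<equiv> - 1\<close>, and the roles of the diagonals are interchanged. In both cases the
  product of the two entries divisible by r vanishes modulo q.\<close>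

lemma shape_exists:
  assumes "aut_condition x y x' y'"
  obtains n i j k where "i \<in> {0, 1}" "j \<in> {0, 1}" "k \<in> {0, 1}" "shape (x, y, x', y') n i j k"
proof -
  let ?d = "x * y' - x' * y"
  have odd: "odd ?d" and adm: "q dvd x * (?d - 1)" "q dvd y * (?d + 1)" "q dvd x' * (?d + 1)" "q dvd y' * (?d - 1)"
    using assms by (simp_all add: aut_condition_def admissible_def Let_def)
  show ?thesis
  proof (cases "even x")
    case False
    then have "coprime q x" by (simp add: q_def)
    then have d: "q dvd ?d - 1" using adm(1) by (simp add: coprime_dvd_mult_right_iff)
    then have d2: "q dvd (?d + 1) - 2" by (simp add: algebra_simps)
    obtain i where i: "i \<in> {0, 1}" "[y = r * i] (mod q)" using admissible_halves[OF adm(2) d2] by auto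
    obtain j where j: "j \<in> {0, 1}" "[x' = r * j] (mod q)" using admissible_halves[OF adm(3) d2] by auto
    have "q dvd (?d - 1) + x' * y" using d q_dvd_mult_halves[OF j(2) i(2)] by (rule dvd_add)
    then have "[x * y' = 1] (mod q)" by (simp add: cong_iff_dvd_diff algebra_simps)
    then have "shape (x, y, x', y') x i j 0" using i j by (auto simp: shape_def)
    then show ?thesis using i j by (intro that[of i j 0 x]) auto
  next
    case True
    then have "odd y" using odd by auto
    then have "coprime q y" by (simp add: q_def)
    then have d: "q dvd ?d + 1" using adm(2) by (simp add: coprime_dvd_mult_right_iff)
    then have d2: "q dvd (?d - 1) - (- 2)" by (simp add: algebra_simps)
    obtain i where i: "i \<in> {0, 1}" "[x = r * i] (mod q)" using admissible_halves[OF adm(1) d2] by auto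
    obtain j where j: "j \<in> {0, 1}" "[y' = r * j] (mod q)" using admissible_halves[OF adm(4) d2] by auto
    have "q dvd x * y' - (?d + 1)" using q_dvd_mult_halves[OF i(2) j(2)] d by (rule dvd_diff)
    then have "[y * x' = 1] (mod q)" by (simp add: cong_iff_dvd_diff algebra_simps)
    then have "shape (x, y, x', y') y i j 1" using i j by (auto simp: shape_def)
    then show ?thesis using i j by (intro that[of i j 1 y]) auto
  qed
qed

lemma shape_unique:
  assumes "shape M n i j k" "shape M n2 i2 j2 k2" "k \<in> {0, 1}" "k2 \<in> {0, 1}"
  shows "[n = n2] (mod q)" "[i = i2] (mod 2)" "[j = j2] (mod 2)" "k = k2"
proof -
  obtain x y x' y' where M: "M = (x, y, x', y')" by (metis prod_cases4)
  have par: "odd x" if sh: "shape M n i j 0" for n i j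
  proof -
    obtain n' where "[n * n' = 1] (mod q)" and x: "[x = n] (mod q)" using sh by (auto simp: shape_def M)
    then show ?thesis using odd_of_inverse(1) cong_dvd_iff[OF cong_dvd_modulus[OF x even_q]] by simp
  qed
  have par': "even x" if "shape M n i j 1" for n i j
  proof -
    have "[x = r * i] (mod 2)" using that cong_dvd_modulus[OF _ even_q] by (auto simp: shape_def M)
    then show ?thesis using even_r by (simp add: cong_dvd_iff)
  qed
  show k: "k = k2" using par par' assms by fastforce
  have halves: "[s = t] (mod 2)" if "[w = r * s] (mod q)" "[w = r * t] (mod q)" for w s t
  proof -
    have "q dvd r * (s - t)"
      using cong_trans[OF cong_sym[OF that(1)] that(2)] by (simp add: cong_iff_dvd_diff right_diff_distrib)
    then show ?thesis by (simp add: q_dvd_r_mult_iff cong_iff_dvd_diff)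
  qed
  have same: "[s = t] (mod q)" if "[w = s] (mod q)" "[w = t] (mod q)" for w s t
    using cong_trans[OF cong_sym[OF that(1)] that(2)] .
  have "[n = n2] (mod q) \<and> [i = i2] (mod 2) \<and> [j = j2] (mod 2)"
  proof (cases "k = 0")
    case True
    have 1: "[x = n] (mod q)" "[y = r * i] (mod q)" "[x' = r * j] (mod q)"
      using assms(1) True by (auto simp: shape_def M)
    have 2: "[x = n2] (mod q)" "[y = r * i2] (mod q)" "[x' = r * j2] (mod q)"
      using assms(2) True k by (auto simp: shape_def M)
    show ?thesis by (intro conjI same[OF 1(1) 2(1)] halves[OF 1(2) 2(2)] halves[OF 1(3) 2(3)])
  next
    case False
    have 1: "[y = n] (mod q)" "[x = r * i] (mod q)" "[y' = r * j] (mod q)"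
      using assms(1) False by (auto simp: shape_def M)
    have 2: "[y = n2] (mod q)" "[x = r * i2] (mod q)" "[y' = r * j2] (mod q)"
      using assms(2) False k by (auto simp: shape_def M)
    show ?thesis by (intro conjI same[OF 1(1) 2(1)] halves[OF 1(2) 2(2)] halves[OF 1(3) 2(3)])
  qed
  then show "[n = n2] (mod q)" "[i = i2] (mod 2)" "[j = j2] (mod 2)" by blast+
qed

lemma r_mult_odd: "odd n \<Longrightarrow> [r * s * n = r * s] (mod q)"
proof -
  assume "odd n"
  then have "q dvd r * (s * (n - 1))" by (simp add: q_dvd_r_mult_iff)
  then show ?thesis by (simp add: cong_iff_dvd_diff algebra_simps)
qed

text \<open>Multiplying the entry r by an odd number does not change it modulo q, and the product of two
  multiples of r vanishes. So the parameters i and j add up, n is multiplicative, and a preceding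
  swap inverts the n of the second factor and exchanges its i and j.\<close>

lemma shape_mult:
  assumes "shape (x, y, x', y') n i j k" "shape (s, t, s', t') n2 i2 j2 k2" "[n2 * w = 1] (mod q)"
    and "k \<in> {0, 1}" "k2 \<in> {0, 1}"
  shows "shape ((x * s + y * s') mod q, (x * t + y * t') mod q, (x' * s + y' * s') mod q, (x' * t + y' * t') mod q)
    (if k = 0 then n * n2 else n * w) (if k = 0 then i + i2 else i + j2) (if k = 0 then j + j2 else j + i2)
    (if k = k2 then 0 else 1)"
proof -
  obtain n' where n': "[n * n' = 1] (mod q)" and A: "if k = 0 then [x = n] (mod q) \<and> [y = r * i] (mod q) \<and> [x' = r * j] (mod q) \<and> [y' = n'] (mod q)
     else [x = r * i] (mod q) \<and> [y = n] (mod q) \<and> [x' = n'] (mod q) \<and> [y' = r * j] (mod q)"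
    using assms(1) by (auto simp: shape_def)
  obtain w' where w': "[n2 * w' = 1] (mod q)" and B: "if k2 = 0 then [s = n2] (mod q) \<and> [t = r * i2] (mod q) \<and> [s' = r * j2] (mod q) \<and> [t' = w'] (mod q)
     else [s = r * i2] (mod q) \<and> [t = n2] (mod q) \<and> [s' = w'] (mod q) \<and> [t' = r * j2] (mod q)"
    using assms(2) by (auto simp: shape_def)
  have "[n2 * w' = n2 * w] (mod q)" using cong_trans[OF w' cong_sym[OF assms(3)]] .
  moreover have "coprime n2 q" using odd_of_inverse(1)[OF w'] by (simp add: q_def)
  ultimately have ww: "[w' = w] (mod q)" by (simp add: cong_mult_lcancel)
  note odds = odd_of_inverse[OF n'] odd_of_inverse[OF w']
  have rr: "[r * e * (r * e') = 0] (mod q)" for e e'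
    using q_dvd_r_r[of "e * e'"] by (simp add: cong_0_iff mult_ac)
  have ro: "[r * e * z = r * e] (mod q)" "[z * (r * e) = r * e] (mod q)" if "odd z" for e z
    using r_mult_odd[OF that, of e] by (simp_all add: mult_ac)
  have inv1: "[n * n2 * (n' * w') = 1] (mod q)"
    using cong_mult[OF n' w'] by (simp add: mult_ac)
  have inv2: "[n * w' * (n' * n2) = 1] (mod q)"
    using cong_mult[OF n' w'] by (simp add: mult_ac)
  have inv2': "[n * w * (n' * n2) = 1] (mod q)"
    using cong_trans[OF cong_mult[OF cong_mult[OF cong_refl[of n] cong_sym[OF ww]] cong_refl[of "n' * n2"]] inv2] .
  have M: "[(g * h + g' * h') mod q = e + e'] (mod q)"
    if "[g * h = e] (mod q)" "[g' * h' = e'] (mod q)" for g h g' h' e e' :: int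
    using cong_add[OF that] by simp
  have P: "[g * h = e] (mod q)" if "[g = g'] (mod q)" "[h = h'] (mod q)" "[g' * h' = e] (mod q)" for g h g' h' e :: int
    using cong_trans[OF cong_mult[OF that(1,2)] that(3)] .
  have M0: "[(g * h + g' * h') mod q = e] (mod q)"
    if "[g * h = e] (mod q)" "[g' * h' = 0] (mod q)" for g h g' h' e :: int
    using M[OF that] by simp
  have M1: "[(g * h + g' * h') mod q = e] (mod q)"
    if "[g * h = 0] (mod q)" "[g' * h' = e] (mod q)" for g h g' h' e :: int
    using M[OF that] by simp
  show ?thesis
  proof (cases "k = 0")
    case True
    note A = A[unfolded if_P[OF True]]
    show ?thesis
    proof (cases "k2 = 0")
      case k2: True
      note B = B[unfolded if_P[OF k2]]
      have "[(x * s + y * s') mod q = n * n2] (mod q)"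
        by (rule M0; rule P) (use A B rr in auto)
      moreover have "[(x * t + y * t') mod q = r * i2 + r * i] (mod q)"
        by (rule M; rule P) (use A B ro odds in auto)
      moreover have "[(x' * s + y' * s') mod q = r * j + r * j2] (mod q)"
        by (rule M; rule P) (use A B ro odds in auto)
      moreover have "[(x' * t + y' * t') mod q = n' * w'] (mod q)"
        by (rule M1; rule P) (use A B rr in auto)
      ultimately show ?thesis using True k2 inv1
        unfolding shape_def by (intro exI[of _ "n' * w'"]) (simp add: algebra_simps)
    next
      case k2: False
      note B = B[unfolded if_not_P[OF k2]]
      have "[(x * s + y * s') mod q = r * i2 + r * i] (mod q)"
        by (rule M; rule P) (use A B ro odds in auto)
      moreover have "[(x * t + y * t') mod q = n * n2] (mod q)"
        by (rule M0; rule P) (use A B rr in auto)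
      moreover have "[(x' * s + y' * s') mod q = n' * w'] (mod q)"
        by (rule M1; rule P) (use A B rr in auto)
      moreover have "[(x' * t + y' * t') mod q = r * j + r * j2] (mod q)"
        by (rule M; rule P) (use A B ro odds in auto)
      ultimately show ?thesis using True k2 inv1
        unfolding shape_def by (intro exI[of _ "n' * w'"]) (simp add: algebra_simps)
    qed
  next
    case False
    note A = A[unfolded if_not_P[OF False]]
    show ?thesis
    proof (cases "k2 = 0")
      case k2: True
      note B = B[unfolded if_P[OF k2]]
      have "[(x * s + y * s') mod q = r * i + r * j2] (mod q)"
        by (rule M; rule P) (use A B ro odds in auto)
      moreover have "[(x * t + y * t') mod q = n * w'] (mod q)"
        by (rule M1; rule P) (use A B rr in auto)
      moreover have "[(x' * s + y' * s') mod q = n' * n2] (mod q)"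
        by (rule M0; rule P) (use A B rr in auto)
      moreover have "[(x' * t + y' * t') mod q = r * i2 + r * j] (mod q)"
        by (rule M; rule P) (use A B ro odds in auto)
      moreover have "[n * w' = n * w] (mod q)" by (intro cong_mult ww cong_refl)
      ultimately show ?thesis using False k2 inv2'
        unfolding shape_def by (intro exI[of _ "n' * n2"]) (auto simp: algebra_simps intro: cong_trans)
    next
      case k2: False
      note B = B[unfolded if_not_P[OF k2]]
      have kk: "k = k2" using False k2 assms(4,5) by auto
      have "[(x * s + y * s') mod q = n * w'] (mod q)"
        by (rule M1; rule P) (use A B rr in auto)
      moreover have "[(x * t + y * t') mod q = r * i + r * j2] (mod q)"
        by (rule M; rule P) (use A B ro odds in auto)
      moreover have "[(x' * s + y' * s') mod q = r * i2 + r * j] (mod q)"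
        by (rule M; rule P) (use A B ro odds in auto)
      moreover have "[(x' * t + y' * t') mod q = n' * n2] (mod q)"
        by (rule M0; rule P) (use A B rr in auto)
      moreover have "[n * w' = n * w] (mod q)" by (intro cong_mult ww cong_refl)
      ultimately show ?thesis using False kk inv2'
        unfolding shape_def by (intro exI[of _ "n' * n2"]) (auto simp: algebra_simps intro: cong_trans)
    qed
  qed
qed

abbreviation "H \<equiv> units_semidirect q"

lemma residues_q: "residues q"
  by (simp add: residues_def q_gt_1)

lemma units_residue_iff: "n \<in> carrier (units_of (residue_ring q)) \<longleftrightarrow> 0 \<le> n \<and> n < q \<and> odd n"
proof -
  have c: "coprime n q \<longleftrightarrow> odd n" using m_gt_1 by (simp add: q_def)
  show ?thesis
    unfolding units_of_carrier residues.res_units_eq[OF residues_q] mem_Collect_eq c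
    by (cases "n = 0") auto
qed

lemma carrier_H:
  "((n, i, j), k) \<in> carrier H \<longleftrightarrow>
    0 \<le> n \<and> n < q \<and> odd n \<and> i \<in> {0, 1} \<and> j \<in> {0, 1} \<and> k \<in> {0, 1}"
proof -
  have "i \<in> carrier (integer_mod_group 2) \<longleftrightarrow> i \<in> {0, 1}" for i :: int
    by (simp add: carrier_integer_mod_group) presburger
  then show ?thesis
    by (simp add: units_semidirect_def Let_def semidirect_product_def units_residue_iff conj_assoc del: insert_iff)
qed

lemma mult_H:
  assumes "0 \<le> n2" "n2 < q" "0 \<le> w" "w < q" "[n2 * w = 1] (mod q)" "k \<in> {0, 1}" "k2 \<in> {0, 1}"
  shows "((n, i, j), k) \<otimes>\<^bsub>H\<^esub> ((n2, i2, j2), k2) =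
    (((if k = 0 then n * n2 else n * w) mod q, (if k = 0 then i + i2 else i + j2) mod 2,
      (if k = 0 then j + j2 else j + i2) mod 2), if k = k2 then 0 else 1)"
proof -
  let ?U = "units_of (residue_ring q)"
  interpret R: residues q "residue_ring q" by (rule residues_q) simp
  interpret U: group ?U by (rule R.units_group)
  have "inv\<^bsub>?U\<^esub> n2 = w"
    using assms odd_of_inverse[OF assms(5)] q_gt_1
    by (intro U.inv_equality) (simp_all add: units_residue_iff units_of_mult units_of_one R.res_mult_eq
        R.res_one_eq Cong.cong_def mult.commute)
  then show ?thesis
    using assms by (auto simp: units_semidirect_def Let_def semidirect_product_def units_of_mult
        R.res_mult_eq)
qed

lemma one_H: "\<one>\<^bsub>H\<^esub> = ((1, 0, 0), 0)"
  using residues.res_one_eq[OF residues_q]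
  by (simp add: units_semidirect_def Let_def semidirect_product_def units_of_one)

text \<open>The parameters of the shape of the matrix, which are unique once they are reduced.\<close>

definition coords :: "('a \<Rightarrow> 'a) \<Rightarrow> (int \<times> int \<times> int) \<times> int" where
  "coords \<psi> = (THE t. t \<in> carrier H \<and> (case t of ((n, i, j), k) \<Rightarrow> shape (aut_matrix \<psi>) n i j k))"

lemma shape_cong:
  assumes "shape M n i j k" "[n = n2] (mod q)" "[i = i2] (mod 2)" "[j = j2] (mod 2)"
  shows "shape M n2 i2 j2 k"
proof -
  have h: "[r * s = r * t] (mod q)" if "[s = t] (mod 2)" for s t
    using that by (simp add: cong_iff_dvd_diff q_dvd_r_mult_iff flip: right_diff_distrib)
  obtain n' where n': "[n * n' = 1] (mod q)" "case M of (x, y, x', y') \<Rightarrow>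
     if k = 0 then [x = n] (mod q) \<and> [y = r * i] (mod q) \<and> [x' = r * j] (mod q) \<and> [y' = n'] (mod q)
     else [x = r * i] (mod q) \<and> [y = n] (mod q) \<and> [x' = n'] (mod q) \<and> [y' = r * j] (mod q)"
    using assms(1) by (auto simp: shape_def)
  have "[n2 * n' = 1] (mod q)"
    using cong_trans[OF cong_mult[OF cong_sym[OF assms(2)] cong_refl] n'(1)] .
  then show ?thesis
    unfolding shape_def using n'(2) assms(2) h[OF assms(3)] h[OF assms(4)]
    by (intro exI[of _ n']) (auto split: prod.splits if_splits intro: cong_trans)
qed

lemma coords_eqI:
  assumes "shape (aut_matrix \<psi>) n i j k" "k \<in> {0, 1}"
  shows "coords \<psi> = ((n mod q, i mod 2, j mod 2), k)"
proof -
  have s: "shape (aut_matrix \<psi>) (n mod q) (i mod 2) (j mod 2) k"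
    by (rule shape_cong[OF assms(1)]) simp_all
  have "odd n" using assms(1) odd_of_inverse by (auto simp: shape_def)
  then have "odd (n mod q)" using even_q by (simp add: dvd_mod_iff)
  then have c: "((n mod q, i mod 2, j mod 2), k) \<in> carrier H"
    using assms(2) q_pos by (auto simp: carrier_H)
  show ?thesis
    unfolding coords_def
  proof (rule the_equality)
    fix t assume t: "t \<in> carrier H \<and> (case t of ((n, i, j), k) \<Rightarrow> shape (aut_matrix \<psi>) n i j k)"
    obtain n2 i2 j2 k2 where e: "t = ((n2, i2, j2), k2)" by (metis prod.exhaust)
    have b: "0 \<le> n2" "n2 < q" "i2 \<in> {0, 1}" "j2 \<in> {0, 1}" "k2 \<in> {0, 1}" using t by (auto simp: e carrier_H)
    have s2: "shape (aut_matrix \<psi>) n2 i2 j2 k2" using t by (simp add: e)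
    note u = shape_unique[OF assms(1) s2 assms(2) b(5)]
    have "n2 = n mod q" "i2 = i mod 2" "j2 = j mod 2"
      using u(1,2,3) b(1-4) by (auto simp: Cong.cong_def)
    then show "t = ((n mod q, i mod 2, j mod 2), k)" using u(4) e by simp
  qed (use s c in simp)
qed

lemma shape_aut:
  assumes "\<psi> \<in> auto K"
  obtains n i j k where "i \<in> {0, 1}" "j \<in> {0, 1}" "k \<in> {0, 1}" "shape (aut_matrix \<psi>) n i j k"
  by (rule shape_exists[OF automorphism_condition[OF assms]]) (rule that, simp_all add: aut_matrix_def)

lemma shape_inverse:
  assumes "shape M n i j k"
  obtains w where "0 \<le> w" "w < q" "[n mod q * w = 1] (mod q)" "[n * w = 1] (mod q)"
proof -
  obtain n' where "[n * n' = 1] (mod q)" using assms by (auto simp: shape_def)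
  then have "[n * (n' mod q) = 1] (mod q)" "[n mod q * (n' mod q) = 1] (mod q)"
    by (simp_all add: Cong.cong_def mod_simps)
  then show ?thesis using that[of "n' mod q"] q_pos by simp
qed

lemma shape_Aut_mult:
  assumes "\<psi> \<in> auto K" "\<psi>' \<in> auto K" "shape (aut_matrix \<psi>) n i j k" "shape (aut_matrix \<psi>') n2 i2 j2 k2"
    and "[n2 * w = 1] (mod q)" "k \<in> {0, 1}" "k2 \<in> {0, 1}"
  shows "shape (aut_matrix (\<psi> \<otimes>\<^bsub>Aut K\<^esub> \<psi>')) (if k = 0 then n * n2 else n * w)
    (if k = 0 then i + i2 else i + j2) (if k = 0 then j + j2 else j + i2) (if k = k2 then 0 else 1)"
proof -
  obtain x y x' y' where M: "aut_matrix \<psi> = (x, y, x', y')" by (metis prod_cases4)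
  obtain s t s' t' where M': "aut_matrix \<psi>' = (s, t, s', t')" by (metis prod_cases4)
  show ?thesis
    unfolding aut_matrix_mult[OF assms(1,2) M M']
    using shape_mult[OF assms(3)[unfolded M] assms(4)[unfolded M'] assms(5,6,7)] .
qed

lemma coords_mult:
  assumes "\<psi> \<in> auto K" "\<psi>' \<in> auto K"
  shows "coords (\<psi> \<otimes>\<^bsub>Aut K\<^esub> \<psi>') = coords \<psi> \<otimes>\<^bsub>H\<^esub> coords \<psi>'"
proof -
  obtain n i j k where 1: "k \<in> {0, 1}" "shape (aut_matrix \<psi>) n i j k"
    by (rule shape_aut[OF assms(1)])
  obtain n2 i2 j2 k2 where 2: "k2 \<in> {0, 1}" "shape (aut_matrix \<psi>') n2 i2 j2 k2"
    by (rule shape_aut[OF assms(2)])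
  obtain w where w: "0 \<le> w" "w < q" "[n2 mod q * w = 1] (mod q)" "[n2 * w = 1] (mod q)"
    by (rule shape_inverse[OF 2(2)])
  have "coords (\<psi> \<otimes>\<^bsub>Aut K\<^esub> \<psi>') =
      (((if k = 0 then n * n2 else n * w) mod q, (if k = 0 then i + i2 else i + j2) mod 2,
        (if k = 0 then j + j2 else j + i2) mod 2), if k = k2 then 0 else 1)"
    by (rule coords_eqI[OF shape_Aut_mult[OF assms 1(2) 2(2) w(4) 1(1) 2(1)]]) simp
  also have "\<dots> = ((n mod q, i mod 2, j mod 2), k) \<otimes>\<^bsub>H\<^esub> ((n2 mod q, i2 mod 2, j2 mod 2), k2)"
    using mult_H[OF _ _ w(1,2,3) 1(1) 2(1), of "n mod q" "i mod 2" "j mod 2" "i2 mod 2" "j2 mod 2"] q_pos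
    by (simp add: mod_simps)
  finally show ?thesis using coords_eqI 1 2 by simp
qed

lemma coords_closed: "\<psi> \<in> auto K \<Longrightarrow> coords \<psi> \<in> carrier H"
proof -
  assume "\<psi> \<in> auto K"
  then obtain n i j k where 1: "k \<in> {0, 1}" "shape (aut_matrix \<psi>) n i j k" by (rule shape_aut)
  then have "odd n" using odd_of_inverse by (auto simp: shape_def)
  then have "odd (n mod q)" using even_q by (simp add: dvd_mod_iff)
  then show "coords \<psi> \<in> carrier H" using 1 q_pos by (auto simp: coords_eqI[OF 1(2,1)] carrier_H)
qed

text \<open>The first three factors realise the normal part of the semidirect product, the last one the
  complement.\<close>

definition rep :: "int \<times> nat \<times> nat \<times> nat \<Rightarrow> ('a \<Rightarrow> 'a)" where
  "rep = (\<lambda>(n, i, j, k). f n \<otimes>\<^bsub>Aut K\<^esub> \<Phi> [^]\<^bsub>Aut K\<^esub> i \<otimes>\<^bsub>Aut K\<^esub> conj_by (Aut K) \<Phi> \<mu> [^]\<^bsub>Aut K\<^esub> j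
     \<otimes>\<^bsub>Aut K\<^esub> \<mu> [^]\<^bsub>Aut K\<^esub> k)"

definition reps :: "(int \<times> nat \<times> nat \<times> nat) set" where
  "reps = {(n, i, j, k). 1 \<le> n \<and> n < q \<and> odd n \<and> i \<le> 1 \<and> j \<le> 1 \<and> k \<le> 1}"

lemma conj_Phi: "conj_by (Aut K) \<Phi> \<mu> \<in> auto K" "aut_matrix (conj_by (Aut K) \<Phi> \<mu>) = (1, 0, r, 1)"
proof -
  interpret A: group "Aut K" by (rule group_Aut)
  have \<mu>: "\<mu> \<in> carrier (Aut K)" using mu by (simp add: carrier_Aut)
  then have "inv\<^bsub>Aut K\<^esub> \<mu> = \<mu>" using mu_square by (intro A.inv_equality)
  then have e: "conj_by (Aut K) \<Phi> \<mu> = \<mu> \<otimes>\<^bsub>Aut K\<^esub> \<Phi> \<otimes>\<^bsub>Aut K\<^esub> \<mu>" by (simp add: conj_by_def)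
  show "conj_by (Aut K) \<Phi> \<mu> \<in> auto K" using mu Phi by (simp add: e Aut_closed)
  have rq: "r mod q = r" using q_eq_r r_pos by simp
  have "aut_matrix (\<mu> \<otimes>\<^bsub>Aut K\<^esub> \<Phi>) = (0, 1, 1, r)"
    using aut_matrix_mult[OF mu(1) Phi(1) aut_matrix_mu aut_matrix_Phi] q_gt_1 rq by simp
  from aut_matrix_mult[OF Aut_closed[OF mu(1) Phi(1)] mu(1) this aut_matrix_mu]
  show "aut_matrix (conj_by (Aut K) \<Phi> \<mu>) = (1, 0, r, 1)" using q_gt_1 rq by (simp add: e)
qed

lemma le_1_cases: "(i::nat) \<le> 1 \<Longrightarrow> i = 0 \<or> i = 1"
  by auto

lemma aut_matrix_one: "aut_matrix \<one>\<^bsub>Aut K\<^esub> = (1, 0, 0, 1)"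
  by (simp add: aut_matrix_def Aut_one)

lemma coords_rep:
  assumes "(n, i, j, k) \<in> reps"
  shows "rep (n, i, j, k) \<in> auto K" "coords (rep (n, i, j, k)) = ((n, int i, int j), int k)"
proof -
  interpret A: group "Aut K" by (rule group_Aut)
  have b: "1 \<le> n" "n < q" "odd n" "i \<le> 1" "j \<le> 1" "k \<le> 1" using assms by (auto simp: reps_def)
  obtain t where t: "[n * t = 1] (mod q)" "aut_matrix (f n) = (n mod q, 0, 0, t mod q)"
    by (rule aut_matrix_f[OF b(3)])
  have f: "f n \<in> auto K" using f_exists[OF b(3)] by blast
  have fs: "shape (aut_matrix (f n)) n 0 0 0"
    unfolding shape_def t(2) using t(1) by (intro exI[of _ t]) simp
  have one: "shape (1, 0, 0, 1) 1 0 0 0" unfolding shape_def by (intro exI[of _ 1]) simp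
  have P: "\<Phi> [^]\<^bsub>Aut K\<^esub> i \<in> auto K" "shape (aut_matrix (\<Phi> [^]\<^bsub>Aut K\<^esub> i)) 1 (int i) 0 0"
  proof -
    show "\<Phi> [^]\<^bsub>Aut K\<^esub> i \<in> auto K" using A.nat_pow_closed[of \<Phi> i] Phi by (simp add: carrier_Aut)
    have "shape (1, r, 0, 1) 1 1 0 0" unfolding shape_def by (intro exI[of _ 1]) simp
    then show "shape (aut_matrix (\<Phi> [^]\<^bsub>Aut K\<^esub> i)) 1 (int i) 0 0"
      using le_1_cases[OF b(4)] one Phi A.nat_pow_eone[of \<Phi>]
      by (auto simp: aut_matrix_one aut_matrix_Phi carrier_Aut)
  qed
  have Q: "conj_by (Aut K) \<Phi> \<mu> [^]\<^bsub>Aut K\<^esub> j \<in> auto K"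
    "shape (aut_matrix (conj_by (Aut K) \<Phi> \<mu> [^]\<^bsub>Aut K\<^esub> j)) 1 0 (int j) 0"
  proof -
    show "conj_by (Aut K) \<Phi> \<mu> [^]\<^bsub>Aut K\<^esub> j \<in> auto K"
      using A.nat_pow_closed[of "conj_by (Aut K) \<Phi> \<mu>" j] conj_Phi by (simp add: carrier_Aut)
    have "shape (1, 0, r, 1) 1 0 1 0" unfolding shape_def by (intro exI[of _ 1]) simp
    then show "shape (aut_matrix (conj_by (Aut K) \<Phi> \<mu> [^]\<^bsub>Aut K\<^esub> j)) 1 0 (int j) 0"
      using le_1_cases[OF b(5)] one conj_Phi A.nat_pow_eone[of "conj_by (Aut K) \<Phi> \<mu>"]
      by (auto simp: aut_matrix_one carrier_Aut)
  qed
  have R: "\<mu> [^]\<^bsub>Aut K\<^esub> k \<in> auto K" "shape (aut_matrix (\<mu> [^]\<^bsub>Aut K\<^esub> k)) 1 0 0 (int k)"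
  proof -
    show "\<mu> [^]\<^bsub>Aut K\<^esub> k \<in> auto K" using A.nat_pow_closed[of \<mu> k] mu by (simp add: carrier_Aut)
    have "shape (0, 1, 1, 0) 1 0 0 1" unfolding shape_def by (intro exI[of _ 1]) simp
    then show "shape (aut_matrix (\<mu> [^]\<^bsub>Aut K\<^esub> k)) 1 0 0 (int k)"
      using le_1_cases[OF b(6)] one mu A.nat_pow_eone[of \<mu>]
      by (auto simp: aut_matrix_one aut_matrix_mu carrier_Aut)
  qed
  have w: "[1 * 1 = 1] (mod q)" by simp
  note s1 = shape_Aut_mult[OF f P(1) fs P(2) w]
  have s1: "shape (aut_matrix (f n \<otimes>\<^bsub>Aut K\<^esub> \<Phi> [^]\<^bsub>Aut K\<^esub> i)) n (int i) 0 0" using s1 by simp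
  note c1 = Aut_closed[OF f P(1)]
  have s2: "shape (aut_matrix (f n \<otimes>\<^bsub>Aut K\<^esub> \<Phi> [^]\<^bsub>Aut K\<^esub> i \<otimes>\<^bsub>Aut K\<^esub> conj_by (Aut K) \<Phi> \<mu> [^]\<^bsub>Aut K\<^esub> j)) n (int i) (int j) 0"
    using shape_Aut_mult[OF c1 Q(1) s1 Q(2) w] by simp
  note c2 = Aut_closed[OF c1 Q(1)]
  show "rep (n, i, j, k) \<in> auto K" using Aut_closed[OF c2 R(1)] by (simp add: rep_def)
  have "shape (aut_matrix (rep (n, i, j, k))) n (int i) (int j) (int k)"
    using shape_Aut_mult[OF c2 R(1) s2 R(2) w] le_1_cases[OF b(6)] by (auto simp: rep_def)
  then have "coords (rep (n, i, j, k)) = ((n mod q, int i mod 2, int j mod 2), int k)"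
    by (rule coords_eqI) (use le_1_cases[OF b(6)] in auto)
  then show "coords (rep (n, i, j, k)) = ((n, int i, int j), int k)"
    using b le_1_cases[OF b(4)] le_1_cases[OF b(5)] by auto
qed

lemma coords_rep_bij: "bij_betw (\<lambda>t. coords (rep t)) reps (carrier H)"
  unfolding bij_betw_def
proof
  show "inj_on (\<lambda>t. coords (rep t)) reps"
  proof (rule inj_onI)
    fix t t' assume t: "t \<in> reps" "t' \<in> reps" "coords (rep t) = coords (rep t')"
    obtain n i j k where e: "t = (n, i, j, k)" by (metis prod_cases4)
    obtain n' i' j' k' where e': "t' = (n', i', j', k')" by (metis prod_cases4)
    show "t = t'" using t coords_rep(2) by (simp add: e e')
  qed
  show "(\<lambda>t. coords (rep t)) ` reps = carrier H"
  proof
    show "(\<lambda>t. coords (rep t)) ` reps \<subseteq> carrier H"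
    proof
      fix h assume "h \<in> (\<lambda>t. coords (rep t)) ` reps"
      then obtain n i j k where "(n, i, j, k) \<in> reps" "h = coords (rep (n, i, j, k))" by auto
      then show "h \<in> carrier H" using coords_rep(1) coords_closed by blast
    qed
    show "carrier H \<subseteq> (\<lambda>t. coords (rep t)) ` reps"
    proof
      fix h assume h: "h \<in> carrier H"
      obtain n i j k where e: "h = ((n, i, j), k)" by (metis prod.exhaust)
      have b: "0 \<le> n" "n < q" "odd n" "i \<in> {0, 1}" "j \<in> {0, 1}" "k \<in> {0, 1}"
        using h by (auto simp: e carrier_H)
      then have "n \<noteq> 0" by auto
      then have "(n, nat i, nat j, nat k) \<in> reps" using b by (auto simp: reps_def)
      then show "h \<in> (\<lambda>t. coords (rep t)) ` reps"
        using coords_rep(2) b by (intro image_eqI[of _ _ "(n, nat i, nat j, nat k)"]) (auto simp: e)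
    qed
  qed
qed

lemma coords_one: "coords \<one>\<^bsub>Aut K\<^esub> = \<one>\<^bsub>H\<^esub>"
proof -
  have "shape (aut_matrix \<one>\<^bsub>Aut K\<^esub>) 1 0 0 0"
    unfolding shape_def aut_matrix_one by (intro exI[of _ 1]) simp
  from coords_eqI[OF this] show ?thesis using q_gt_1 by (simp add: one_H)
qed

lemma rep_closed: "t \<in> reps \<Longrightarrow> rep t \<in> carrier (Aut K)"
  using coords_rep(1) by (cases t) (auto simp: carrier_Aut)

sublocale coords: group_hom "Aut K" H coords
proof (rule group_of_surj_hom)
  show "coords \<in> hom (Aut K) H"
    by (intro homI) (simp_all add: carrier_Aut coords_closed coords_mult)
  show "coords ` carrier (Aut K) = carrier H"
  proof
    show "coords ` carrier (Aut K) \<subseteq> carrier H" using coords_closed by (auto simp: carrier_Aut)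
    have "carrier H = coords ` rep ` reps" using coords_rep_bij by (simp add: bij_betw_def image_image)
    then show "carrier H \<subseteq> coords ` carrier (Aut K)" using rep_closed by auto
  qed
qed (rule group_Aut coords_one)+

lemma kernel_coords: "kernel (Aut K) H coords = A2"
proof -
  have "coords \<psi> = \<one>\<^bsub>H\<^esub> \<longleftrightarrow> aut_matrix \<psi> = (1, 0, 0, 1)" if aut: "\<psi> \<in> auto K" for \<psi>
  proof
    assume c: "coords \<psi> = \<one>\<^bsub>H\<^esub>"
    obtain n i j k where s: "k \<in> {0, 1}" "shape (aut_matrix \<psi>) n i j k" by (rule shape_aut[OF aut])
    then have e: "n mod q = 1" "i mod 2 = 0" "j mod 2 = 0" "k = 0"
      using c coords_eqI[OF s(2,1)] by (auto simp: one_H)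
    have "shape (aut_matrix \<psi>) 1 0 0 0"
      using shape_cong[OF s(2), of 1 0 0] e q_gt_1 by (simp add: Cong.cong_def)
    then obtain n' where "[n' = 1] (mod q)" "[exp_a (\<psi> a) = 1] (mod q)" "[exp_b (\<psi> a) = 0] (mod q)"
      "[exp_a (\<psi> b) = 0] (mod q)" "[exp_b (\<psi> b) = n'] (mod q)"
      by (auto simp: shape_def aut_matrix_def)
    then have "exp_a (\<psi> a) mod q = 1" "exp_b (\<psi> a) mod q = 0" "exp_a (\<psi> b) mod q = 0" "exp_b (\<psi> b) mod q = 1"
      using q_gt_1 by (auto simp: Cong.cong_def)
    then show "aut_matrix \<psi> = (1, 0, 0, 1)" using exp_range by (simp add: aut_matrix_def)
  next
    assume "aut_matrix \<psi> = (1, 0, 0, 1)"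
    then have "shape (aut_matrix \<psi>) 1 0 0 0" unfolding shape_def by (intro exI[of _ 1]) simp
    from coords_eqI[OF this] show "coords \<psi> = \<one>\<^bsub>H\<^esub>" using q_gt_1 by (simp add: one_H)
  qed
  then show ?thesis by (auto simp: kernel_def carrier_Aut A2_iff)
qed

lemma card_reps: "card reps = 2 ^ (m + 1)"
proof -
  have "reps = {n. 1 \<le> n \<and> n < q \<and> odd n} \<times> {..1} \<times> {..1} \<times> {..1}" by (auto simp: reps_def)
  moreover have "{n. 1 \<le> n \<and> n < q \<and> odd n} = (\<lambda>s. 2 * s + 1) ` {0..<r}"
    by (auto simp: q_eq_r elim!: oddE)
  moreover have "card ((\<lambda>s. 2 * s + 1) ` {0..<r}) = 2 ^ (m - 2)"
    by (subst card_image) (auto simp: inj_on_def r_def nat_power_eq)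
  ultimately have "card reps = 2 ^ (m - 2) * 2 ^ 3" by (simp add: card_cartesian_product)
  also have "\<dots> = 2 ^ (m - 2 + 3)" by (simp only: power_add)
  also have "m - 2 + 3 = m + 1" using m_gt_2 by simp
  finally show ?thesis .
qed

end

section \<open>The quotient for m equal to two\<close>

definition bit_matrix :: "int \<times> int \<times> int \<times> int \<Rightarrow> bit ^ 2 ^ 2" where
  "bit_matrix = (\<lambda>(x, y, x', y'). vector [vector [of_bool (odd x), of_bool (odd y)],
     vector [of_bool (odd x'), of_bool (odd y')]])"

lemma bit_matrix_mult:
  "bit_matrix (x, y, x', y') ** bit_matrix (s, t, s', t') =
    bit_matrix (x * s + y * s', x * t + y * t', x' * s + y' * s', x' * t + y' * t')"
  by (simp add: bit_matrix_def vec_eq_iff forall_2 matrix_matrix_mult_def sum_2)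
    (auto simp: of_bool_def)

lemma bit_matrix_eq_iff:
  "bit_matrix (x, y, x', y') = bit_matrix (s, t, s', t') \<longleftrightarrow>
    (odd x \<longleftrightarrow> odd s) \<and> (odd y \<longleftrightarrow> odd t) \<and> (odd x' \<longleftrightarrow> odd s') \<and> (odd y' \<longleftrightarrow> odd t')"
  by (auto simp: bit_matrix_def vec_eq_iff forall_2 of_bool_def split: if_splits)

lemma invertible_bit_matrix: "invertible (bit_matrix (x, y, x', y')) \<longleftrightarrow> odd (x * y' - x' * y)"
  by (auto simp: invertible_det_nz det_2 bit_matrix_def of_bool_def)

lemma bit_matrix_one: "mat 1 = bit_matrix (1, 0, 0, 1)"
  by (simp add: bit_matrix_def vec_eq_iff forall_2 mat_def)

lemma bit_matrix_surj: "\<exists>x y x' y'. M = bit_matrix (x, y, x', y')"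
proof -
  have "of_bool (odd (if e = 1 then 1 else 0 :: int)) = e" for e :: bit
    by (cases "e = 1") auto
  then have "M = bit_matrix (if M $ 1 $ 1 = 1 then 1 else 0, if M $ 1 $ 2 = 1 then 1 else 0,
      if M $ 2 $ 1 = 1 then 1 else 0, if M $ 2 $ 2 = 1 then 1 else 0)"
    by (simp add: bit_matrix_def vec_eq_iff forall_2)
  then show ?thesis by blast
qed

locale K_group_two = K_group +
  assumes m_eq_2: "m = 2"
begin

lemma q_eq_2: "q = 2" and r_eq_1: "r = 1"
  unfolding q_def r_def unfolding m_eq_2 by simp_all

text \<open>For an odd determinant d both \<open>d - 1\<close> and \<open>d + 1\<close> are even, and q = 2.\<close>

lemma aut_condition_iff: "aut_condition x y x' y' \<longleftrightarrow> odd (x * y' - x' * y)"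
  by (auto simp: aut_condition_def admissible_def Let_def q_eq_2)

definition reduction :: "('a \<Rightarrow> 'a) \<Rightarrow> bit ^ 2 ^ 2" where
  "reduction \<psi> = bit_matrix (aut_matrix \<psi>)"

lemma bit_matrix_mod: "bit_matrix (x mod q, y mod q, x' mod q, y' mod q) = bit_matrix (x, y, x', y')"
  by (simp add: bit_matrix_eq_iff q_eq_2)

lemma reduction_mult:
  assumes "\<psi> \<in> auto K" "\<psi>' \<in> auto K"
  shows "reduction (\<psi> \<otimes>\<^bsub>Aut K\<^esub> \<psi>') = reduction \<psi> ** reduction \<psi>'"
proof -
  obtain x y x' y' where M: "aut_matrix \<psi> = (x, y, x', y')" by (metis prod_cases4)
  obtain s t s' t' where M': "aut_matrix \<psi>' = (s, t, s', t')" by (metis prod_cases4)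
  show ?thesis
    unfolding reduction_def aut_matrix_mult[OF assms M M'] M M' bit_matrix_mod bit_matrix_mult ..
qed

definition rep2 :: "nat \<times> nat \<Rightarrow> ('a \<Rightarrow> 'a)" where
  "rep2 = (\<lambda>(i, k). (\<mu> \<otimes>\<^bsub>Aut K\<^esub> \<Phi>) [^]\<^bsub>Aut K\<^esub> i \<otimes>\<^bsub>Aut K\<^esub> \<mu> [^]\<^bsub>Aut K\<^esub> k)"

definition reps2 :: "(nat \<times> nat) set" where
  "reps2 = {(i, k). i \<le> 2 \<and> k \<le> 1}"

lemma reps2_eq: "reps2 = {(0, 0), (1, 0), (2, 0), (0, 1), (1, 1), (2, 1)}"
proof -
  have "reps2 = {..2} \<times> {..1}" by (simp add: reps2_def atMost_def Times_eq_cancel2 set_eq_iff)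
  moreover have "{..2} = {0, 1, 2 :: nat}" "{..1} = {0, 1 :: nat}"
    by (simp_all add: numeral_2_eq_2 atMost_Suc insert_commute)
  ultimately show ?thesis by (simp add: insert_commute)
qed

lemma rep2_auto: "rep2 t \<in> auto K"
proof -
  interpret A: group "Aut K" by (rule group_Aut)
  have "\<mu> \<in> carrier (Aut K)" "\<Phi> \<in> carrier (Aut K)" using mu Phi by (simp_all add: carrier_Aut)
  then have "rep2 t \<in> carrier (Aut K)" by (simp add: rep2_def split: prod.split)
  then show ?thesis by (simp add: carrier_Aut)
qed

lemma reduction_rep2:
  "reduction (rep2 (0, 0)) = bit_matrix (1, 0, 0, 1)" "reduction (rep2 (1, 0)) = bit_matrix (0, 1, 1, 1)"
  "reduction (rep2 (2, 0)) = bit_matrix (1, 1, 1, 0)" "reduction (rep2 (0, 1)) = bit_matrix (0, 1, 1, 0)"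
  "reduction (rep2 (1, 1)) = bit_matrix (1, 0, 1, 1)" "reduction (rep2 (2, 1)) = bit_matrix (1, 1, 0, 1)"
proof -
  interpret A: group "Aut K" by (rule group_Aut)
  define \<sigma> where "\<sigma> = \<mu> \<otimes>\<^bsub>Aut K\<^esub> \<Phi>"
  have c: "\<sigma> \<in> auto K" "\<mu> \<in> auto K" using mu Phi by (simp_all add: \<sigma>_def Aut_closed)
  then have c': "\<sigma> \<in> carrier (Aut K)" "\<mu> \<in> carrier (Aut K)" by (simp_all add: carrier_Aut)
  have m: "aut_matrix \<mu> = (0, 1, 1, 0)" "aut_matrix \<Phi> = (1, 1, 0, 1)"
    using aut_matrix_mu aut_matrix_Phi by (simp_all add: r_eq_1)
  have s: "reduction \<sigma> = bit_matrix (0, 1, 1, 1)" "reduction \<mu> = bit_matrix (0, 1, 1, 0)"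
    by (simp_all only: \<sigma>_def reduction_mult mu Phi) (simp_all add: reduction_def m bit_matrix_mult)
  have s2: "reduction (\<sigma> \<otimes>\<^bsub>Aut K\<^esub> \<sigma>) = bit_matrix (1, 1, 1, 0)"
    by (simp add: reduction_mult c s bit_matrix_mult bit_matrix_eq_iff)
  have one: "reduction \<one>\<^bsub>Aut K\<^esub> = bit_matrix (1, 0, 0, 1)"
    by (simp add: reduction_def aut_matrix_def Aut_one)
  have rep: "rep2 (0, 0) = \<one>\<^bsub>Aut K\<^esub>" "rep2 (1, 0) = \<sigma>" "rep2 (2, 0) = \<sigma> \<otimes>\<^bsub>Aut K\<^esub> \<sigma>"
    "rep2 (0, 1) = \<mu>" "rep2 (1, 1) = \<sigma> \<otimes>\<^bsub>Aut K\<^esub> \<mu>" "rep2 (2, 1) = \<sigma> \<otimes>\<^bsub>Aut K\<^esub> \<sigma> \<otimes>\<^bsub>Aut K\<^esub> \<mu>"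
    using c' unfolding rep2_def \<sigma>_def[symmetric] by (simp_all add: numeral_2_eq_2)
  show "reduction (rep2 (0, 0)) = bit_matrix (1, 0, 0, 1)" "reduction (rep2 (1, 0)) = bit_matrix (0, 1, 1, 1)"
    "reduction (rep2 (2, 0)) = bit_matrix (1, 1, 1, 0)" "reduction (rep2 (0, 1)) = bit_matrix (0, 1, 1, 0)"
    "reduction (rep2 (1, 1)) = bit_matrix (1, 0, 1, 1)" "reduction (rep2 (2, 1)) = bit_matrix (1, 1, 0, 1)"
    unfolding rep by (simp_all add: one s s2 reduction_mult Aut_closed c bit_matrix_mult bit_matrix_eq_iff)
qed

lemma reduction_closed: "\<psi> \<in> auto K \<Longrightarrow> reduction \<psi> \<in> carrier GL"
  using automorphism_condition[of \<psi>]
  by (simp add: GL_def reduction_def aut_matrix_def invertible_bit_matrix aut_condition_iff)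

lemma reduction_rep2_bij: "bij_betw (\<lambda>t. reduction (rep2 t)) reps2 (carrier GL)"
  unfolding bij_betw_def
proof
  show "inj_on (\<lambda>t. reduction (rep2 t)) reps2"
    unfolding reps2_eq by (simp add: reduction_rep2 bit_matrix_eq_iff del: One_nat_def)
  show "(\<lambda>t. reduction (rep2 t)) ` reps2 = carrier GL"
  proof
    show "(\<lambda>t. reduction (rep2 t)) ` reps2 \<subseteq> carrier GL"
      using reduction_closed rep2_auto by blast
    show "carrier GL \<subseteq> (\<lambda>t. reduction (rep2 t)) ` reps2"
    proof
      fix M :: "bit ^ 2 ^ 2" assume "M \<in> carrier GL"
      moreover obtain x y x' y' where M: "M = bit_matrix (x, y, x', y')" using bit_matrix_surj by blast
      ultimately have "odd (x * y' - x' * y)" by (simp add: GL_def invertible_bit_matrix)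
      then have "odd x \<and> odd y' \<and> (even x' \<or> even y) \<or> odd x' \<and> odd y \<and> (even x \<or> even y')" by auto
      then show "M \<in> (\<lambda>t. reduction (rep2 t)) ` reps2"
        unfolding reps2_eq image_insert image_empty reduction_rep2 M insert_iff bit_matrix_eq_iff by auto
    qed
  qed
qed

sublocale reduction: group_hom "Aut K" "GL :: (bit ^ 2 ^ 2) monoid" reduction
proof (rule group_of_surj_hom)
  show "reduction \<in> hom (Aut K) GL"
    using reduction_closed reduction_mult by (intro homI) (simp_all add: carrier_Aut, simp add: GL_def)
  show "reduction ` carrier (Aut K) = carrier GL"
  proof
    show "reduction ` carrier (Aut K) \<subseteq> carrier GL" using reduction_closed by (auto simp: carrier_Aut)
    have "carrier GL = reduction ` rep2 ` reps2"
      using reduction_rep2_bij by (simp add: bij_betw_def image_image)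
    then show "carrier GL \<subseteq> reduction ` carrier (Aut K)" using rep2_auto by (auto simp: carrier_Aut)
  qed
  show "reduction \<one>\<^bsub>Aut K\<^esub> = \<one>\<^bsub>GL\<^esub>"
    by (simp add: reduction_def aut_matrix_def Aut_one GL_def bit_matrix_one)
qed (rule group_Aut)

lemma kernel_reduction: "kernel (Aut K) GL reduction = A2"
proof -
  have bits: "s = 0 \<or> s = 1" if "0 \<le> s" "s < q" for s
    using that unfolding q_eq_2 by presburger
  have eq: "reduction \<psi> = \<one>\<^bsub>GL\<^esub> \<longleftrightarrow> aut_matrix \<psi> = (1, 0, 0, 1)" for \<psi>
    using bits[OF exp_range(1,2)[of "\<psi> a"]] bits[OF exp_range(3,4)[of "\<psi> a"]]
      bits[OF exp_range(1,2)[of "\<psi> b"]] bits[OF exp_range(3,4)[of "\<psi> b"]]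
    by (elim disjE) (simp_all add: reduction_def GL_def bit_matrix_one aut_matrix_def bit_matrix_eq_iff)
  show ?thesis unfolding kernel_def carrier_Aut eq using A2_iff by blast
qed

lemma rep2_closed: "rep2 t \<in> carrier (Aut K)"
  using rep2_auto by (simp add: carrier_Aut)

text \<open>An automorphism of the four-group \<open>K/Z\<^sub>2(K)\<close> sends the classes of a and b to distinct
  nontrivial classes, and these have odd determinant.\<close>

lemma induced_aut_surj:
  "induced_aut K (upper_central K 2) ` carrier (Aut K) = carrier (Aut (K Mod upper_central K 2))"
proof -
  let ?Z = "upper_central K 2"
  let ?Q = "K Mod ?Z"
  interpret Z: characteristic_subgroup ?Z K by (rule characteristic_upper_central)
  interpret Q: group ?Q by (rule Z.factorgroup_is_group)
  interpret I: group_hom "Aut K" "Aut ?Q" "induced_aut K ?Z" by (rule Z.group_hom_induced_aut)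
  have "\<theta> \<in> induced_aut K ?Z ` carrier (Aut K)" if \<theta>: "\<theta> \<in> auto ?Q" for \<theta>
  proof -
    interpret \<theta>: group_hom ?Q ?Q \<theta> by (rule Q.auto_group_hom[OF \<theta>])
    have inj: "inj_on \<theta> (carrier ?Q)" using auto_bij[OF \<theta>] by (simp add: bij_betw_def)
    have cl: "?Z #> g \<in> carrier ?Q" if "g \<in> carrier K" for g
      using that by (auto simp: carrier_FactGroup)
    have "\<theta> (?Z #> a) \<in> carrier ?Q" "\<theta> (?Z #> b) \<in> carrier ?Q" using cl by auto
    then obtain g h where gh: "g \<in> carrier K" "\<theta> (?Z #> a) = ?Z #> g" "h \<in> carrier K" "\<theta> (?Z #> b) = ?Z #> h"
      by (auto simp: carrier_FactGroup)
    have one: "?Z #> \<one> = \<one>\<^bsub>?Q\<^esub>" using Z.subset by simp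
    have e1: "exp_a \<one> = 0" "exp_b \<one> = 0" using exp_E[of 0 0 0] by (simp_all add: E_0)
    have ne: "?Z #> a \<noteq> ?Z #> b" "?Z #> a \<noteq> ?Z #> \<one>" "?Z #> b \<noteq> ?Z #> \<one>"
      by (simp_all add: coset_Z2_eq_iff e1 del: coset_mult_one)
    have "?Z #> g \<noteq> ?Z #> h" using inj_onD[OF inj _ cl cl, of a b] ne(1) gh by auto
    moreover have "?Z #> g \<noteq> ?Z #> \<one>"
      using inj_onD[OF inj _ cl cl, of a \<one>] ne(2) gh one \<theta>.hom_one by auto
    moreover have "?Z #> h \<noteq> ?Z #> \<one>"
      using inj_onD[OF inj _ cl cl, of b \<one>] ne(3) gh one \<theta>.hom_one by auto
    ultimately have d: "\<not> (exp_a g = exp_a h \<and> exp_b g = exp_b h)" "\<not> (exp_a g = 0 \<and> exp_b g = 0)"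
      "\<not> (exp_a h = 0 \<and> exp_b h = 0)"
      using gh(1,3) by (simp_all add: coset_Z2_eq_iff e1 del: coset_mult_one)
    have bits: "s = 0 \<or> s = 1" if "0 \<le> s" "s < q" for s
      using that unfolding q_eq_2 by presburger
    have "odd (exp_a g * exp_b h - exp_a h * exp_b g)"
      using d bits[OF exp_range(1,2)[of g]] bits[OF exp_range(3,4)[of g]]
        bits[OF exp_range(1,2)[of h]] bits[OF exp_range(3,4)[of h]] by (elim disjE) simp_all
    then obtain \<psi> where \<psi>: "\<psi> \<in> auto K" "\<psi> a = g" "\<psi> b = h"
      using automorphism_exists[OF gh(1,3)] aut_condition_iff by blast
    have "(\<lambda>x. ?Z #> x) \<in> hom K ?Q" by (rule Z.r_coset_hom_Mod)
    then interpret N: group_hom K ?Q "\<lambda>x. ?Z #> x"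
      by (simp add: group_hom_def group_hom_axioms_def)
    interpret \<psi>: group_hom K K \<psi> by (rule auto_group_hom[OF \<psi>(1)])
    have eq: "\<theta> (?Z #> x) = ?Z #> \<psi> x" if x: "x \<in> carrier K" for x
    proof -
      obtain s t w where e: "x = E (s, t, w)" by (rule obtain_E[OF x])
      show ?thesis
        by (simp add: e E_def c_def N.hom_int_pow \<theta>.hom_int_pow \<psi>.hom_int_pow N.hom_mult \<theta>.hom_mult
            \<psi>.hom_mult N.hom_commutator \<theta>.hom_commutator \<psi>.hom_commutator N.hom_closed gh \<psi> del: mult_FactGroup)
    qed
    have "induced_aut K ?Z \<psi> = \<theta>"
    proof (rule auto_eqI[OF Z.induced_aut_closed[OF \<psi>(1)] \<theta>])
      fix C assume "C \<in> carrier ?Q"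
      then obtain x where "x \<in> carrier K" "C = ?Z #> x" by (auto simp: carrier_FactGroup)
      then show "induced_aut K ?Z \<psi> C = \<theta> C" using eq \<psi>(1) by (simp add: Z.induced_aut_coset)
    qed
    then show ?thesis using \<psi>(1) by (auto simp: carrier_Aut)
  qed
  moreover have "induced_aut K ?Z ` carrier (Aut K) \<subseteq> carrier (Aut ?Q)"
    using Z.induced_aut_closed by (auto simp: carrier_Aut)
  ultimately show ?thesis by (auto simp: carrier_Aut)
qed

end

section \<open>The structure of the automorphism group\<close>

context K_group
begin

lemma f_closed: "odd n \<Longrightarrow> f n \<in> carrier (Aut K)"
  by (rule f_exists) (simp_all add: carrier_Aut)

lemma K_S_closed: "K_S K a b m \<subseteq> carrier (Aut K)"
  using f_closed unfolding K_S_def by blast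

lemma one_in_K_S: "\<one>\<^bsub>Aut K\<^esub> \<in> K_S K a b m"
  unfolding K_S_def using f_1 by (intro CollectI exI[of _ 1]) simp

lemma mu_Phi_closed: "{\<mu>, \<Phi>} \<subseteq> carrier (Aut K)"
  using mu Phi by (simp add: carrier_Aut)

text \<open>The kernel factor on the left does not affect the induced automorphism.\<close>

lemma Aut_decomposition:
  assumes "\<And>\<psi>. \<psi> \<in> carrier (Aut K) \<Longrightarrow>
    \<exists>g s w. g \<in> A2 \<and> s \<in> K_S K a b m \<and> w \<in> generate (Aut K) {\<mu>, \<Phi>} \<and> \<psi> = g \<otimes>\<^bsub>Aut K\<^esub> s \<otimes>\<^bsub>Aut K\<^esub> w"
  shows "carrier (Aut K) = A2 <#>\<^bsub>Aut K\<^esub> K_S K a b m <#>\<^bsub>Aut K\<^esub> generate (Aut K) {\<mu>, \<Phi>}"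
    and "induced_aut K (upper_central K 2) ` carrier (Aut K) =
      induced_aut K (upper_central K 2) ` (K_S K a b m <#>\<^bsub>Aut K\<^esub> generate (Aut K) {\<mu>, \<Phi>})"
proof -
  interpret Z: characteristic_subgroup "upper_central K 2" K by (rule characteristic_upper_central)
  interpret I: group_hom "Aut K" "Aut (K Mod upper_central K 2)" "induced_aut K (upper_central K 2)"
    by (rule Z.group_hom_induced_aut)
  let ?S = "K_S K a b m" and ?W = "generate (Aut K) {\<mu>, \<Phi>}"
  have W: "?W \<subseteq> carrier (Aut K)" using I.G.generate_incl[OF mu_Phi_closed] .
  have A2: "A2 \<subseteq> carrier (Aut K)" by (auto simp: A2_iff carrier_Aut)
  show "carrier (Aut K) = A2 <#>\<^bsub>Aut K\<^esub> ?S <#>\<^bsub>Aut K\<^esub> ?W"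
  proof
    show "carrier (Aut K) \<subseteq> A2 <#>\<^bsub>Aut K\<^esub> ?S <#>\<^bsub>Aut K\<^esub> ?W"
    proof
      fix \<psi> assume "\<psi> \<in> carrier (Aut K)"
      from assms[OF this] obtain g s w where "g \<in> A2" "s \<in> ?S" "w \<in> ?W" and
        e: "\<psi> = g \<otimes>\<^bsub>Aut K\<^esub> s \<otimes>\<^bsub>Aut K\<^esub> w" by blast
      then show "\<psi> \<in> A2 <#>\<^bsub>Aut K\<^esub> ?S <#>\<^bsub>Aut K\<^esub> ?W"
        unfolding e set_mult_def by blast
    qed
    show "A2 <#>\<^bsub>Aut K\<^esub> ?S <#>\<^bsub>Aut K\<^esub> ?W \<subseteq> carrier (Aut K)"
      by (rule I.G.set_mult_closed[OF I.G.set_mult_closed[OF A2 K_S_closed] W])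
  qed
  show "induced_aut K (upper_central K 2) ` carrier (Aut K) = induced_aut K (upper_central K 2) ` (?S <#>\<^bsub>Aut K\<^esub> ?W)"
  proof
    show "induced_aut K (upper_central K 2) ` (?S <#>\<^bsub>Aut K\<^esub> ?W) \<subseteq> induced_aut K (upper_central K 2) ` carrier (Aut K)"
      by (rule image_mono[OF I.G.set_mult_closed[OF K_S_closed W]])
    show "induced_aut K (upper_central K 2) ` carrier (Aut K) \<subseteq> induced_aut K (upper_central K 2) ` (?S <#>\<^bsub>Aut K\<^esub> ?W)"
    proof
      fix y assume "y \<in> induced_aut K (upper_central K 2) ` carrier (Aut K)"
      then obtain \<psi> where \<psi>: "\<psi> \<in> carrier (Aut K)" "y = induced_aut K (upper_central K 2) \<psi>" by blast
      obtain g s w where d: "g \<in> A2" "s \<in> ?S" "w \<in> ?W" "\<psi> = g \<otimes>\<^bsub>Aut K\<^esub> s \<otimes>\<^bsub>Aut K\<^esub> w"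
        using assms[OF \<psi>(1)] by blast
      have c: "g \<in> carrier (Aut K)" "s \<in> carrier (Aut K)" "w \<in> carrier (Aut K)"
        using d A2 K_S_closed W by blast+
      have "induced_aut K (upper_central K 2) g = \<one>\<^bsub>Aut (K Mod upper_central K 2)\<^esub>"
        using d(1) by (simp add: Aut_i_def kernel_def)
      then have "y = induced_aut K (upper_central K 2) (s \<otimes>\<^bsub>Aut K\<^esub> w)"
        using c by (simp add: \<psi>(2) d(4) I.G.m_assoc)
      then show "y \<in> induced_aut K (upper_central K 2) ` (?S <#>\<^bsub>Aut K\<^esub> ?W)"
        using d(2,3) unfolding set_mult_def by blast
    qed
  qed
qed

lemma generate_closed_pow:
  assumes "w \<in> generate (Aut K) {\<mu>, \<Phi>}" shows "w [^]\<^bsub>Aut K\<^esub> (n::nat) \<in> generate (Aut K) {\<mu>, \<Phi>}"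
proof -
  interpret A: group "Aut K" by (rule group_Aut)
  show ?thesis
    by (induction n) (auto intro: generate.one generate.eng assms)
qed

lemma conj_Phi_in_generate: "conj_by (Aut K) \<Phi> \<mu> \<in> generate (Aut K) {\<mu>, \<Phi>}"
  unfolding conj_by_def by (intro generate.eng generate.inv generate.incl) auto

end

lemma (in K_group_large) rep_factorisation:
  assumes "g \<in> carrier (Aut K)" "(n, i, j, k) \<in> reps"
  shows "g \<otimes>\<^bsub>Aut K\<^esub> rep (n, i, j, k) = g \<otimes>\<^bsub>Aut K\<^esub> f n \<otimes>\<^bsub>Aut K\<^esub> \<Phi> [^]\<^bsub>Aut K\<^esub> i
    \<otimes>\<^bsub>Aut K\<^esub> conj_by (Aut K) \<Phi> \<mu> [^]\<^bsub>Aut K\<^esub> j \<otimes>\<^bsub>Aut K\<^esub> \<mu> [^]\<^bsub>Aut K\<^esub> k"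
proof -
  have "odd n" using assms(2) by (simp add: reps_def)
  then have "f n \<in> carrier (Aut K)" by (rule f_closed)
  moreover have "\<mu> \<in> carrier (Aut K)" "\<Phi> \<in> carrier (Aut K)" "conj_by (Aut K) \<Phi> \<mu> \<in> carrier (Aut K)"
    using mu Phi conj_Phi by (simp_all add: carrier_Aut)
  ultimately show ?thesis using assms(1) by (simp add: rep_def coords.G.m_assoc)
qed

lemma (in K_group_large) Aut_structure:
  shows "Aut K Mod A2 \<cong> units_semidirect (2 ^ (m - 1))"
    and "Coset.order (Aut K) = 2 ^ (7 * m - 1)"
    and "\<psi> \<in> carrier (Aut K) \<Longrightarrow> \<exists>!(g, n :: int, i :: nat, j :: nat, k :: nat).
      g \<in> A2 \<and> 1 \<le> n \<and> n < 2 ^ (m - 1) \<and> odd n \<and> i \<le> 1 \<and> j \<le> 1 \<and> k \<le> 1 \<and>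
      \<psi> = g \<otimes>\<^bsub>Aut K\<^esub> f n \<otimes>\<^bsub>Aut K\<^esub> \<Phi> [^]\<^bsub>Aut K\<^esub> i
        \<otimes>\<^bsub>Aut K\<^esub> conj_by (Aut K) \<Phi> \<mu> [^]\<^bsub>Aut K\<^esub> j \<otimes>\<^bsub>Aut K\<^esub> \<mu> [^]\<^bsub>Aut K\<^esub> k"
    and "\<psi> \<in> carrier (Aut K) \<Longrightarrow> \<exists>g s w. g \<in> A2 \<and> s \<in> K_S K a b m \<and>
      w \<in> generate (Aut K) {\<mu>, \<Phi>} \<and> \<psi> = g \<otimes>\<^bsub>Aut K\<^esub> s \<otimes>\<^bsub>Aut K\<^esub> w"
proof -
  show "Aut K Mod A2 \<cong> units_semidirect (2 ^ (m - 1))"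
    unfolding q_def[symmetric] kernel_coords[symmetric]
    by (rule coords.surj_kernel_transversal[OF rep_closed coords_rep_bij])
  have "Coset.order (Aut K) = card A2 * card reps"
    unfolding kernel_coords[symmetric] by (rule coords.order_kernel_transversal[OF rep_closed coords_rep_bij])
  also have "\<dots> = 2 ^ (6 * m - 2) * 2 ^ (m + 1)" by (simp only: card_A2 card_reps)
  also have "\<dots> = 2 ^ (6 * m - 2 + (m + 1))" by (simp only: power_add)
  also have "6 * m - 2 + (m + 1) = 7 * m - 1" using m_gt_2 by simp
  finally show "Coset.order (Aut K) = 2 ^ (7 * m - 1)" .
  assume \<psi>: "\<psi> \<in> carrier (Aut K)"
  have unique: "\<exists>!p. fst p \<in> A2 \<and> snd p \<in> reps \<and> \<psi> = fst p \<otimes>\<^bsub>Aut K\<^esub> rep (snd p)"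
    unfolding kernel_coords[symmetric] by (rule coords.kernel_transversal[OF rep_closed coords_rep_bij \<psi>])
  have A2: "g \<in> carrier (Aut K)" if "g \<in> A2" for g using that by (simp add: A2_iff carrier_Aut)
  have eq: "(\<lambda>(g, n, i, j, k). g \<in> A2 \<and> 1 \<le> n \<and> n < 2 ^ (m - 1) \<and> odd n \<and> i \<le> 1 \<and> j \<le> 1 \<and> k \<le> 1 \<and>
      \<psi> = g \<otimes>\<^bsub>Aut K\<^esub> f n \<otimes>\<^bsub>Aut K\<^esub> \<Phi> [^]\<^bsub>Aut K\<^esub> i
        \<otimes>\<^bsub>Aut K\<^esub> conj_by (Aut K) \<Phi> \<mu> [^]\<^bsub>Aut K\<^esub> j \<otimes>\<^bsub>Aut K\<^esub> \<mu> [^]\<^bsub>Aut K\<^esub> k) =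
    (\<lambda>p. fst p \<in> A2 \<and> snd p \<in> reps \<and> \<psi> = fst p \<otimes>\<^bsub>Aut K\<^esub> rep (snd p))" (is "?R = ?R'")
  proof
    fix p :: "('a \<Rightarrow> 'a) \<times> int \<times> nat \<times> nat \<times> nat"
    obtain g n i j k where p: "p = (g, n, i, j, k)" by (metis prod_cases5)
    have "(n, i, j, k) \<in> reps \<longleftrightarrow> 1 \<le> n \<and> n < 2 ^ (m - 1) \<and> odd n \<and> i \<le> 1 \<and> j \<le> 1 \<and> k \<le> 1"
      by (simp add: reps_def q_def)
    then show "?R p = ?R' p"
      unfolding p prod.case fst_conv snd_conv using rep_factorisation[OF A2] by metis
  qed
  show "\<exists>!(g, n :: int, i :: nat, j :: nat, k :: nat).
      g \<in> A2 \<and> 1 \<le> n \<and> n < 2 ^ (m - 1) \<and> odd n \<and> i \<le> 1 \<and> j \<le> 1 \<and> k \<le> 1 \<and>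
      \<psi> = g \<otimes>\<^bsub>Aut K\<^esub> f n \<otimes>\<^bsub>Aut K\<^esub> \<Phi> [^]\<^bsub>Aut K\<^esub> i
        \<otimes>\<^bsub>Aut K\<^esub> conj_by (Aut K) \<Phi> \<mu> [^]\<^bsub>Aut K\<^esub> j \<otimes>\<^bsub>Aut K\<^esub> \<mu> [^]\<^bsub>Aut K\<^esub> k"
    unfolding eq by (rule unique)
  obtain g n i j k where p: "g \<in> A2" "(n, i, j, k) \<in> reps" "\<psi> = g \<otimes>\<^bsub>Aut K\<^esub> rep (n, i, j, k)"
    using ex1_implies_ex[OF unique] by auto
  let ?w = "\<Phi> [^]\<^bsub>Aut K\<^esub> i \<otimes>\<^bsub>Aut K\<^esub> conj_by (Aut K) \<Phi> \<mu> [^]\<^bsub>Aut K\<^esub> j \<otimes>\<^bsub>Aut K\<^esub> \<mu> [^]\<^bsub>Aut K\<^esub> k"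
  have n: "odd n" using p(2) by (simp add: reps_def)
  then have f: "f n \<in> carrier (Aut K)" "f n \<in> K_S K a b m"
    using f_closed unfolding K_S_def by blast+
  have w: "?w \<in> generate (Aut K) {\<mu>, \<Phi>}"
    by (intro generate.eng generate_closed_pow conj_Phi_in_generate generate.incl) auto
  have "\<psi> = g \<otimes>\<^bsub>Aut K\<^esub> f n \<otimes>\<^bsub>Aut K\<^esub> ?w"
    unfolding p(3) rep_factorisation[OF A2[OF p(1)] p(2)]
    using f(1) A2[OF p(1)] mu Phi conj_Phi by (simp add: coords.G.m_assoc carrier_Aut[symmetric])
  then show "\<exists>g s w. g \<in> A2 \<and> s \<in> K_S K a b m \<and>
      w \<in> generate (Aut K) {\<mu>, \<Phi>} \<and> \<psi> = g \<otimes>\<^bsub>Aut K\<^esub> s \<otimes>\<^bsub>Aut K\<^esub> w"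
    using p(1) f(2) w by blast
qed

lemma (in K_group_two) rep2_factorisation:
  assumes "g \<in> carrier (Aut K)"
  shows "g \<otimes>\<^bsub>Aut K\<^esub> rep2 (i, k) =
    g \<otimes>\<^bsub>Aut K\<^esub> (\<mu> \<otimes>\<^bsub>Aut K\<^esub> \<Phi>) [^]\<^bsub>Aut K\<^esub> i \<otimes>\<^bsub>Aut K\<^esub> \<mu> [^]\<^bsub>Aut K\<^esub> k"
proof -
  have "\<mu> \<in> carrier (Aut K)" "\<Phi> \<in> carrier (Aut K)" using mu Phi by (simp_all add: carrier_Aut)
  then show ?thesis using assms by (simp add: rep2_def reduction.G.m_assoc)
qed

lemma (in K_group_two) Aut_structure:
  shows "Aut K Mod A2 \<cong> (GL :: (bit ^ 2 ^ 2) monoid)"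
    and "Coset.order (Aut K) = 2 ^ 11 * 3"
    and "\<psi> \<in> carrier (Aut K) \<Longrightarrow> \<exists>!(g, i :: nat, k :: nat). g \<in> A2 \<and> i \<le> 2 \<and> k \<le> 1 \<and>
      \<psi> = g \<otimes>\<^bsub>Aut K\<^esub> (\<mu> \<otimes>\<^bsub>Aut K\<^esub> \<Phi>) [^]\<^bsub>Aut K\<^esub> i \<otimes>\<^bsub>Aut K\<^esub> \<mu> [^]\<^bsub>Aut K\<^esub> k"
    and "\<psi> \<in> carrier (Aut K) \<Longrightarrow> \<exists>g s w. g \<in> A2 \<and> s \<in> K_S K a b m \<and>
      w \<in> generate (Aut K) {\<mu>, \<Phi>} \<and> \<psi> = g \<otimes>\<^bsub>Aut K\<^esub> s \<otimes>\<^bsub>Aut K\<^esub> w"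
proof -
  show "Aut K Mod A2 \<cong> (GL :: (bit ^ 2 ^ 2) monoid)"
    unfolding kernel_reduction[symmetric]
    by (rule reduction.surj_kernel_transversal[OF rep2_closed reduction_rep2_bij])
  have "Coset.order (Aut K) = card A2 * card reps2"
    unfolding kernel_reduction[symmetric]
    by (rule reduction.order_kernel_transversal[OF rep2_closed reduction_rep2_bij])
  moreover have "card reps2 = 6" by (simp add: reps2_eq)
  ultimately show "Coset.order (Aut K) = 2 ^ 11 * 3" by (simp add: card_A2 m_eq_2)
  assume \<psi>: "\<psi> \<in> carrier (Aut K)"
  have unique: "\<exists>!p. fst p \<in> A2 \<and> snd p \<in> reps2 \<and> \<psi> = fst p \<otimes>\<^bsub>Aut K\<^esub> rep2 (snd p)"
    unfolding kernel_reduction[symmetric] by (rule reduction.kernel_transversal[OF rep2_closed reduction_rep2_bij \<psi>])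
  have A2: "g \<in> carrier (Aut K)" if "g \<in> A2" for g using that by (simp add: A2_iff carrier_Aut)
  have eq: "(\<lambda>(g, i, k). g \<in> A2 \<and> i \<le> 2 \<and> k \<le> 1 \<and>
      \<psi> = g \<otimes>\<^bsub>Aut K\<^esub> (\<mu> \<otimes>\<^bsub>Aut K\<^esub> \<Phi>) [^]\<^bsub>Aut K\<^esub> i \<otimes>\<^bsub>Aut K\<^esub> \<mu> [^]\<^bsub>Aut K\<^esub> k) =
    (\<lambda>p. fst p \<in> A2 \<and> snd p \<in> reps2 \<and> \<psi> = fst p \<otimes>\<^bsub>Aut K\<^esub> rep2 (snd p))" (is "?R = ?R'")
  proof
    fix p :: "('a \<Rightarrow> 'a) \<times> nat \<times> nat"
    obtain g i k where p: "p = (g, i, k)" by (metis prod_cases3)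
    have "(i, k) \<in> reps2 \<longleftrightarrow> i \<le> 2 \<and> k \<le> 1" by (simp add: reps2_def)
    then show "?R p = ?R' p"
      unfolding p prod.case fst_conv snd_conv using rep2_factorisation[OF A2] by metis
  qed
  show "\<exists>!(g, i :: nat, k :: nat). g \<in> A2 \<and> i \<le> 2 \<and> k \<le> 1 \<and>
      \<psi> = g \<otimes>\<^bsub>Aut K\<^esub> (\<mu> \<otimes>\<^bsub>Aut K\<^esub> \<Phi>) [^]\<^bsub>Aut K\<^esub> i \<otimes>\<^bsub>Aut K\<^esub> \<mu> [^]\<^bsub>Aut K\<^esub> k"
    unfolding eq by (rule unique)
  obtain g i k where p: "g \<in> A2" "\<psi> = g \<otimes>\<^bsub>Aut K\<^esub> rep2 (i, k)"
    using ex1_implies_ex[OF unique] by auto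
  have "rep2 (i, k) \<in> generate (Aut K) {\<mu>, \<Phi>}"
    unfolding rep2_def prod.case by (intro generate.eng generate_closed_pow generate.incl) auto
  moreover have "\<psi> = g \<otimes>\<^bsub>Aut K\<^esub> \<one>\<^bsub>Aut K\<^esub> \<otimes>\<^bsub>Aut K\<^esub> rep2 (i, k)"
    using p(2) A2[OF p(1)] by simp
  ultimately show "\<exists>g s w. g \<in> A2 \<and> s \<in> K_S K a b m \<and>
      w \<in> generate (Aut K) {\<mu>, \<Phi>} \<and> \<psi> = g \<otimes>\<^bsub>Aut K\<^esub> s \<otimes>\<^bsub>Aut K\<^esub> w"
    using p(1) one_in_K_S by blast
qed

theorem theorem5p13:
  fixes K :: "('g, 'z) monoid_scheme" and a b :: 'g and m :: nat and l :: int
  assumes "m > 1" and "odd l"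
    and "has_presentation K (case_gen2 a b) (K_relators m l)"
  shows
    "let A = Aut K; Q = K Mod upper_central K 2; P = induced_aut K (upper_central K 2);
         A2 = Aut_i K 2; \<mu> = K_mu K a b; \<Phi> = K_Phi K a b m; f = K_f K a b m; S = K_S K a b m
     in group_hom A (Aut Q) P \<and>
        kernel A (Aut Q) P = A2 \<and>
        P ` carrier A = P ` (S <#>\<^bsub>A\<^esub> generate A {\<mu>, \<Phi>}) \<and>
        carrier A = A2 <#>\<^bsub>A\<^esub> S <#>\<^bsub>A\<^esub> generate A {\<mu>, \<Phi>} \<and>
        (m > 2 \<longrightarrow> A Mod A2 \<cong> units_semidirect (2 ^ (m - 1))) \<and>
        (m = 2 \<longrightarrow> A Mod A2 \<cong> (GL :: (bit ^ 2 ^ 2) monoid)) \<and>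
        (m > 2 \<longrightarrow> Coset.order A = 2 ^ (7 * m - 1)) \<and>
        (m = 2 \<longrightarrow> Coset.order A = 2 ^ 11 * 3 \<and> P ` carrier A = carrier (Aut Q)) \<and>
        (m > 2 \<longrightarrow>
           (\<forall>\<psi> \<in> carrier A. \<exists>!(g, n :: int, i :: nat, j :: nat, k :: nat).
              g \<in> A2 \<and> 1 \<le> n \<and> n < 2 ^ (m - 1) \<and> odd n \<and> i \<le> 1 \<and> j \<le> 1 \<and> k \<le> 1 \<and>
              \<psi> = g \<otimes>\<^bsub>A\<^esub> f n \<otimes>\<^bsub>A\<^esub> \<Phi> [^]\<^bsub>A\<^esub> i \<otimes>\<^bsub>A\<^esub> conj_by A \<Phi> \<mu> [^]\<^bsub>A\<^esub> j \<otimes>\<^bsub>A\<^esub> \<mu> [^]\<^bsub>A\<^esub> k)) \<and>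
        (m = 2 \<longrightarrow>
           (\<forall>\<psi> \<in> carrier A. \<exists>!(g, i :: nat, k :: nat).
              g \<in> A2 \<and> i \<le> 2 \<and> k \<le> 1 \<and>
              \<psi> = g \<otimes>\<^bsub>A\<^esub> (\<mu> \<otimes>\<^bsub>A\<^esub> \<Phi>) [^]\<^bsub>A\<^esub> i \<otimes>\<^bsub>A\<^esub> \<mu> [^]\<^bsub>A\<^esub> k))"
proof -
  interpret group K by (rule K_presentation_relations(1)[OF assms(3)])
  interpret K_group m l K a b by unfold_locales (rule assms)+
  interpret Z: characteristic_subgroup "upper_central K 2" K by (rule characteristic_upper_central)
  have large: "K_group_large m l K a b" if "m > 2"
    by (intro K_group_large.intro K_group_large_axioms.intro K_group_axioms that)
  have two: "K_group_two m l K a b" if "m = 2"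
    by (intro K_group_two.intro K_group_two_axioms.intro K_group_axioms that)
  have dec: "\<exists>g s w. g \<in> Aut_i K 2 \<and> s \<in> K_S K a b m \<and> w \<in> generate (Aut K) {K_mu K a b, K_Phi K a b m} \<and>
      \<psi> = g \<otimes>\<^bsub>Aut K\<^esub> s \<otimes>\<^bsub>Aut K\<^esub> w" if \<psi>: "\<psi> \<in> carrier (Aut K)" for \<psi>
  proof (cases "m = 2")
    case True
    then show ?thesis by (rule K_group_two.Aut_structure(4)[OF two \<psi>])
  next
    case False
    then have "m > 2" using assms(1) by simp
    then show ?thesis by (rule K_group_large.Aut_structure(4)[OF large \<psi>])
  qed
  show ?thesis
    unfolding Let_def
    using Z.group_hom_induced_aut Aut_decomposition[OF dec] K_group_large.Aut_structure(1-3)[OF large]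
      K_group_two.Aut_structure(1-3)[OF two] K_group_two.induced_aut_surj[OF two]
    by (intro conjI impI ballI) (simp_all only: Aut_i_def[symmetric])
qed

end
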